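(* Let $G$ be a chordal graph and $r \geq 2$. The following are equivalent: (1) $\Sigma_r(G)$ is vertex decomposable; (2) $\Sigma_r(G)$ is shellable; (3) $\Sigma_r(G)$ is Cohen–Macaulay (over a field $\mathbb K$); (4) $G$ is $r$-gap-free; (5) the clutter $\mathrm{Con}_r(G)$ is co-chordal.
   Context: A graph is chordal if it has no induced cycle of length $\ge 4$. $\mathrm{Con}_r(G)$ is the $r$-uniform clutter on $V(G)$ whose circuits are the $r$-subsets $W$ with $G[W]$ connected; $\Sigma_r(G)$ is the simplicial complex generated by $V(G)\setminus W$ for such $W$. An induced matching of a clutter $\mathcal H$ is a set $M$ of pairwise disjoint circuits such that the circuits of $\mathcal H$ contained in $\bigcup M$ are exactly those of $M$; $G$ is $r$-gap-free if every induced matching of $\mathrm{Con}_r(G)$ has at most one element. For a $d$-uniform clutter $\mathcal H$: a clique is a vertex set all of whose $d$-subsets are circuits; for $Z\subseteq V(\mathcal H)$, $\mathcal N_{\mathcal H}(Z)=\{x\notin Z: x\in \mathcal E\subseteq Z\cup\{x\}\text{ for some circuit }\mathcal E\}$ and $\mathcal N_{\mathcal H}[Z]=\mathcal N_{\mathcal H}(Z)\cup Z$; a $(d-1)$-subset $Z$ is a simplicial maximal subcircuit if $\mathcal N_{\mathcal H}[Z]$ is a clique; $\mathcal H\setminus_d Z$ is the clutter on $V(\mathcal H)$ with circuits those of $\mathcal H$ not containing $Z$. $\mathcal H$ is chordal if it has no circuits or has a simplicial maximal subcircuit $Z$ with $\mathcal H\setminus_d Z$ chordal. $\mathcal H$ is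 co-chordal if its complement (same vertices, circuits the $d$-subsets that are not circuits of $\mathcal H$) is chordal. Vertex decomposable: simplex, empty or void complex, or a vertex $x$ with link and deletion vertex decomposable and every facet of the deletion a facet of the complex. Shellable: facets ordered $F_1,\dots,F_s$ with $\langle F_i\rangle\cap\langle F_1,\dots,F_{i-1}\rangle$ pure of dimension $\dim F_i-1$ for $i\ge2$. *)

theory Defs
  imports
    "Graph_Theory.Digraph_Component"
    "HOL-Algebra.QuotRing"
    "HOL-Library.Poly_Mapping"
    "HOL-Library.Extended_Nat"
begin

section \<open>Chordal graphs\<close>

text \<open>A finite simple graph is an instance of the locale \<^locale>\<open>graph\<close>: a finite symmetric digraph
  without loops and multiple arcs.\<close>

definition induced_cycle :: "('v, 'e) pre_digraph \<Rightarrow> 'v list \<Rightarrow> bool" where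
  "induced_cycle G c \<longleftrightarrow>
     length c \<ge> 3 \<and> distinct c \<and> set c \<subseteq> verts G \<and>
     (\<forall>i<length c. \<forall>j<length c. c ! i \<rightarrow>\<^bsub>G\<^esub> c ! j \<longleftrightarrow>
        j = Suc i mod length c \<or> i = Suc j mod length c)"

definition chordal_graph :: "('v, 'e) pre_digraph \<Rightarrow> bool" where
  "chordal_graph G \<longleftrightarrow> \<not> (\<exists>c. induced_cycle G c \<and> length c \<ge> 4)"


section \<open>Clutters\<close>

text \<open>A \<open>d\<close>-uniform clutter on a vertex set \<open>V\<close> is given by \<open>d\<close>, \<open>V\<close> and its set of circuits, a
  family of \<open>d\<close>-subsets of \<open>V\<close>.\<close>

definition Con :: "nat \<Rightarrow> ('v, 'e) pre_digraph \<Rightarrow> 'v set set" where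
  "Con r G = {W. W \<subseteq> verts G \<and> card W = r \<and> connected (G \<restriction> W)}"

definition induced_matching :: "'v set set \<Rightarrow> 'v set set \<Rightarrow> bool" where
  "induced_matching H M \<longleftrightarrow> M \<subseteq> H \<and> disjoint M \<and> {C \<in> H. C \<subseteq> \<Union>M} = M"

definition gap_free :: "nat \<Rightarrow> ('v, 'e) pre_digraph \<Rightarrow> bool" where
  "gap_free r G \<longleftrightarrow> (\<forall>M. induced_matching (Con r G) M \<longrightarrow> finite M \<and> card M \<le> 1)"

definition clutter_clique :: "nat \<Rightarrow> 'v set set \<Rightarrow> 'v set \<Rightarrow> bool" where
  "clutter_clique d H K \<longleftrightarrow> (\<forall>C. C \<subseteq> K \<and> card C = d \<longrightarrow> C \<in> H)"

definition open_nbhd :: "'v set set \<Rightarrow> 'v set \<Rightarrow> 'v set" where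
  "open_nbhd H Z = {x. x \<notin> Z \<and> (\<exists>C\<in>H. x \<in> C \<and> C \<subseteq> Z \<union> {x})}"

definition closed_nbhd :: "'v set set \<Rightarrow> 'v set \<Rightarrow> 'v set" where
  "closed_nbhd H Z = open_nbhd H Z \<union> Z"

definition simplicial_subcircuit :: "nat \<Rightarrow> 'v set \<Rightarrow> 'v set set \<Rightarrow> 'v set \<Rightarrow> bool" where
  "simplicial_subcircuit d V H Z \<longleftrightarrow>
     Z \<subseteq> V \<and> card Z = d - 1 \<and> clutter_clique d H (closed_nbhd H Z)"

definition clutter_delete :: "'v set set \<Rightarrow> 'v set \<Rightarrow> 'v set set" where
  "clutter_delete H Z = {C \<in> H. \<not> Z \<subseteq> C}"

text \<open>A set \<open>Z\<close> contained in no circuit is vacuously simplicial, but its deletion changes nothing;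
  since the definition is a least fixed point, such steps are harmless.\<close>

inductive chordal_clutter :: "nat \<Rightarrow> 'v set \<Rightarrow> 'v set set \<Rightarrow> bool" for d V where
  no_circuits: "chordal_clutter d V {}"
| delete: "simplicial_subcircuit d V H Z \<Longrightarrow> chordal_clutter d V (clutter_delete H Z) \<Longrightarrow>
     chordal_clutter d V H"

definition clutter_complement :: "nat \<Rightarrow> 'v set \<Rightarrow> 'v set set \<Rightarrow> 'v set set" where
  "clutter_complement d V H = {C. C \<subseteq> V \<and> card C = d \<and> C \<notin> H}"

definition cochordal_clutter :: "nat \<Rightarrow> 'v set \<Rightarrow> 'v set set \<Rightarrow> bool" where
  "cochordal_clutter d V H \<longleftrightarrow> chordal_clutter d V (clutter_complement d V H)"


section \<open>Simplicial complexes\<close>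

text \<open>A complex is its set of faces, a family of finite sets closed under taking subsets. The void
  complex is \<open>{}\<close> and the empty complex is \<open>{{}}\<close>.\<close>

definition generated_complex :: "'v set set \<Rightarrow> 'v set set" where
  "generated_complex \<F> = {A. \<exists>F\<in>\<F>. A \<subseteq> F}"

definition Sigma_complex :: "nat \<Rightarrow> ('v, 'e) pre_digraph \<Rightarrow> 'v set set" where
  "Sigma_complex r G = generated_complex ((\<lambda>W. verts G - W) ` Con r G)"

definition facets :: "'v set set \<Rightarrow> 'v set set" where
  "facets \<Delta> = {F \<in> \<Delta>. \<forall>A\<in>\<Delta>. F \<subseteq> A \<longrightarrow> A = F}"

definition link :: "'v set set \<Rightarrow> 'v \<Rightarrow> 'v set set" where
  "link \<Delta> x = {A. x \<notin> A \<and> insert x A \<in> \<Delta>}"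

definition deletion :: "'v set set \<Rightarrow> 'v \<Rightarrow> 'v set set" where
  "deletion \<Delta> x = {A \<in> \<Delta>. x \<notin> A}"

inductive vertex_decomposable :: "'v set set \<Rightarrow> bool" where
  void: "vertex_decomposable {}"
| empty: "vertex_decomposable {{}}"
| simplex: "finite F \<Longrightarrow> vertex_decomposable (Pow F)"
| shedding: "{x} \<in> \<Delta> \<Longrightarrow> vertex_decomposable (link \<Delta> x) \<Longrightarrow> vertex_decomposable (deletion \<Delta> x) \<Longrightarrow>
     facets (deletion \<Delta> x) \<subseteq> facets \<Delta> \<Longrightarrow> vertex_decomposable \<Delta>"

definition face_dim :: "'v set \<Rightarrow> int" where
  "face_dim F = int (card F) - 1"

definition pure_of_dim :: "'v set set \<Rightarrow> int \<Rightarrow> bool" where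
  "pure_of_dim \<Delta> k \<longleftrightarrow> \<Delta> \<noteq> {} \<and> (\<forall>F\<in>facets \<Delta>. face_dim F = k)"

definition shellable :: "'v set set \<Rightarrow> bool" where
  "shellable \<Delta> \<longleftrightarrow>
     (\<exists>Fs. distinct Fs \<and> set Fs = facets \<Delta> \<and>
        (\<forall>i. 1 \<le> i \<and> i < length Fs \<longrightarrow>
           pure_of_dim (generated_complex {Fs ! i} \<inter> generated_complex (set (take i Fs)))
             (face_dim (Fs ! i) - 1)))"


section \<open>Cohen--Macaulay complexes\<close>

text \<open>A prime ideal is proper, so the zero ring has no chains. The supremum of the empty set in
  \<^typ>\<open>enat\<close> is \<open>0\<close>.\<close>

definition krull_dim :: "('a, 'b) ring_scheme \<Rightarrow> enat" where
  "krull_dim R =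
     Sup {enat n | n. \<exists>P. (\<forall>i\<le>n. primeideal (P i) R) \<and> (\<forall>i<n. P i \<subset> P (Suc i))}"

definition regular_sequence :: "('a, 'b) ring_scheme \<Rightarrow> 'a list \<Rightarrow> bool" where
  "regular_sequence R xs \<longleftrightarrow>
     set xs \<subseteq> carrier R \<and> genideal R (set xs) \<noteq> carrier R \<and>
     (\<forall>i<length xs. \<forall>a\<in>carrier R.
        xs ! i \<otimes>\<^bsub>R\<^esub> a \<in> genideal R (set (take i xs)) \<longrightarrow> a \<in> genideal R (set (take i xs)))"

definition depth :: "('a, 'b) ring_scheme \<Rightarrow> 'a set \<Rightarrow> enat" where
  "depth R \<mm> = Sup {enat (length xs) | xs. regular_sequence R xs \<and> set xs \<subseteq> \<mm>}"

text \<open>The polynomial ring \<open>k[x\<^sub>v : v \<in> V]\<close>: a monomial is an exponent vector \<^typ>\<open>'v \<Rightarrow>\<^sub>0 nat\<close>, a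
  polynomial a finitely supported function from monomials to \<open>k\<close>, with the convolution product.\<close>

definition polynomial_ring :: "'k::field itself \<Rightarrow> 'v set \<Rightarrow> (('v \<Rightarrow>\<^sub>0 nat) \<Rightarrow>\<^sub>0 'k) ring" where
  "polynomial_ring _ V =
     \<lparr>carrier = {p. \<forall>m\<in>Poly_Mapping.keys p. Poly_Mapping.keys m \<subseteq> V},
      mult = (*), one = 1, zero = 0, add = (+)\<rparr>"

definition variable :: "'v \<Rightarrow> ('v \<Rightarrow>\<^sub>0 nat) \<Rightarrow>\<^sub>0 'k::field" where
  "variable v = Poly_Mapping.single (Poly_Mapping.single v 1) 1"

definition stanley_reisner_ideal ::
    "'k::field itself \<Rightarrow> 'v set \<Rightarrow> 'v set set \<Rightarrow> (('v \<Rightarrow>\<^sub>0 nat) \<Rightarrow>\<^sub>0 'k) set" where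
  "stanley_reisner_ideal k V \<Delta> =
     genideal (polynomial_ring k V) {\<Prod>v\<in>A. variable v | A. A \<subseteq> V \<and> A \<notin> \<Delta>}"

definition stanley_reisner_ring ::
    "'k::field itself \<Rightarrow> 'v set \<Rightarrow> 'v set set \<Rightarrow> (('v \<Rightarrow>\<^sub>0 nat) \<Rightarrow>\<^sub>0 'k) set ring" where
  "stanley_reisner_ring k V \<Delta> = polynomial_ring k V Quot stanley_reisner_ideal k V \<Delta>"

definition graded_maximal_ideal ::
    "'k::field itself \<Rightarrow> 'v set \<Rightarrow> 'v set set \<Rightarrow> (('v \<Rightarrow>\<^sub>0 nat) \<Rightarrow>\<^sub>0 'k) set set" where
  "graded_maximal_ideal k V \<Delta> =
     genideal (stanley_reisner_ring k V \<Delta>)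
       {stanley_reisner_ideal k V \<Delta> +>\<^bsub>polynomial_ring k V\<^esub> variable v | v. v \<in> V}"

text \<open>The standard graded \<open>k\<close>-algebra \<open>k[\<Delta>]\<close> is Cohen--Macaulay if its depth, the supremum of the
  lengths of regular sequences in the graded maximal ideal, equals its Krull dimension. For the void
  complex \<open>k[\<Delta>]\<close> is the zero ring and both sides are \<open>0\<close>, so it counts as Cohen--Macaulay, as usual.\<close>

definition cohen_macaulay :: "'k::field itself \<Rightarrow> 'v set \<Rightarrow> 'v set set \<Rightarrow> bool" where
  "cohen_macaulay k V \<Delta> \<longleftrightarrow>
     depth (stanley_reisner_ring k V \<Delta>) (graded_maximal_ideal k V \<Delta>) =
     krull_dim (stanley_reisner_ring k V \<Delta>)"

end

theory Submission
  imports Defs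
begin

text \<open>
  Two connected \<open>r\<close>-sets which neither meet nor are joined by an edge form a gap. So if \<open>G\<close> is
  \<open>r\<close>-gap-free, the connected \<open>r\<close>-sets form a bramble, and in a chordal graph some clique meets all
  members of a bramble. Any vertex \<open>x\<close> of this clique is adjacent to every connected \<open>r\<close>-set avoiding
  it, so \<open>x\<close> can be exchanged into each of them: this is the shedding condition for \<open>\<Sigma>\<^sub>r(G)\<close>, and it
  also lets a simplicial elimination of the circuits through \<open>x\<close> precede one of the remaining circuits.
  The family of connected sets containing a fixed connected set is handled in the same way in any graph.

  Conversely, a gap \<open>A, B\<close> makes the sets \<open>A \<union> B - {a, b}\<close> cliques of the complementary clutter which no
  simplicial deletion can destroy; and it makes the link of the face \<open>V - (A \<union> B)\<close> the disjoint union of two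
  simplices, whose disconnectedness gives a nonzero Koszul cohomology class in degree
  \<open>|V| - 2r + 1 < |V| - r\<close> and so bounds the depth below the dimension. For a shellable complex with facets of
  size \<open>d\<close> the elementary symmetric functions \<open>e\<^sub>d, \<dots>, e\<^sub>1\<close> form a regular sequence over every field, by
  induction along the shelling; the Krull dimension is bounded by counting monomials.
\<close>

section \<open>Connected sets and simplicial vertices\<close>

text \<open>Gap-freeness is the hub: \<open>decomposable_clutter\<close> is derived from it once and
  read off twice, as vertex decomposability of the complex of complements and as chordality of the
  complementary clutter. The hypothesis on r enters numerically on both ways back:
  \<open>2r - 2 \<ge> r\<close> makes the cliques of a gap contain circuits, and
  \<open>|V| - 2r + 1 < |V| - r\<close> makes the depth drop. For r = 1 and at least two vertices
  the equivalence fails: the complex is the boundary of a simplex, yet any two vertices form a gap.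
  Three obstacles shape the algebra. The field may be finite, so a linear system of parameters need
  not exist; symmetric functions serve over every field. The regular sequences counted by
  \<open>depth\<close> need not be homogeneous, so the depth bound may use only that constant terms
  vanish. Finally, the class of a gap belongs to local cohomology with the variables of F inverted;
  instead of localising, the Koszul complex is taken on squares of these variables, which is enough
  to isolate the one coefficient that detects the class.\<close>

text \<open>Connectedness is phrased by cuts, which is easier to manipulate than reachability.\<close>

definition conn_set :: "'v rel \<Rightarrow> 'v set \<Rightarrow> bool" where
  "conn_set E W \<longleftrightarrow> W \<noteq> {} \<and> (\<forall>A. A \<subseteq> W \<and> A \<noteq> {} \<and> A \<noteq> W \<longrightarrow> (\<exists>a\<in>A. \<exists>b\<in>W - A. (a, b) \<in> E))"

definition simplicial_vertex :: "'v rel \<Rightarrow> 'v set \<Rightarrow> 'v \<Rightarrow> bool" where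
  "simplicial_vertex E V w \<longleftrightarrow>
     (\<forall>a\<in>V. \<forall>b\<in>V. (w, a) \<in> E \<longrightarrow> (w, b) \<in> E \<longrightarrow> a \<noteq> b \<longrightarrow> (a, b) \<in> E)"

definition clique_set :: "'v rel \<Rightarrow> 'v set \<Rightarrow> bool" where
  "clique_set E K \<longleftrightarrow> (\<forall>a\<in>K. \<forall>b\<in>K. a \<noteq> b \<longrightarrow> (a, b) \<in> E)"

definition touching :: "'v rel \<Rightarrow> 'v set \<Rightarrow> 'v set \<Rightarrow> bool" where
  "touching E A B \<longleftrightarrow> A \<inter> B \<noteq> {} \<or> (\<exists>a\<in>A. \<exists>b\<in>B. (a, b) \<in> E)"

text \<open>Chordality of an induced subgraph without forming that subgraph, so that inductions on
  the vertex set keep the relation \<open>E\<close> fixed.\<close>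

definition chordal_on :: "'v rel \<Rightarrow> 'v set \<Rightarrow> bool" where
  "chordal_on E V \<longleftrightarrow> \<not> (\<exists>c. length c \<ge> 4 \<and> distinct c \<and> set c \<subseteq> V \<and>
     (\<forall>i<length c. \<forall>j<length c. (c ! i, c ! j) \<in> E \<longleftrightarrow>
        j = Suc i mod length c \<or> i = Suc j mod length c))"

lemma chordal_on_mono: "chordal_on E V \<Longrightarrow> U \<subseteq> V \<Longrightarrow> chordal_on E U"
  unfolding chordal_on_def by (meson order_trans)

lemma conn_setD:
  assumes "conn_set E W" "A \<subseteq> W" "A \<noteq> {}" "A \<noteq> W"
  obtains a b where "a \<in> A" "b \<in> W - A" "(a, b) \<in> E"
  using assms unfolding conn_set_def by blast

lemma conn_set_singleton: "conn_set E {x}"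
  unfolding conn_set_def by auto

lemma conn_set_insert:
  assumes "sym E" "conn_set E X" "x \<in> X" "(x, y) \<in> E"
  shows "conn_set E (insert y X)"
  unfolding conn_set_def
proof (intro conjI allI impI)
  fix A assume A: "A \<subseteq> insert y X \<and> A \<noteq> {} \<and> A \<noteq> insert y X"
  have yx: "(y, x) \<in> E" using assms by (meson symD)
  consider "A \<inter> X = {}" | "A \<inter> X = X" | "A \<inter> X \<noteq> {}" "A \<inter> X \<noteq> X" by blast
  then show "\<exists>a\<in>A. \<exists>b\<in>insert y X - A. (a, b) \<in> E"
  proof cases
    case 1 then have "A = {y}" using A by blast
    then show ?thesis using 1 assms yx by blast
  next
    case 2 then have "y \<notin> A" using A by blast
    then show ?thesis using 2 assms by blast
  next
    case 3
    then obtain a b where "a \<in> A \<inter> X" "b \<in> X - A \<inter> X" "(a, b) \<in> E"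
      using conn_setD[OF assms(2), of "A \<inter> X"] by blast
    then show ?thesis by blast
  qed
qed (use assms in auto)

text \<open>Grow \<open>X\<close> inside \<open>Z\<close> by one neighbour at a time. All
  intermediate sets are connected, so the last vertex added can be taken out of
  \<open>Z\<close>.\<close>

lemma conn_set_remove:
  assumes "sym E" "finite Z" "conn_set E X" "conn_set E Z" "X \<subset> Z"
  obtains w where "w \<in> Z - X" "conn_set E (Z - {w})"
  using assms
proof (induction "card (Z - X)" arbitrary: X thesis rule: less_induct)
  case less
  from less.prems(4,6) obtain x y where xy: "x \<in> X" "y \<in> Z - X" "(x, y) \<in> E"
    using conn_setD[OF less.prems(5), of X] unfolding conn_set_def by blast
  show ?case
  proof (cases "Z = insert y X")
    case True
    then have "Z - {y} = X" using xy by auto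
    then show ?thesis using less.prems(1)[of y] xy less.prems(4) by auto
  next
    case False
    have "card (Z - insert y X) < card (Z - X)"
      using xy less.prems(3) by (intro psubset_card_mono) auto
    moreover have "conn_set E (insert y X)"
      using conn_set_insert[OF \<open>sym E\<close> less.prems(4)] xy by blast
    ultimately obtain w where "w \<in> Z - insert y X" "conn_set E (Z - {w})"
      using less.hyps[of "insert y X"] less.prems xy False by (metis Diff_iff insert_subset psubsetE psubsetI)
    then show ?thesis using less.prems(1) by blast
  qed
qed

text \<open>If a cut of \<open>W - {v}\<close> had no crossing edge, both of its sides would be
  attached to \<open>v\<close>; but the two neighbours of \<open>v\<close> found this way are
  adjacent, as \<open>v\<close> is simplicial.\<close>

lemma conn_set_remove_simplicial:
  assumes "sym E" "conn_set E W" "simplicial_vertex E W v" "W \<noteq> {v}"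
  shows "conn_set E (W - {v})"
proof (cases "v \<in> W")
  case True
  show ?thesis unfolding conn_set_def
  proof (intro conjI allI impI)
    show "W - {v} \<noteq> {}" using assms True by auto
    fix A assume A: "A \<subseteq> W - {v} \<and> A \<noteq> {} \<and> A \<noteq> W - {v}"
    show "\<exists>a\<in>A. \<exists>b\<in>W - {v} - A. (a, b) \<in> E"
    proof (rule ccontr)
      assume no: "\<not> ?thesis"
      obtain a b where ab: "a \<in> A" "b \<in> W - A" "(a, b) \<in> E"
        using conn_setD[OF assms(2), of A] A by blast
      obtain c d where cd: "c \<in> W - {v} - A" "d \<in> W - (W - {v} - A)" "(c, d) \<in> E"
        using conn_setD[OF assms(2), of "W - {v} - A"] A True by blast
      have "b = v" using ab no A by blast
      moreover have "d = v" using cd no A \<open>sym E\<close> by (meson DiffD1 DiffD2 DiffI empty_iff insert_iff symD)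
      ultimately have "(v, a) \<in> E" "(v, c) \<in> E" using ab cd \<open>sym E\<close> by (auto dest: symD)
      then have "(a, c) \<in> E" using assms(3) ab cd A unfolding simplicial_vertex_def by blast
      then show False using no ab cd by blast
    qed
  qed
qed (use assms in auto)

lemma conn_set_nbr:
  assumes "sym E" "conn_set E W" "v \<in> W" "W \<noteq> {v}"
  obtains u where "u \<in> W - {v}" "(v, u) \<in> E"
  using conn_setD[OF assms(2), of "{v}"] assms by blast

section \<open>Induced paths, clique separators and simplicial vertices of chordal graphs\<close>

lemma walk_exists:
  assumes "conn_set E W" "s \<in> W" "t \<in> W"
  obtains p where "p \<noteq> []" "hd p = s" "last p = t" "set p \<subseteq> W" "successively (\<lambda>a b. (a, b) \<in> E) p"
proof -
  let ?walk = "\<lambda>p. p \<noteq> [] \<and> hd p = s \<and> set p \<subseteq> W \<and> successively (\<lambda>a b. (a, b) \<in> E) p"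
  let ?A = "last ` {p. ?walk p}"
  have "[s] \<in> {p. ?walk p}" using assms by simp
  then have s: "s \<in> ?A" by (metis (mono_tags, lifting) image_eqI last.simps)
  have sub: "?A \<subseteq> W" by (auto dest: last_in_set)
  have "?A = W"
  proof (rule ccontr)
    assume "?A \<noteq> W"
    then obtain a b where ab: "a \<in> ?A" "b \<in> W - ?A" "(a, b) \<in> E"
      using conn_setD[OF assms(1) sub] s by blast
    then obtain p where p: "?walk p" "last p = a" by blast
    have "?walk (p @ [b])" using p ab by (auto simp: successively_append_iff)
    then have "b \<in> ?A" by (metis (mono_tags, lifting) image_eqI last_snoc mem_Collect_eq)
    then show False using ab by blast
  qed
  then have "t \<in> ?A" using assms by simp
  then show ?thesis using that by blast
qed

lemma successively_nth:
  "successively P p \<longleftrightarrow> (\<forall>i. Suc i < length p \<longrightarrow> P (p ! i) (p ! Suc i))"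
  by (simp add: successively_conv_nth)

text \<open>A walk of minimal length has neither a repeated vertex nor a chord, since either would
  allow a shortcut.\<close>

lemma induced_path_exists:
  assumes "sym E" "irrefl E" "conn_set E W" "s \<in> W" "t \<in> W"
  obtains p where "p \<noteq> []" "hd p = s" "last p = t" "set p \<subseteq> W" "distinct p"
    "\<And>i j. i < length p \<Longrightarrow> j < length p \<Longrightarrow> (p ! i, p ! j) \<in> E \<longleftrightarrow> j = Suc i \<or> i = Suc j"
proof -
  let ?walk = "\<lambda>p. p \<noteq> [] \<and> hd p = s \<and> last p = t \<and> set p \<subseteq> W \<and> successively (\<lambda>a b. (a, b) \<in> E) p"
  obtain p0 where "?walk p0" using walk_exists[OF assms(3-5)] by blast
  then obtain p where p: "?walk p" and min: "\<And>q. ?walk q \<Longrightarrow> length p \<le> length q"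
    using ex_has_least_nat[of ?walk p0 length] by blast
  \<comment> \<open>The walk \<open>q\<close> jumps from position \<open>k - 1\<close> to position
    \<open>j\<close>. A repetition \<open>p ! i = p ! j\<close> is cut with \<open>k = i\<close>, a
    chord between positions \<open>i\<close> and \<open>j\<close> with \<open>k = Suc i\<close>; for
    \<open>k = 0\<close> the shortened walk has to begin at \<open>s\<close> again.\<close>
  have shortcut: False if "i < j" "j < length p" "q = take k p @ drop j p" "k < j" "k = 0 \<Longrightarrow> p ! j = s"
    "k > 0 \<Longrightarrow> (p ! (k - 1), p ! j) \<in> E" for i j k q
  proof -
    have "hd q = s"
      using that p by (cases "k = 0") (auto simp: hd_drop_conv_nth hd_append)
    moreover have "last q = t" "q \<noteq> []" using that p by auto
    moreover have "set q \<subseteq> W" using that p by (auto dest: in_set_takeD in_set_dropD)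
    moreover have "successively (\<lambda>a b. (a, b) \<in> E) q"
    proof -
      have "successively (\<lambda>a b. (a, b) \<in> E) (take k p)" "successively (\<lambda>a b. (a, b) \<in> E) (drop j p)"
        using p by (auto simp: successively_nth)
      moreover have "(last (take k p), hd (drop j p)) \<in> E" if "k > 0"
      proof -
        have "take k p \<noteq> []" using that p by auto
        then have "last (take k p) = p ! (k - 1)"
          using that \<open>k < j\<close> \<open>j < length p\<close> by (simp add: last_conv_nth min_def)
        then show ?thesis
          using that \<open>j < length p\<close> \<open>k > 0 \<Longrightarrow> (p ! (k - 1), p ! j) \<in> E\<close> by (simp add: hd_drop_conv_nth)
      qed
      ultimately show ?thesis using \<open>q = _\<close> by (auto simp: successively_append_iff)
    qed
    ultimately have "length p \<le> length q" using min by blast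
    then show False using that by simp
  qed
  have dist: "distinct p"
  proof -
    have "p ! i \<noteq> p ! j" if "i < j" "j < length p" for i j
    proof
      assume eq: "p ! i = p ! j"
      have "i = 0 \<Longrightarrow> p ! j = s" using eq p by (metis hd_conv_nth)
      moreover have "i > 0 \<Longrightarrow> (p ! (i - 1), p ! j) \<in> E"
        using eq p that by (metis (no_types, lifting) Suc_diff_1 order_less_trans successively_nth)
      ultimately show False using shortcut[of i j _ i] that by blast
    qed
    then show ?thesis by (metis distinct_conv_nth nat_neq_iff)
  qed
  have aux: "j = Suc i" if "i < j" "j < length p" "(p ! i, p ! j) \<in> E" for i j
  proof (rule ccontr)
    assume "j \<noteq> Suc i"
    then have "Suc i < j" using that by simp
    then show False using shortcut[of i j _ "Suc i"] that by force
  qed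
  have "(p ! i, p ! j) \<in> E \<longleftrightarrow> j = Suc i \<or> i = Suc j" if "i < length p" "j < length p" for i j
  proof
    assume e: "(p ! i, p ! j) \<in> E"
    then have "i \<noteq> j" using assms(2) by (metis irreflD)
    then show "j = Suc i \<or> i = Suc j"
      using aux[of i j] aux[of j i] e that \<open>sym E\<close> by (metis nat_neq_iff symD)
  next
    assume "j = Suc i \<or> i = Suc j"
    then show "(p ! i, p ! j) \<in> E"
      using p that \<open>sym E\<close> by (metis (no_types, lifting) successively_nth symD)
  qed
  then show ?thesis using that p dist by blast
qed

text \<open>Otherwise an induced path from \<open>s\<close> to \<open>t\<close> through the
  connected set \<open>C\<close>, closed up by \<open>v\<close>, is an induced cycle:
  \<open>v\<close> sees only the two ends of the path, and the missing edge forces an inner vertex,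
  so the length is at least 4.\<close>

lemma chordal_separator_clique:
  assumes "sym E" "irrefl E" "chordal_on E V" "v \<in> V"
    and C: "conn_set E C" "C \<subseteq> V" "v \<notin> C" "\<And>c. c \<in> C \<Longrightarrow> (v, c) \<notin> E"
    and st: "s \<in> V" "t \<in> V" "(v, s) \<in> E" "(v, t) \<in> E" "s \<noteq> t"
    and cs: "c \<in> C" "(c, s) \<in> E" and dt: "d \<in> C" "(d, t) \<in> E"
  shows "(s, t) \<in> E"
proof (rule ccontr)
  assume nst: "(s, t) \<notin> E"
  have "conn_set E (insert t (insert s C))"
    using conn_set_insert[OF \<open>sym E\<close> conn_set_insert[OF \<open>sym E\<close> C(1) cs]] dt by blast
  then obtain p where p: "p \<noteq> []" "hd p = s" "last p = t" "set p \<subseteq> insert t (insert s C)" "distinct p"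
    and ind: "\<And>i j. i < length p \<Longrightarrow> j < length p \<Longrightarrow> (p ! i, p ! j) \<in> E \<longleftrightarrow> j = Suc i \<or> i = Suc j"
    using induced_path_exists[OF assms(1,2), of "insert t (insert s C)" s t] by (metis insertCI)
  define k where "k = length p"
  have p0: "p ! 0 = s" "p ! (k - 1) = t" "k > 0"
    using p by (auto simp: k_def hd_conv_nth last_conv_nth)
  have "k \<noteq> 1" using p0 st by auto
  moreover have "k \<noteq> 2" using p0 ind[of 0 1] nst by (auto simp: k_def)
  ultimately have k3: "k \<ge> 3" using p0 by linarith
  have vE: "(v, p ! i) \<in> E \<longleftrightarrow> i = 0 \<or> i = k - 1" if "i < k" for i
  proof
    assume e: "(v, p ! i) \<in> E"
    have "p ! i \<in> set p" using that by (simp add: k_def)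
    then have "p ! i \<in> insert t (insert s C)" using p(4) by blast
    then have "p ! i = t \<or> p ! i = s" using e C(4) by blast
    then show "i = 0 \<or> i = k - 1"
      using p0 p that by (metis diff_less k_def less_numeral_extra(1) nth_eq_iff_index_eq)
  qed (use p0 st in auto)
  have vp: "v \<notin> set p" using p C st assms(2) by (metis insertE irreflD subsetD)
  let ?c = "v # p"
  have "(?c ! i, ?c ! j) \<in> E \<longleftrightarrow> j = Suc i mod length ?c \<or> i = Suc j mod length ?c"
    if "i < length ?c" "j < length ?c" for i j
  proof -
    have len: "length ?c = Suc k" by (simp add: k_def)
    have mod: "Suc m mod Suc k = (if m = k then 0 else Suc m)" if "m < Suc k" for m
      using that by auto
    have vv: "(v, v) \<notin> E" using assms(2) by (metis irreflD)
    have comm: "(p ! m, v) \<in> E \<longleftrightarrow> (v, p ! m) \<in> E" for m using \<open>sym E\<close> by (meson symD)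
    show ?thesis unfolding len using that k3 vE vv comm ind
      by (cases i; cases j) (auto simp: mod len k_def[symmetric])
  qed
  moreover have "set ?c \<subseteq> V" using p C(2) st \<open>v \<in> V\<close> by auto
  moreover have "length ?c \<ge> 4" using k3 by (simp add: k_def)
  moreover have "distinct ?c" using vp p by simp
  ultimately show False using assms(3) unfolding chordal_on_def by blast
qed

text \<open>A maximal connected subset: any neighbour left outside could still be added.\<close>

lemma conn_component_exists:
  assumes "finite U" "u \<in> U" "sym E"
  obtains C where "conn_set E C" "C \<subseteq> U" "\<And>x c. c \<in> C \<Longrightarrow> x \<in> U - C \<Longrightarrow> (c, x) \<notin> E"
proof -
  let ?S = "{C. conn_set E C \<and> C \<subseteq> U}"
  have "finite ?S" using assms by (simp add: finite_subset[of _ "Pow U"])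
  moreover have "{u} \<in> ?S" using assms by (simp add: conn_set_singleton)
  ultimately obtain C where C: "C \<in> ?S" "\<And>D. D \<in> ?S \<Longrightarrow> C \<subseteq> D \<Longrightarrow> C = D"
    by (meson finite_has_maximal2)
  have "(c, x) \<notin> E" if "c \<in> C" "x \<in> U - C" for x c
    using C(2)[of "insert x C"] conn_set_insert[OF assms(3), of C c x] C(1) that by blast
  then show ?thesis using that C by blast
qed

text \<open>Dirac's theorem in the strong form that makes the induction work: a component \<open>C\<close> of the
  non-neighbours of \<open>v\<close> is attached to the rest of the graph along a clique \<open>S\<close>, and a simplicial
  vertex of \<open>C \<union> S\<close> outside \<open>S\<close> is simplicial in the whole graph.\<close>

lemma simplicial_nonneighbour_exists:
  assumes "sym E" "irrefl E" "finite V" "chordal_on E V" "v \<in> V" "u \<in> V" "u \<noteq> v" "(v, u) \<notin> E"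
  shows "\<exists>w\<in>V. w \<noteq> v \<and> (v, w) \<notin> E \<and> simplicial_vertex E V w"
  using assms(3-)
proof (induction "card V" arbitrary: V v u rule: less_induct)
  case less
  let ?U = "{x \<in> V. x \<noteq> v \<and> (v, x) \<notin> E}"
  obtain C where C: "conn_set E C" "C \<subseteq> ?U" "\<And>x c. c \<in> C \<Longrightarrow> x \<in> ?U - C \<Longrightarrow> (c, x) \<notin> E"
    using conn_component_exists[of ?U u E] less.prems assms(1) by auto
  define S where "S = {y \<in> V - C. \<exists>c\<in>C. (c, y) \<in> E}"
  have vC: "(c, v) \<notin> E" if "c \<in> C" for c using C(2) that \<open>sym E\<close> by (auto dest: symD)
  have SN: "(v, y) \<in> E" if "y \<in> S" for y
    using that C(3) vC unfolding S_def by blast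
  have Sclique: "(s, t) \<in> E" if st: "s \<in> S" "t \<in> S" "s \<noteq> t" for s t
  proof -
    obtain c d where "c \<in> C" "(c, s) \<in> E" "d \<in> C" "(d, t) \<in> E"
      using st unfolding S_def by blast
    then show ?thesis
      using chordal_separator_clique[OF assms(1,2) less.prems(2,3) C(1), of s t c d] SN st C(2)
      unfolding S_def by blast
  qed
  let ?H = "C \<union> S"
  have HV: "?H \<subseteq> V" using C(2) unfolding S_def by blast
  have vH: "v \<notin> ?H" using C(2) SN assms(2) by (auto dest: irreflD)
  have smaller: "card ?H < card V"
    using HV vH less.prems by (intro psubset_card_mono) auto
  have chH: "chordal_on E ?H" using chordal_on_mono[OF less.prems(2) HV] .
  have finH: "finite ?H" using HV less.prems(1) finite_subset by blast
  have lift: "simplicial_vertex E V w" if "simplicial_vertex E ?H w" "w \<in> C" for w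
  proof -
    have "x \<in> ?H" if "x \<in> V" "(w, x) \<in> E" for x using that \<open>w \<in> C\<close> unfolding S_def by blast
    then show ?thesis using that unfolding simplicial_vertex_def by blast
  qed
  \<comment> \<open>The induction hypothesis has to be steered away from \<open>S\<close>. Applied
    at some \<open>s \<in> S\<close> with a non-neighbour, it returns a non-neighbour of
    \<open>s\<close>, which cannot belong to the clique \<open>S\<close>. If every \<open>s\<close>
    is adjacent to the rest of \<open>?H\<close>, it is applied at a vertex of \<open>C\<close>
    instead, and a non-neighbour of that vertex is outside \<open>S\<close> again. In the remaining
    case \<open>?H\<close> is a clique.\<close>
  have "\<exists>w\<in>C. simplicial_vertex E ?H w"
  proof (cases "\<exists>s\<in>S. \<exists>x\<in>?H. x \<noteq> s \<and> (s, x) \<notin> E")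
    case True
    then obtain s x where "s \<in> S" "x \<in> ?H" "x \<noteq> s" "(s, x) \<notin> E" by blast
    then obtain w where "w \<in> ?H" "w \<noteq> s" "(s, w) \<notin> E" "simplicial_vertex E ?H w"
      using less.hyps[OF smaller finH chH, of s x] by blast
    then show ?thesis using Sclique \<open>s \<in> S\<close> by blast
  next
    case allS: False
    show ?thesis
    proof (cases "\<exists>c\<in>C. \<exists>x\<in>?H. x \<noteq> c \<and> (c, x) \<notin> E")
      case True
      then obtain c x where cx: "c \<in> C" "x \<in> ?H" "x \<noteq> c" "(c, x) \<notin> E" by blast
      then obtain w where w: "w \<in> ?H" "w \<noteq> c" "(c, w) \<notin> E" "simplicial_vertex E ?H w"
        using less.hyps[OF smaller finH chH, of c x] by blast
      have "w \<notin> S" using w cx allS \<open>sym E\<close> by (metis UnCI symD)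
      then show ?thesis using w by blast
    next
      case False
      have "(a, b) \<in> E" if "a \<in> ?H" "b \<in> ?H" "b \<noteq> a" for a b
        using that allS False by (cases "a \<in> S") auto
      then have "simplicial_vertex E ?H c" for c
        unfolding simplicial_vertex_def by metis
      moreover obtain c where "c \<in> C" using C(1) unfolding conn_set_def by blast
      ultimately show ?thesis by blast
    qed
  qed
  then show ?case using lift C(2) by blast
qed

lemma simplicial_vertex_exists:
  assumes "sym E" "irrefl E" "finite V" "chordal_on E V" "V \<noteq> {}"
  obtains w where "w \<in> V" "simplicial_vertex E V w"
proof (cases "clique_set E V")
  case True
  then show ?thesis using that assms unfolding clique_set_def simplicial_vertex_def by blast
next
  case False
  then show ?thesis
    using simplicial_nonneighbour_exists[OF assms(1-4)] that unfolding clique_set_def by metis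
qed

text \<open>The bramble duality for chordal graphs: removing a simplicial vertex from every member of the
  family preserves connectedness and touching, unless that vertex alone is a member.\<close>

lemma touching_family_clique_transversal:
  assumes "sym E" "irrefl E" "finite V" "chordal_on E V"
    and "\<And>W. W \<in> \<W> \<Longrightarrow> W \<subseteq> V \<and> conn_set E W"
    and "\<And>W W'. W \<in> \<W> \<Longrightarrow> W' \<in> \<W> \<Longrightarrow> touching E W W'"
  obtains K where "K \<subseteq> V" "clique_set E K" "\<And>W. W \<in> \<W> \<Longrightarrow> K \<inter> W \<noteq> {}"
proof -
  have "\<exists>K\<subseteq>V. clique_set E K \<and> (\<forall>W\<in>\<W>. K \<inter> W \<noteq> {})"
    using assms(3-)
  proof (induction "card V" arbitrary: V \<W> rule: less_induct)
    case less
    show ?case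
    proof (cases "V = {}")
      case True
      then have "\<W> = {}" using less.prems(3) unfolding conn_set_def by blast
      then show ?thesis unfolding clique_set_def by blast
    next
      case False
      then obtain v where v: "v \<in> V" "simplicial_vertex E V v"
        using simplicial_vertex_exists[OF assms(1,2) less.prems(1,2)] by blast
      have simp: "simplicial_vertex E W v" if "W \<subseteq> V" for W
        using v(2) that unfolding simplicial_vertex_def by blast
      show ?thesis
      proof (cases "{v} \<in> \<W>")
        \<comment> \<open>Every member touches \<open>{v}\<close> and therefore meets the closed
          neighbourhood of \<open>v\<close>, which is a clique.\<close>
        case True
        let ?K = "insert v {u \<in> V. (v, u) \<in> E}"
        have "clique_set E ?K"
          using v \<open>sym E\<close> unfolding clique_set_def simplicial_vertex_def by (auto dest: symD)
        moreover have "?K \<inter> W \<noteq> {}" if "W \<in> \<W>" for W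
          using less.prems(4)[OF True that] less.prems(3)[OF that] unfolding touching_def by blast
        ultimately show ?thesis using v by (intro exI[of _ ?K]) auto
      next
        case False
        let ?\<W> = "(\<lambda>W. W - {v}) ` \<W>"
        have conn: "W \<subseteq> V - {v} \<and> conn_set E W" if "W \<in> ?\<W>" for W
          using that less.prems(3) conn_set_remove_simplicial[OF assms(1) _ simp] False by blast
        \<comment> \<open>Contact through \<open>v\<close> is replaced by contact between neighbours
          of \<open>v\<close>: if both sets contain one, these coincide or are adjacent. If
          \<open>W'\<close> contains none, then \<open>v \<notin> W'\<close> and the given contact
          did not involve \<open>v\<close> at all.\<close>
        have touch1: "touching E (W - {v}) (W' - {v})"
          if W: "W \<in> \<W>" "W' \<in> \<W>" "v \<in> W" for W W'
        proof -
          obtain u where u: "u \<in> W - {v}" "(v, u) \<in> E"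
            using conn_set_nbr[OF assms(1), of W v] less.prems(3)[OF W(1)] W False by metis
          show ?thesis
          proof (cases "\<exists>u'\<in>W' - {v}. (v, u') \<in> E")
            case True
            then obtain u' where u': "u' \<in> W' - {v}" "(v, u') \<in> E" by blast
            have "u = u' \<or> (u, u') \<in> E"
              using v(2) u u' less.prems(3) W unfolding simplicial_vertex_def by blast
            then show ?thesis using u u' unfolding touching_def by blast
          next
            case no: False
            then have "v \<notin> W'"
              using conn_set_nbr[OF assms(1), of W' v] less.prems(3)[OF W(2)] W(2) False by metis
            then show ?thesis using less.prems(4)[OF W(1,2)] no unfolding touching_def by blast
          qed
        qed
        have tsym: "touching E A B \<longleftrightarrow> touching E B A" for A B
          using \<open>sym E\<close> unfolding touching_def by (meson disjoint_iff symD)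
        have "touching E W W'" if "W \<in> ?\<W>" "W' \<in> ?\<W>" for W W'
        proof -
          from that obtain X X' where X: "X \<in> \<W>" "X' \<in> \<W>" "W = X - {v}" "W' = X' - {v}" by blast
          show ?thesis
          proof (cases "v \<in> X \<or> v \<in> X'")
            case True then show ?thesis using touch1 X tsym by blast
          next
            case False then show ?thesis using less.prems(4)[OF X(1,2)] X by simp
          qed
        qed
        moreover have "card (V - {v}) < card V" using v less.prems(1) by (meson card_Diff1_less)
        ultimately have "\<exists>K\<subseteq>V - {v}. clique_set E K \<and> (\<forall>W\<in>?\<W>. K \<inter> W \<noteq> {})"
          using conn less.prems(1) chordal_on_mono[OF less.prems(2), of "V - {v}"]
          by (intro less.hyps) blast+
        then obtain K where K: "K \<subseteq> V - {v}" "clique_set E K" "\<forall>W\<in>?\<W>. K \<inter> W \<noteq> {}"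
          by blast
        have "K \<inter> W \<noteq> {}" if "W \<in> \<W>" for W
        proof -
          have "K \<inter> (W - {v}) \<noteq> {}" using K(3) imageI[OF that] by (rule bspec)
          then show ?thesis by auto
        qed
        then show ?thesis using K by (intro exI[of _ K]) auto
      qed
    qed
  qed
  then show ?thesis using that by blast
qed

section \<open>Decomposable clutters\<close>

text \<open>The clutter-side mirror of vertex decomposability of the complex generated by the complements
  of the circuits; the exchange condition is the shedding condition.\<close>

inductive decomposable_clutter :: "nat \<Rightarrow> 'v set \<Rightarrow> 'v set set \<Rightarrow> bool" where
  empty: "finite V \<Longrightarrow> decomposable_clutter d V {}"
| full: "finite V \<Longrightarrow> decomposable_clutter 0 V {{}}"
| step: "x \<in> V \<Longrightarrow> decomposable_clutter (Suc d) (V - {x}) {W \<in> H. x \<notin> W} \<Longrightarrow>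
     decomposable_clutter d (V - {x}) ((\<lambda>W. W - {x}) ` {W \<in> H. x \<in> W}) \<Longrightarrow>
     \<forall>W\<in>H. x \<notin> W \<longrightarrow> (\<exists>w\<in>W. insert x (W - {w}) \<in> H) \<Longrightarrow>
     decomposable_clutter (Suc d) V H"

text \<open>In the rule \<open>step\<close>, uniformity of \<open>H\<close> is inherited from the
  deletion for circuits avoiding \<open>x\<close> and from the link for circuits through
  \<open>x\<close>.\<close>

lemma decomposable_clutter_uniform:
  "decomposable_clutter d V H \<Longrightarrow> finite V \<and> (\<forall>W\<in>H. W \<subseteq> V \<and> card W = d)"
proof (induction rule: decomposable_clutter.induct)
  case (step x V d H)
  have "W \<subseteq> V \<and> card W = Suc d" if "W \<in> H" for W
  proof (cases "x \<in> W")
    case True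
    then have "W - {x} \<subseteq> V - {x}" "card (W - {x}) = d" using step.IH(2) that by auto
    moreover have "finite W" using \<open>W - {x} \<subseteq> V - {x}\<close> step.IH(1) 
      by (meson finite.emptyI finite_insert finite_subset finite_Diff2)
    ultimately have "card W = Suc d" using True by (metis card_Suc_Diff1)
    then show ?thesis using True step.hyps(1) \<open>W - {x} \<subseteq> V - {x}\<close> by blast
  qed (use step that in auto)
  then show ?case using step.IH(1) by auto
qed auto

text \<open>Complementation exchanges the two operations: circuits avoiding \<open>x\<close> produce
  the link of \<open>x\<close>, circuits through \<open>x\<close> the deletion. All generating faces
  have the same size, so a facet of the deletion cannot be properly contained in a face of the whole
  complex.\<close>

lemma vertex_decomposable_of_decomposable_clutter:
  "decomposable_clutter d V H \<Longrightarrow> vertex_decomposable (generated_complex ((\<lambda>W. V - W) ` H))"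
proof (induction rule: decomposable_clutter.induct)
  case (empty V d)
  then show ?case by (simp add: generated_complex_def vertex_decomposable.void)
next
  case (full V)
  then have "generated_complex ((\<lambda>W. V - W) ` {{}}) = Pow V" by (auto simp: generated_complex_def)
  then show ?case using full by (simp add: vertex_decomposable.simplex)
next
  case (step x V d H)
  let ?D = "generated_complex ((\<lambda>W. V - W) ` H)"
  have "decomposable_clutter (Suc d) V H" by (rule decomposable_clutter.step[OF step.hyps])
  then have unif: "finite V" "\<And>W. W \<in> H \<Longrightarrow> W \<subseteq> V" "\<And>W. W \<in> H \<Longrightarrow> card W = Suc d"
    using decomposable_clutter_uniform by blast+
  have link: "link ?D x = generated_complex ((\<lambda>W. V - {x} - W) ` {W \<in> H. x \<notin> W})"
    using step.hyps(1) by (auto simp: link_def generated_complex_def)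
  \<comment> \<open>The exchange condition makes this an equality: a face avoiding \<open>x\<close>
    inside \<open>V - W\<close> with \<open>x \<notin> W\<close> also lies inside
    \<open>V - W'\<close>, where \<open>W'\<close> trades some vertex of \<open>W\<close> for
    \<open>x\<close>.\<close>
  have del: "deletion ?D x =
      generated_complex ((\<lambda>W. V - {x} - W) ` (\<lambda>W. W - {x}) ` {W \<in> H. x \<in> W})" (is "?L = ?R")
  proof (intro equalityI subsetI)
    fix A assume "A \<in> ?L"
    then obtain W where W: "x \<notin> A" "W \<in> H" "A \<subseteq> V - W" by (auto simp: deletion_def generated_complex_def)
    obtain W' where W': "W' \<in> H" "x \<in> W'" "W' \<subseteq> insert x W"
      using step.hyps(4) W(2) by (cases "x \<in> W") blast+
    then have "A \<subseteq> V - {x} - (W' - {x})" using W by blast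
    then show "A \<in> ?R" using W' by (auto simp: generated_complex_def)
  qed (auto simp: deletion_def generated_complex_def)
  show ?case
  \<comment> \<open>If every circuit contains \<open>x\<close>, then \<open>x\<close> is not a
    vertex of the complex and cannot be shed; the complex is then its own deletion.\<close>
  proof (cases "{W \<in> H. x \<notin> W} = {}")
    case True
    then have "deletion ?D x = ?D" by (auto simp: deletion_def generated_complex_def)
    then show ?thesis using step.IH(2) del by simp
  next
    case False
    then have "{x} \<in> ?D" using step.hyps(1) by (auto simp: generated_complex_def)
    moreover have "facets (deletion ?D x) \<subseteq> facets ?D"
    proof
      fix F assume F: "F \<in> facets (deletion ?D x)"
      then have "F \<in> ?R" using del by (simp add: facets_def)
      then obtain W where W: "W \<in> H" "x \<in> W" "F \<subseteq> V - W" by (auto simp: generated_complex_def)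
      then have "V - W \<in> deletion ?D x" by (auto simp: deletion_def generated_complex_def)
      then have FW: "F = V - W" using F W(3) by (auto simp: facets_def)
      have "A = F" if A: "A \<in> ?D" "F \<subseteq> A" for A
      proof -
        obtain W' where W': "W' \<in> H" "A \<subseteq> V - W'" using A(1) by (auto simp: generated_complex_def)
        have "card (V - W') = card (V - W)"
          using unif W' W by (metis card_Diff_subset finite_subset)
        then have "V - W = V - W'"
          using W' A FW unif(1) by (intro card_subset_eq) auto
        then show ?thesis using W' A FW by blast
      qed
      then show "F \<in> facets ?D" using F by (auto simp: facets_def deletion_def)
    qed
    ultimately show ?thesis
      using vertex_decomposable.shedding step.IH link del by metis
  qed
qed

section \<open>Simplicial elimination in the complementary clutter\<close>

lemma chordal_clutter_mono:
  "chordal_clutter d V H \<Longrightarrow> V \<subseteq> V' \<Longrightarrow> chordal_clutter d V' H"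
proof (induction rule: chordal_clutter.induct)
  case (delete H Z)
  then have "simplicial_subcircuit d V' H Z" by (auto simp: simplicial_subcircuit_def)
  then show ?case using delete by (auto intro: chordal_clutter.delete)
qed (rule chordal_clutter.no_circuits)

text \<open>Base of the recursion on uniformity: the empty set is simplicial here, and since it is
  contained in every circuit, deleting it removes all circuits at once.\<close>

lemma chordal_clutter_1: "(\<And>C. C \<in> K \<Longrightarrow> card C = 1) \<Longrightarrow> chordal_clutter 1 V K"
proof (rule chordal_clutter.delete[where Z = "{}"])
  show "simplicial_subcircuit 1 V K {}"
    unfolding simplicial_subcircuit_def clutter_clique_def closed_nbhd_def open_nbhd_def
  proof (intro conjI allI impI)
    fix C assume C: "C \<subseteq> {x. x \<notin> {} \<and> (\<exists>C\<in>K. x \<in> C \<and> C \<subseteq> {} \<union> {x})} \<union> {} \<and> card C = 1"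
    then obtain x where x: "C = {x}" by (auto simp: card_1_singleton_iff)
    then obtain D where "D \<in> K" "x \<in> D" "D \<subseteq> {x}" using C by auto
    then show "C \<in> K" using x by (metis empty_iff subset_singletonD)
  qed auto
  show "chordal_clutter 1 V (clutter_delete K {})"
    by (simp add: clutter_delete_def chordal_clutter.no_circuits)
qed

text \<open>First the circuits through \<open>x\<close> are removed, along the deletion sequence of the link with \<open>x\<close>
  added to every subcircuit; the exchange condition keeps these subcircuits simplicial.\<close>

lemma chordal_clutter_combine:
  assumes "chordal_clutter d (V - {x}) L" and "d \<ge> 1" "x \<in> V" "finite V"
    and "L = (\<lambda>C. C - {x}) ` {C \<in> K. x \<in> C}"
    and "chordal_clutter (Suc d) (V - {x}) {C \<in> K. x \<notin> C}"
    and "\<And>C. C \<in> K \<Longrightarrow> C \<subseteq> V \<and> card C = Suc d"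
    and "\<And>W. W \<subseteq> V - {x} \<Longrightarrow> card W = Suc d \<Longrightarrow> (\<And>w. w \<in> W \<Longrightarrow> insert x (W - {w}) \<in> K) \<Longrightarrow> W \<in> K"
  shows "chordal_clutter (Suc d) V K"
  using assms
proof (induction arbitrary: K rule: chordal_clutter.induct)
  case no_circuits
  then have "{C \<in> K. x \<notin> C} = K" by blast
  then show ?case using no_circuits.prems(5) chordal_clutter_mono by (metis Diff_subset)
next
  case (delete L Z')
  define Z where "Z = insert x Z'"
  have Z': "Z' \<subseteq> V - {x}" "card Z' = d - 1" "clutter_clique d L (closed_nbhd L Z')"
    using delete.hyps(1) by (auto simp: simplicial_subcircuit_def)
  have finZ': "finite Z'" using Z'(1) \<open>finite V\<close> by (meson finite_Diff finite_subset)
  have xZ': "x \<notin> Z'" using Z' by blast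
  have cardZ: "card Z = d" using Z' xZ' finZ' \<open>d \<ge> 1\<close> by (simp add: Z_def)
  have LK: "insert x D \<in> K" "x \<notin> D" if "D \<in> L" for D
    using that unfolding delete.prems(4) by (auto simp: insert_absorb)
  have LV: "D \<subseteq> V - {x}" if "D \<in> L" for D
    using LK[OF that] delete.prems(6)[of "insert x D"] by blast
  have N'V: "closed_nbhd L Z' \<subseteq> V - {x}"
    using LV Z'(1) unfolding closed_nbhd_def open_nbhd_def by blast
  have N: "closed_nbhd K Z \<subseteq> insert x (closed_nbhd L Z')"
  proof
    fix y assume "y \<in> closed_nbhd K Z"
    moreover have "y \<in> closed_nbhd L Z'" if y: "y \<notin> Z" "C \<in> K" "y \<in> C" "C \<subseteq> Z \<union> {y}" for C
    proof -
      have "card (Z \<union> {y}) = card C" using delete.prems(6)[OF y(2)] cardZ y(1) finZ' by (simp add: Z_def)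
      then have "C = Z \<union> {y}" using y(4) finZ' by (intro card_subset_eq) (auto simp: Z_def)
      then have "C - {x} = insert y Z'" "x \<in> C" using y(1) xZ' by (auto simp: Z_def)
      moreover from this have "C - {x} \<in> L" using y(2) unfolding delete.prems(4) by (intro imageI) simp
      ultimately have "insert y Z' \<in> L" by (simp only:)
      then show ?thesis using y(1) by (auto simp: closed_nbhd_def open_nbhd_def Z_def)
    qed
    ultimately show "y \<in> insert x (closed_nbhd L Z')"
      by (auto simp: closed_nbhd_def open_nbhd_def Z_def)
  qed
  \<comment> \<open>Circuits through \<open>x\<close> come from the clique in the link. For a set
    avoiding \<open>x\<close>, the same clique shows that all its exchanges with \<open>x\<close>
    are circuits, and the last hypothesis, the exchange condition read on the complement, puts the
    set itself into \<open>K\<close>.\<close>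
  have "C \<in> K" if C: "C \<subseteq> closed_nbhd K Z" "card C = Suc d" for C
  proof (cases "x \<in> C")
    case True
    then have "C - {x} \<subseteq> closed_nbhd L Z'" "card (C - {x}) = d" using C N by auto
    then have "C - {x} \<in> L" using Z'(3) unfolding clutter_clique_def by blast
    then show ?thesis using LK True by (metis insert_Diff)
  next
    case False
    have "insert x (C - {w}) \<in> K" if "w \<in> C" for w
    proof -
      have "C - {w} \<subseteq> closed_nbhd L Z'" "card (C - {w}) = d" using C N that False by auto
      then have "C - {w} \<in> L" using Z'(3) unfolding clutter_clique_def by blast
      then show ?thesis using LK by blast
    qed
    moreover have "C \<subseteq> V - {x}" using C N N'V False by blast
    ultimately show ?thesis using delete.prems(7) C by blast
  qed
  moreover have "Z \<subseteq> V" using Z'(1) \<open>x \<in> V\<close> by (auto simp: Z_def)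
  ultimately have simp: "simplicial_subcircuit (Suc d) V K Z"
    using cardZ by (auto simp: simplicial_subcircuit_def clutter_clique_def)
  have "chordal_clutter (Suc d) V (clutter_delete K Z)"
  proof (rule delete.IH)
    show "clutter_delete L Z' = (\<lambda>C. C - {x}) ` {C \<in> clutter_delete K Z. x \<in> C}"
      using xZ' unfolding delete.prems(4) by (auto simp: clutter_delete_def Z_def)
    have "{C \<in> clutter_delete K Z. x \<notin> C} = {C \<in> K. x \<notin> C}"
      by (auto simp: clutter_delete_def Z_def)
    then show "chordal_clutter (Suc d) (V - {x}) {C \<in> clutter_delete K Z. x \<notin> C}"
      using delete.prems(5) by simp
    \<comment> \<open>The exchange hypothesis survives the deletion because \<open>Z\<close>
      contains \<open>x\<close>: no set avoiding \<open>x\<close> is ever deleted.\<close>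
    fix W assume W: "W \<subseteq> V - {x}" "card W = Suc d" "\<And>w. w \<in> W \<Longrightarrow> insert x (W - {w}) \<in> clutter_delete K Z"
    then have "W \<in> K" using delete.prems(7)[OF W(1,2)] by (auto simp: clutter_delete_def)
    then show "W \<in> clutter_delete K Z" using W(1) by (auto simp: clutter_delete_def Z_def)
  qed (use delete.prems in \<open>auto simp: clutter_delete_def\<close>)
  then show ?case using simp chordal_clutter.delete by blast
qed

lemma clutter_complement_link:
  assumes "x \<in> V" "finite V"
  shows "(\<lambda>C. C - {x}) ` {C \<in> clutter_complement (Suc d) V H. x \<in> C} =
         clutter_complement d (V - {x}) ((\<lambda>W. W - {x}) ` {W \<in> H. x \<in> W})" (is "?L = ?R")
proof (intro equalityI subsetI)
  fix D assume "D \<in> ?L"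
  then obtain C where C: "C \<subseteq> V" "card C = Suc d" "C \<notin> H" "x \<in> C" "D = C - {x}"
    by (auto simp: clutter_complement_def)
  then have "C - {x} \<noteq> W - {x}" if "W \<in> H" "x \<in> W" for W using that by (metis insert_Diff)
  then show "D \<in> ?R" using C by (auto simp: clutter_complement_def)
next
  fix D assume D: "D \<in> ?R"
  then have "x \<notin> D" "finite D" using assms by (auto simp: clutter_complement_def intro: finite_subset)
  have "insert x D \<notin> H"
  proof
    assume "insert x D \<in> H"
    then have "insert x D - {x} \<in> (\<lambda>W. W - {x}) ` {W \<in> H. x \<in> W}" by (intro imageI) simp
    then show False using D \<open>x \<notin> D\<close> by (simp add: clutter_complement_def)
  qed
  then have "insert x D \<in> {C \<in> clutter_complement (Suc d) V H. x \<in> C}" "D = insert x D - {x}"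
    using D \<open>x \<notin> D\<close> \<open>finite D\<close> assms by (auto simp: clutter_complement_def)
  then show "D \<in> ?L" by blast
qed

lemma clutter_complement_deletion:
  "{C \<in> clutter_complement d V H. x \<notin> C} = clutter_complement d (V - {x}) {W \<in> H. x \<notin> W}"
  by (auto simp: clutter_complement_def)

text \<open>Complementation commutes with link and deletion at \<open>x\<close>, and by
  contraposition the exchange condition for \<open>H\<close> becomes the last hypothesis of
  \<open>chordal_clutter_combine\<close>.\<close>

lemma cochordal_clutter_step:
  assumes "x \<in> V" "finite V" "d \<ge> 1"
    and "cochordal_clutter (Suc d) (V - {x}) {W \<in> H. x \<notin> W}"
    and "cochordal_clutter d (V - {x}) ((\<lambda>W. W - {x}) ` {W \<in> H. x \<in> W})"
    and "\<forall>W\<in>H. x \<notin> W \<longrightarrow> (\<exists>w\<in>W. insert x (W - {w}) \<in> H)"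
  shows "cochordal_clutter (Suc d) V H"
  unfolding cochordal_clutter_def
proof (rule chordal_clutter_combine[OF _ assms(3,1,2)])
  show "chordal_clutter d (V - {x}) ((\<lambda>C. C - {x}) ` {C \<in> clutter_complement (Suc d) V H. x \<in> C})"
    using assms(5) unfolding cochordal_clutter_def clutter_complement_link[OF assms(1,2)] .
  show "chordal_clutter (Suc d) (V - {x}) {C \<in> clutter_complement (Suc d) V H. x \<notin> C}"
    using assms(4) unfolding cochordal_clutter_def clutter_complement_deletion .
next
  fix W assume W: "W \<subseteq> V - {x}" "card W = Suc d"
    "\<And>w. w \<in> W \<Longrightarrow> insert x (W - {w}) \<in> clutter_complement (Suc d) V H"
  then have "W \<notin> H" using assms(6) unfolding clutter_complement_def by blast
  then show "W \<in> clutter_complement (Suc d) V H" using W by (auto simp: clutter_complement_def)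
qed (auto simp: clutter_complement_def)

text \<open>The complement is the complete clutter; its vertices are eliminated one after another,
  the exchange condition being vacuous.\<close>

lemma cochordal_clutter_empty: "finite V \<Longrightarrow> d \<ge> 1 \<Longrightarrow> cochordal_clutter d V {}"
proof (induction V arbitrary: d rule: finite_induct)
  case empty
  then have "clutter_complement d ({} :: 'a set) {} = {}" by (auto simp: clutter_complement_def)
  then show ?case by (simp add: cochordal_clutter_def chordal_clutter.no_circuits)
next
  case (insert x V)
  show ?case
  proof (cases "d = 1")
    case True
    then show ?thesis unfolding cochordal_clutter_def True
      by (intro chordal_clutter_1) (auto simp: clutter_complement_def)
  next
    case False
    then obtain d' where "d = Suc d'" "d' \<ge> 1" using insert.prems by (cases d) auto
    then show ?thesis
      using cochordal_clutter_step[of x "insert x V" d' "{}"] insert by simp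
  qed
qed

lemma cochordal_of_decomposable_clutter:
  "decomposable_clutter d V H \<Longrightarrow> d \<ge> 1 \<Longrightarrow> cochordal_clutter d V H"
proof (induction rule: decomposable_clutter.induct)
  case (step x V d H)
  have "finite V" using decomposable_clutter_uniform[OF step.hyps(2)] by simp
  show ?case
  \<comment> \<open>In uniformity 1 the link has uniformity 0, below the range of
    \<open>cochordal_clutter_step\<close>; there \<open>chordal_clutter_1\<close> settles the
    complement directly.\<close>
  proof (cases "d = 0")
    case True
    then show ?thesis unfolding cochordal_clutter_def
      by (simp only: One_nat_def[symmetric]) (intro chordal_clutter_1, auto simp: clutter_complement_def)
  next
    case False
    then show ?thesis using cochordal_clutter_step[of x V d H] step \<open>finite V\<close> by simp
  qed
qed (auto intro: cochordal_clutter_empty)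

text \<open>All the sets \<open>A \<union> B - {a, b}\<close> being cliques while \<open>A\<close> and \<open>B\<close> are not circuits is preserved by
  the deletion of a simplicial subcircuit: these cliques form a combinatorial sphere, so none of
  them can be a free face.\<close>

lemma chordal_clutter_no_sphere:
  assumes "chordal_clutter r V K" "r \<ge> 2" "card A = r" "card B = r" "A \<inter> B = {}" "A \<notin> K" "B \<notin> K"
    and "\<And>a b C. a \<in> A \<Longrightarrow> b \<in> B \<Longrightarrow> C \<subseteq> A \<union> B - {a, b} \<Longrightarrow> card C = r \<Longrightarrow> C \<in> K"
  shows False
  using assms
proof (induction rule: chordal_clutter.induct)
  case no_circuits
  have fin: "finite A" "finite B" using no_circuits.prems by (auto intro: card_ge_0_finite)
  obtain a b where ab: "a \<in> A" "b \<in> B"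
    using no_circuits.prems(1-3) by (metis card.empty ex_in_conv not_numeral_le_zero)
  have "card (A \<union> B - {a, b}) = 2 * r - 2"
    using ab fin no_circuits.prems(2-4) by (subst card_Diff_subset) (auto simp: card_Un_disjoint card_insert_if)
  then have "r \<le> card (A \<union> B - {a, b})" using no_circuits.prems(1) by linarith
  then obtain C where "C \<subseteq> A \<union> B - {a, b}" "card C = r"
    by (meson obtain_subset_with_card_n)
  then show False using no_circuits.prems(7) ab by blast
next
  case (delete K Z)
  have fin: "finite A" "finite B" using delete.prems by (auto intro: card_ge_0_finite)
  have cardZ: "card Z = r - 1" and clq: "clutter_clique r K (closed_nbhd K Z)"
    using delete.hyps(1) by (auto simp: simplicial_subcircuit_def)
  have finZ: "finite Z" using cardZ delete.prems(1) by (intro card_ge_0_finite) auto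
  have sub: "A \<union> B - {a, b} \<subseteq> closed_nbhd K Z" if ab: "a \<in> A" "b \<in> B" "Z \<subseteq> A \<union> B - {a, b}" for a b
  proof
    fix x assume x: "x \<in> A \<union> B - {a, b}"
    show "x \<in> closed_nbhd K Z"
    proof (cases "x \<in> Z")
      case False
      then have "card (insert x Z) = r" using cardZ finZ delete.prems(1) by simp
      moreover have "insert x Z \<subseteq> A \<union> B - {a, b}" using ab(3) x by simp
      ultimately have "insert x Z \<in> K" using delete.prems(7)[OF ab(1,2)] by simp
      then show ?thesis using False by (auto simp: closed_nbhd_def open_nbhd_def)
    qed (simp add: closed_nbhd_def)
  qed
  \<comment> \<open>As \<open>Z\<close> has only \<open>r - 1 < 2r - 2\<close> elements, it misses
    some \<open>t\<close> of the clique. If \<open>t \<in> A\<close>, then \<open>Z\<close> also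
    lies in the clique that omits \<open>t\<close> in place of \<open>a\<close>. Both cliques are
    contained in the neighbourhood of \<open>Z\<close> and together they cover \<open>A\<close>, so
    \<open>A\<close> would be a circuit; likewise for \<open>B\<close>.\<close>
  have noZ: "\<not> Z \<subseteq> A \<union> B - {a, b}" if ab: "a \<in> A" "b \<in> B" for a b
  proof
    assume Z: "Z \<subseteq> A \<union> B - {a, b}"
    have "card (A \<union> B - {a, b}) = 2 * r - 2"
      using ab fin delete.prems(2-4) by (subst card_Diff_subset) (auto simp: card_Un_disjoint card_insert_if)
    then have "Z \<noteq> A \<union> B - {a, b}" using cardZ delete.prems(1) by auto
    then obtain t where t: "t \<in> A \<union> B - {a, b} - Z" using Z by blast
    then consider "t \<in> A" "a \<noteq> t" | "t \<in> B" "b \<noteq> t" by blast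
    then show False
    proof cases
      case 1
      then have "A \<union> B - {t, b} \<subseteq> closed_nbhd K Z" using sub[of t b] ab Z t by blast
      then have "A \<subseteq> closed_nbhd K Z" using sub[OF ab Z] 1 ab delete.prems(4) by blast
      then show False using clq delete.prems(2,5) unfolding clutter_clique_def by blast
    next
      case 2
      then have "A \<union> B - {a, t} \<subseteq> closed_nbhd K Z" using sub[of a t] ab Z t by blast
      then have "B \<subseteq> closed_nbhd K Z" using sub[OF ab Z] 2 ab delete.prems(4) by blast
      then show False using clq delete.prems(3,6) unfolding clutter_clique_def by blast
    qed
  qed
  show False
  proof (rule delete.IH)
    fix a b C assume "a \<in> A" "b \<in> B" "C \<subseteq> A \<union> B - {a, b}" "card C = r"
    then show "C \<in> clutter_delete K Z"
      using noZ[of a b] delete.prems(7)[of a b C] by (auto simp: clutter_delete_def)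
  qed (use delete.prems in \<open>auto simp: clutter_delete_def\<close>)
qed

section \<open>Connected vertex sets of a fixed size\<close>

definition conn_subsets :: "'v rel \<Rightarrow> nat \<Rightarrow> 'v set \<Rightarrow> 'v set set" where
  "conn_subsets E r V = {W. W \<subseteq> V \<and> card W = r \<and> conn_set E W}"

lemma card_exchange:
  assumes "finite W" "z \<in> W" "y \<notin> W"
  shows "card (insert y (W - {z})) = card W"
proof -
  have "card (insert y (W - {z})) = Suc (card (W - {z}))" using assms by (intro card_insert_disjoint) auto
  then show ?thesis using assms by (metis card_Suc_Diff1)
qed

text \<open>The set \<open>insert y W\<close> is connected, and \<open>X\<close> is a connected
  subset of it, proper by cardinality. So \<open>conn_set_remove\<close> finds a removable vertex
  outside \<open>X\<close>, and this is not \<open>y\<close> because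
  \<open>y \<in> X\<close>.\<close>

lemma conn_set_exchange:
  assumes "sym E" "finite W" "conn_set E W" "conn_set E X" "X \<subseteq> insert y W" "y \<in> X" "y \<notin> W"
    "(w, y) \<in> E" "w \<in> W" "card X \<le> card W"
  obtains z where "z \<in> W - X" "conn_set E (insert y (W - {z}))"
proof -
  have "conn_set E (insert y W)" using conn_set_insert assms by metis
  moreover have "X \<noteq> insert y W"
    using card_insert_disjoint[OF assms(2,7)] assms(10) by auto
  ultimately obtain z where z: "z \<in> insert y W - X" "conn_set E (insert y W - {z})"
    using conn_set_remove[OF assms(1), of "insert y W" X] assms by auto
  then have "insert y W - {z} = insert y (W - {z})" "z \<in> W - X" using assms by auto
  then show ?thesis using that z by metis
qed

text \<open>The sets containing a fixed connected set always form a decomposable clutter, whatever the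
  graph: any neighbour of the fixed set is a shedding vertex.\<close>

lemma decomposable_conn_supersets:
  assumes "sym E" "finite V" "conn_set E X" "X \<subseteq> V" "card X \<le> r"
  shows "decomposable_clutter (r - card X) (V - X) ((\<lambda>W. W - X) ` {W \<in> conn_subsets E r V. X \<subseteq> W})"
  using assms(2-)
proof (induction "card (V - X)" arbitrary: V X rule: less_induct)
  case less
  let ?H = "(\<lambda>W. W - X) ` {W \<in> conn_subsets E r V. X \<subseteq> W}"
  have finX: "finite X" using less.prems finite_subset by blast
  consider "card X = r" | "?H = {}" | "card X < r" "?H \<noteq> {}" using less.prems(4) by linarith
  then show ?case
  proof cases
    case 1
    have "W = X" if W: "W \<in> conn_subsets E r V" "X \<subseteq> W" for W
    proof -
      have "finite W" "card X = card W"
        using W(1) 1 less.prems(1) finite_subset unfolding conn_subsets_def by auto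
      then show ?thesis using W(2) card_subset_eq by metis
    qed
    then have "{W \<in> conn_subsets E r V. X \<subseteq> W} = {X}"
      using 1 less.prems by (auto simp: conn_subsets_def)
    then show ?thesis using 1 less.prems by (simp add: decomposable_clutter.full)
  next
    case 2
    then show ?thesis using less.prems(1) by (simp only: decomposable_clutter.empty finite_Diff)
  next
    case 3
    then obtain W0 where W0: "W0 \<in> conn_subsets E r V" "X \<subseteq> W0" by blast
    then have "X \<noteq> W0" using 3 by (auto simp: conn_subsets_def)
    moreover have "X \<noteq> {}" using less.prems(2) by (auto simp: conn_set_def)
    ultimately obtain x y where xy: "x \<in> X" "y \<in> W0 - X" "(x, y) \<in> E"
      using conn_setD[of E W0 X] W0 unfolding conn_subsets_def by blast
    have yV: "y \<in> V - X" using xy W0 by (auto simp: conn_subsets_def)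
    let ?X = "insert y X"
    have connX: "conn_set E ?X" using conn_set_insert[OF \<open>sym E\<close> less.prems(2)] xy by blast
    have cardX: "card ?X = Suc (card X)" using xy finX by auto
    \<comment> \<open>The measure drops both when \<open>y\<close> is deleted from \<open>V\<close>,
      which gives the deletion, and when \<open>y\<close> joins the core \<open>X\<close>, which
      gives the link.\<close>
    have dec: "card (V - {y} - X) < card (V - X)" "card (V - ?X) < card (V - X)"
      using yV less.prems(1) by (intro psubset_card_mono; blast)+
    have "decomposable_clutter (r - card X) (V - {y} - X)
        ((\<lambda>W. W - X) ` {W \<in> conn_subsets E r (V - {y}). X \<subseteq> W})"
      using less.prems xy by (intro less.hyps[OF dec(1)]) auto
    moreover have "(\<lambda>W. W - X) ` {W \<in> conn_subsets E r (V - {y}). X \<subseteq> W} = {W \<in> ?H. y \<notin> W}"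
      using xy by (auto simp: conn_subsets_def)
    moreover have "V - {y} - X = V - X - {y}" by blast
    ultimately have A: "decomposable_clutter (r - card X) (V - X - {y}) {W \<in> ?H. y \<notin> W}"
      by (simp only:)
    have "decomposable_clutter (r - card ?X) (V - ?X)
        ((\<lambda>W. W - ?X) ` {W \<in> conn_subsets E r V. ?X \<subseteq> W})"
      using less.prems yV connX cardX 3 by (intro less.hyps[OF dec(2)]) auto
    moreover have "(\<lambda>W. W - ?X) ` {W \<in> conn_subsets E r V. ?X \<subseteq> W} = (\<lambda>W. W - {y}) ` {W \<in> ?H. y \<in> W}"
    proof -
      have "W - ?X = W - X - {y}" for W by blast
      moreover have "{W \<in> ?H. y \<in> W} = (\<lambda>W. W - X) ` {W \<in> conn_subsets E r V. ?X \<subseteq> W}"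
        using xy by auto
      ultimately show ?thesis by (simp add: image_image)
    qed
    moreover have "V - ?X = V - X - {y}" "r - card X = Suc (r - card ?X)" using cardX 3 by auto
    ultimately have B: "decomposable_clutter (r - card ?X) (V - X - {y}) ((\<lambda>W. W - {y}) ` {W \<in> ?H. y \<in> W})"
      by (simp only:)
    have "\<exists>w\<in>U. insert y (U - {w}) \<in> ?H" if U: "U \<in> ?H" "y \<notin> U" for U
    proof -
      obtain W where W: "W \<subseteq> V" "card W = r" "conn_set E W" "X \<subseteq> W" "U = W - X"
        using U(1) by (auto simp: conn_subsets_def)
      have yW: "y \<notin> W" using U W xy by auto
      have finW: "finite W" using W(1) less.prems(1) finite_subset by blast
      \<comment> \<open>The connected core protected during the exchange is
        \<open>insert y X\<close>, so the vertex given up lies outside \<open>X\<close>. The core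
        still fits because \<open>card X < r\<close>.\<close>
      obtain z where z: "z \<in> W - ?X" "conn_set E (insert y (W - {z}))"
        using conn_set_exchange[OF \<open>sym E\<close> finW W(3) connX _ _ yW xy(3)] W xy yW 3 cardX by auto
      have "card (insert y (W - {z})) = r" using card_exchange[OF finW _ yW] z W(2) by blast
      then have "insert y (W - {z}) \<in> {W \<in> conn_subsets E r V. X \<subseteq> W}"
        using z W yV by (auto simp: conn_subsets_def)
      moreover have "insert y (W - {z}) - X = insert y (U - {z})" using W xy by auto
      ultimately have "insert y (U - {z}) \<in> ?H" by (metis (no_types, lifting) image_eqI)
      moreover have "z \<in> U" using z W by blast
      ultimately show ?thesis by blast
    qed
    then show ?thesis
      using decomposable_clutter.step[of y "V - X" "r - card ?X" ?H] A B yV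
        \<open>r - card X = Suc (r - card ?X)\<close> by simp
  qed
qed

text \<open>At a vertex \<open>x\<close> of the transversal clique, the link consists of the
  connected sets containing \<open>x\<close> and is decomposable by
  \<open>decomposable_conn_supersets\<close> with core \<open>{x}\<close>. Only the deletion needs
  the induction: it is the same family on \<open>V - {x}\<close>, where chordality and touching
  persist.\<close>

lemma decomposable_conn_subsets:
  assumes "sym E" "irrefl E" "finite V" "chordal_on E V" "r \<ge> 1"
    and "\<And>W W'. W \<in> conn_subsets E r V \<Longrightarrow> W' \<in> conn_subsets E r V \<Longrightarrow> touching E W W'"
  shows "decomposable_clutter r V (conn_subsets E r V)"
  using assms(3,4,6)
proof (induction "card V" arbitrary: V rule: less_induct)
  case less
  let ?H = "conn_subsets E r V"
  show ?case
  proof (cases "?H = {}")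
    case True
    then show ?thesis using less.prems by (simp add: decomposable_clutter.empty)
  next
    case False
    obtain K where K: "K \<subseteq> V" "clique_set E K" "\<And>W. W \<in> ?H \<Longrightarrow> K \<inter> W \<noteq> {}"
    proof (rule touching_family_clique_transversal[OF assms(1,2) less.prems(1,2)])
      show "W \<subseteq> V \<and> conn_set E W" if "W \<in> ?H" for W using that by (simp add: conn_subsets_def)
    qed (use less.prems(3) in blast)+
    then obtain x where x: "x \<in> K" "x \<in> V" using False by blast
    obtain r' where r': "r = Suc r'" using assms(5) by (cases r) auto
    have "decomposable_clutter r (V - {x}) (conn_subsets E r (V - {x}))"
    proof (rule less.hyps)
      show "card (V - {x}) < card V" using x less.prems(1) by (meson card_Diff1_less)
      show "chordal_on E (V - {x})" using chordal_on_mono[OF less.prems(2)] by blast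
      show "finite (V - {x})" using less.prems(1) by simp
      fix W W' assume "W \<in> conn_subsets E r (V - {x})" "W' \<in> conn_subsets E r (V - {x})"
      then show "touching E W W'" by (intro less.prems(3)) (auto simp: conn_subsets_def)
    qed
    moreover have "conn_subsets E r (V - {x}) = {W \<in> ?H. x \<notin> W}" by (auto simp: conn_subsets_def)
    moreover have "decomposable_clutter (r - card {x}) (V - {x}) ((\<lambda>W. W - {x}) ` {W \<in> ?H. {x} \<subseteq> W})"
      using assms x less.prems by (intro decomposable_conn_supersets) (auto simp: conn_set_singleton)
    moreover have "\<exists>w\<in>W. insert x (W - {w}) \<in> ?H" if W: "W \<in> ?H" "x \<notin> W" for W
    proof -
      obtain k where k: "k \<in> K" "k \<in> W" using K(3)[OF W(1)] by blast
      then have "(k, x) \<in> E" using K(2) x W unfolding clique_set_def by metis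
      moreover have finW: "finite W" using W less.prems(1) by (auto simp: conn_subsets_def intro: finite_subset)
      ultimately obtain z where z: "z \<in> W - {x}" "conn_set E (insert x (W - {z}))"
        using conn_set_exchange[OF assms(1) _ _ conn_set_singleton, of W x x k] W k assms(5)
        by (auto simp: conn_subsets_def)
      have "card (insert x (W - {z})) = r"
        using card_exchange[OF finW _ W(2)] z W(1) unfolding conn_subsets_def by blast
      then show ?thesis using z W x by (intro bexI[of _ z]) (auto simp: conn_subsets_def)
    qed
    ultimately show ?thesis
      using decomposable_clutter.step[of x V r' ?H] x r' by simp
  qed
qed

section \<open>Gaps in chordal graphs\<close>

lemma arcs_ends_induce_subgraph: "arcs_ends (G \<restriction> W) = arcs_ends G \<inter> W \<times> W"
  by (auto simp: arcs_ends_conv)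

text \<open>A path that leaves \<open>A\<close> crosses its boundary; conversely, the set of
  vertices reachable from \<open>u\<close> has no outgoing edge and must be everything.\<close>

lemma connected_induce_subgraph_iff:
  assumes "graph G" "W \<subseteq> verts G"
  shows "connected (G \<restriction> W) \<longleftrightarrow> conn_set (arcs_ends G) W"
proof -
  interpret graph G by fact
  interpret H: wf_digraph "G \<restriction> W" by (rule wellformed_induce_subgraph)
  have symG: "sym (arcs_ends G)" using sym_arcs by (simp add: symmetric_def)
  have "symmetric (G \<restriction> W)"
    using symG unfolding symmetric_def arcs_ends_induce_subgraph by (auto simp: sym_def)
  let ?R = "rtrancl_on W (arcs_ends G \<inter> W \<times> W)"
  have "connected (G \<restriction> W) \<longleftrightarrow> W \<noteq> {} \<and> (\<forall>u\<in>W. \<forall>v\<in>W. (u, v) \<in> ?R)"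
    unfolding connected_def strongly_connected_def
    using H.reachable_mk_symmetric_eq[OF \<open>symmetric (G \<restriction> W)\<close>]
    by (simp add: reachable_def arcs_ends_induce_subgraph mk_symmetric_def)
  also have "\<dots> \<longleftrightarrow> conn_set (arcs_ends G) W"
  proof
    assume L: "W \<noteq> {} \<and> (\<forall>u\<in>W. \<forall>v\<in>W. (u, v) \<in> ?R)"
    show "conn_set (arcs_ends G) W" unfolding conn_set_def
    proof (intro conjI allI impI)
      fix A assume A: "A \<subseteq> W \<and> A \<noteq> {} \<and> A \<noteq> W"
      then obtain a b where ab: "a \<in> A" "b \<in> W - A" by blast
      have "(a, b) \<in> ?R" using L A ab by blast
      then have "b \<in> A \<or> (\<exists>a\<in>A. \<exists>b\<in>W - A. (a, b) \<in> arcs_ends G)"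
        by (induction rule: rtrancl_on_induct) (use ab in auto)
      then show "\<exists>a\<in>A. \<exists>b\<in>W - A. (a, b) \<in> arcs_ends G" using ab by blast
    qed (use L in blast)
  next
    assume R: "conn_set (arcs_ends G) W"
    have "(u, v) \<in> ?R" if uv: "u \<in> W" "v \<in> W" for u v
    proof -
      let ?A = "{x \<in> W. (u, x) \<in> ?R}"
      have "?A = W"
      proof (rule ccontr)
        assume "?A \<noteq> W"
        moreover have "u \<in> ?A" using uv by simp
        ultimately obtain a b where "a \<in> ?A" "b \<in> W - ?A" "(a, b) \<in> arcs_ends G"
          using conn_setD[OF R, of ?A] by blast
        then show False
          using rtrancl_on_into_rtrancl_on[of u a W "arcs_ends G \<inter> W \<times> W" b] by blast
      qed
      then show ?thesis using uv by blast
    qed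
    then show "W \<noteq> {} \<and> (\<forall>u\<in>W. \<forall>v\<in>W. (u, v) \<in> ?R)" using R unfolding conn_set_def by blast
  qed
  finally show ?thesis .
qed

lemma Con_eq_conn_subsets: "graph G \<Longrightarrow> Con r G = conn_subsets (arcs_ends G) r (verts G)"
  unfolding Con_def conn_subsets_def using connected_induce_subgraph_iff by blast

lemma graph_arcs_ends:
  assumes "graph G"
  shows "sym (arcs_ends G)" "irrefl (arcs_ends G)" "finite (verts G)"
proof -
  interpret graph G by fact
  show "sym (arcs_ends G)" using sym_arcs by (simp add: symmetric_def)
  show "irrefl (arcs_ends G)" by (auto simp: irrefl_def arcs_ends_conv dest: no_loops)
  show "finite (verts G)" by simp
qed

lemma chordal_graph_iff: "chordal_graph G \<longleftrightarrow> chordal_on (arcs_ends G) (verts G)"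
proof -
  have "induced_cycle G c \<and> length c \<ge> 4 \<longleftrightarrow> length c \<ge> 4 \<and> distinct c \<and> set c \<subseteq> verts G \<and>
     (\<forall>i<length c. \<forall>j<length c. (c ! i, c ! j) \<in> arcs_ends G \<longleftrightarrow>
        j = Suc i mod length c \<or> i = Suc j mod length c)" for c
    unfolding induced_cycle_def by (cases "length c \<ge> 4") simp_all
  then show ?thesis unfolding chordal_graph_def chordal_on_def by (simp only:)
qed

text \<open>Any two members of an induced matching form one: a third circuit inside their union
  would belong to the matching, hence be disjoint from both of them and empty.\<close>

lemma gap_obtain:
  assumes "graph G" "r \<ge> 2" "\<not> gap_free r G"
  obtains A B where "A \<in> Con r G" "B \<in> Con r G" "A \<inter> B = {}"
    "\<And>C. C \<in> Con r G \<Longrightarrow> C \<subseteq> A \<union> B \<Longrightarrow> C = A \<or> C = B"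
proof -
  \<comment> \<open>The negation includes infinite \<open>M\<close>, whose \<open>card\<close> is 0;
    in either case \<open>M\<close> has two distinct members.\<close>
  obtain M where M: "induced_matching (Con r G) M" "\<not> (finite M \<and> card M \<le> 1)"
    using assms(3) unfolding gap_free_def by blast
  have "\<exists>A\<in>M. \<exists>B\<in>M. A \<noteq> B"
  proof (rule ccontr)
    assume no: "\<not> ?thesis"
    show False
    proof (cases "M = {}")
      case False
      then obtain A where "A \<in> M" by blast
      then have "M = {A}" using no by blast
      then show False using M(2) by simp
    qed (use M in simp)
  qed
  then obtain A B where AB: "A \<in> M" "B \<in> M" "A \<noteq> B" by blast
  have MD: "M \<subseteq> Con r G" "disjoint M" "{C \<in> Con r G. C \<subseteq> \<Union> M} = M"
    using M(1) unfolding induced_matching_def by auto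
  have "C = A \<or> C = B" if C: "C \<in> Con r G" "C \<subseteq> A \<union> B" for C
  proof (rule ccontr)
    assume no: "\<not> ?thesis"
    have "C \<in> M" using C AB MD(3) by blast
    then have "C \<inter> A = {}" "C \<inter> B = {}" using no AB MD(2) unfolding disjoint_def by blast+
    then have "C = {}" using C by blast
    then show False using C(1) assms(2) by (simp add: Con_def)
  qed
  moreover have "A \<inter> B = {}" using AB MD(2) unfolding disjoint_def by blast
  moreover have "A \<in> Con r G" "B \<in> Con r G" using AB MD(1) by blast+
  ultimately show ?thesis by (intro that[of A B])
qed

text \<open>If \<open>A\<close> and \<open>B\<close> are disjoint and not joined by an edge, a
  connected set inside their union lies in one of them and equals it by size, so
  \<open>{A, B}\<close> would be an induced matching.\<close>

lemma gap_free_touching: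
  assumes "graph G" "r \<ge> 2" "gap_free r G" "A \<in> Con r G" "B \<in> Con r G"
  shows "touching (arcs_ends G) A B"
proof (rule ccontr)
  assume nt: "\<not> touching (arcs_ends G) A B"
  then have AB: "A \<inter> B = {}" and ne: "\<And>a b. a \<in> A \<Longrightarrow> b \<in> B \<Longrightarrow> (a, b) \<notin> arcs_ends G"
    unfolding touching_def by auto
  have sym: "sym (arcs_ends G)" and fin: "finite (verts G)" using graph_arcs_ends[OF assms(1)] by auto
  have AB': "card A = r" "card B = r" "finite A" "finite B"
    using assms(4,5) fin finite_subset unfolding Con_def by auto
  have "A \<noteq> B" using AB AB' assms(2) by auto
  have "C = A \<or> C = B" if C: "C \<in> Con r G" "C \<subseteq> A \<union> B" for C
  proof -
    have cC: "conn_set (arcs_ends G) C" "card C = r"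
      using C(1) unfolding Con_eq_conn_subsets[OF assms(1)] conn_subsets_def by auto
    have "C \<inter> A = {} \<or> C \<inter> A = C"
    proof (rule ccontr)
      assume "\<not> ?thesis"
      then obtain a b where "a \<in> C \<inter> A" "b \<in> C - (C \<inter> A)" "(a, b) \<in> arcs_ends G"
        using conn_setD[OF cC(1), of "C \<inter> A"] by blast
      then show False using ne C(2) by blast
    qed
    then have "C \<subseteq> B \<or> C \<subseteq> A" using C(2) by blast
    then show ?thesis using cC(2) AB' card_subset_eq by metis
  qed
  then have "induced_matching (Con r G) {A, B}"
    using assms(4,5) AB unfolding induced_matching_def disjoint_def by auto
  then have "card {A, B} \<le> 1" using assms(3) unfolding gap_free_def by blast
  then show False using \<open>A \<noteq> B\<close> by simp
qed

lemma decomposable_Con: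
  assumes "graph G" "chordal_graph G" "r \<ge> 2" "gap_free r G"
  shows "decomposable_clutter r (verts G) (Con r G)"
  unfolding Con_eq_conn_subsets[OF assms(1)]
proof (rule decomposable_conn_subsets)
  show "chordal_on (arcs_ends G) (verts G)" using assms(2) chordal_graph_iff by blast
  show "touching (arcs_ends G) W W'"
    if "W \<in> conn_subsets (arcs_ends G) r (verts G)" "W' \<in> conn_subsets (arcs_ends G) r (verts G)" for W W'
    using gap_free_touching[OF assms(1,3,4)] that Con_eq_conn_subsets[OF assms(1)] by blast
qed (use assms graph_arcs_ends in auto)

text \<open>An r-set that misses a vertex of \<open>A\<close> and one of \<open>B\<close> is neither
  of the two, so inside the union of a gap it is a circuit of the complement. This is the
  configuration excluded by \<open>chordal_clutter_no_sphere\<close>.\<close>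

lemma gap_free_of_cochordal_Con:
  assumes "graph G" "r \<ge> 2" "cochordal_clutter r (verts G) (Con r G)"
  shows "gap_free r G"
proof (rule ccontr)
  assume "\<not> gap_free r G"
  then obtain A B where AB: "A \<in> Con r G" "B \<in> Con r G" "A \<inter> B = {}"
    "\<And>C. C \<in> Con r G \<Longrightarrow> C \<subseteq> A \<union> B \<Longrightarrow> C = A \<or> C = B"
    using gap_obtain assms by metis
  have sub: "A \<subseteq> verts G" "B \<subseteq> verts G" "card A = r" "card B = r" using AB by (auto simp: Con_def)
  show False
  proof (rule chordal_clutter_no_sphere[OF assms(3)[unfolded cochordal_clutter_def] assms(2) sub(3,4) AB(3)])
    fix a b C assume C: "a \<in> A" "b \<in> B" "C \<subseteq> A \<union> B - {a, b}" "card C = r"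
    then have "C \<noteq> A" "C \<noteq> B" by auto
    then have "C \<notin> Con r G" using AB(4)[of C] C(3) by blast
    then show "C \<in> clutter_complement r (verts G) (Con r G)"
      using C sub by (auto simp: clutter_complement_def)
  qed (use AB in \<open>auto simp: clutter_complement_def\<close>)
qed

section \<open>Shellings\<close>

lemma generated_complex_closed: "A \<in> generated_complex \<F> \<Longrightarrow> B \<subseteq> A \<Longrightarrow> B \<in> generated_complex \<F>"
  unfolding generated_complex_def by blast

lemma face_subset_facet:
  assumes "finite \<Delta>" "A \<in> \<Delta>"
  obtains F where "F \<in> facets \<Delta>" "A \<subseteq> F"
proof -
  obtain M where "M \<in> \<Delta>" "A \<subseteq> M" "\<forall>B\<in>\<Delta>. M \<subseteq> B \<longrightarrow> M = B"
    using finite_has_maximal2[OF assms] by auto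
  then show ?thesis by (intro that[of M]) (auto simp: facets_def)
qed

text \<open>The faces of \<open>F\<close> of the required dimension are the sets
  \<open>F - {v}\<close>. Purity thus says that each \<open>A \<inter> F\<close> lies in such a set
  which is itself contained in a member of the family.\<close>

lemma pure_intersection_iff:
  assumes "finite F" "\<And>B. B \<in> \<F> \<Longrightarrow> \<not> F \<subseteq> B"
  shows "pure_of_dim (generated_complex {F} \<inter> generated_complex \<F>) (face_dim F - 1) \<longleftrightarrow>
         \<F> \<noteq> {} \<and> (\<forall>A\<in>\<F>. \<exists>v\<in>F - A. \<exists>B\<in>\<F>. F - {v} \<subseteq> B)" (is "pure_of_dim ?I _ \<longleftrightarrow> ?R")
proof
  have memI: "M \<in> ?I \<longleftrightarrow> M \<subseteq> F \<and> (\<exists>B\<in>\<F>. M \<subseteq> B)" for M by (auto simp: generated_complex_def)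
  have finI: "finite ?I"
    using assms(1) by (intro finite_subset[of ?I "Pow F"]) (auto simp: generated_complex_def)
  assume L: "pure_of_dim ?I (face_dim F - 1)"
  have "\<exists>v\<in>F - A. \<exists>B\<in>\<F>. F - {v} \<subseteq> B" if A: "A \<in> \<F>" for A
  proof -
    have "A \<inter> F \<in> ?I" using A memI by blast
    then obtain M where M: "M \<in> facets ?I" "A \<inter> F \<subseteq> M" using face_subset_facet[OF finI] by blast
    then have MF: "M \<subseteq> F" "int (card M) = int (card F) - 1" "M \<in> ?I"
      using L memI by (auto simp: pure_of_dim_def face_dim_def facets_def)
    then have "card (F - M) = 1" using assms(1) by (simp add: card_Diff_subset finite_subset)
    then obtain v where v: "F - M = {v}" by (auto simp: card_1_singleton_iff)
    then have "M = F - {v}" using MF(1) by blast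
    moreover have "v \<in> F - A" using v M(2) by blast
    moreover obtain B where "B \<in> \<F>" "M \<subseteq> B" using MF(3) memI by auto
    ultimately show ?thesis by (intro bexI[of _ v] bexI[of _ B]) simp_all
  qed
  moreover have "\<F> \<noteq> {}" using L memI by (auto simp: pure_of_dim_def)
  ultimately show ?R by blast
next
  have memI: "M \<in> ?I \<longleftrightarrow> M \<subseteq> F \<and> (\<exists>B\<in>\<F>. M \<subseteq> B)" for M by (auto simp: generated_complex_def)
  assume R: ?R
  have "face_dim M = face_dim F - 1" if M: "M \<in> facets ?I" for M
  proof -
    have "M \<in> ?I" using M by (simp add: facets_def)
    then obtain A where A: "M \<subseteq> F" "A \<in> \<F>" "M \<subseteq> A" using memI by auto
    then obtain v B where v: "v \<in> F - A" "B \<in> \<F>" "F - {v} \<subseteq> B" using R by blast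
    have "F - {v} \<in> ?I" unfolding memI using v by blast
    moreover have "M \<subseteq> F - {v}" using A v by blast
    ultimately have "M = F - {v}" using M by (auto simp: facets_def)
    moreover have "card F \<ge> 1" using v(1) assms(1) by (auto simp: Suc_le_eq card_gt_0_iff)
    ultimately show ?thesis using v(1) by (auto simp: face_dim_def of_nat_diff)
  qed
  moreover have "?I \<noteq> {}" using R memI by blast
  ultimately show "pure_of_dim ?I (face_dim F - 1)" by (simp add: pure_of_dim_def)
qed

text \<open>The exchange form of a shelling. It refers to positions in a list only, which suits
  concatenation and induction on prefixes.\<close>

definition shelling :: "'v set list \<Rightarrow> bool" where
  "shelling Fs \<longleftrightarrow> (\<forall>i<length Fs. \<forall>j<i. \<exists>v\<in>Fs ! i - Fs ! j. \<exists>k<i. Fs ! i - {v} \<subseteq> Fs ! k)"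

lemma shellable_iff_shelling:
  assumes "finite \<Delta>" "\<And>A. A \<in> \<Delta> \<Longrightarrow> finite A"
  shows "shellable \<Delta> \<longleftrightarrow> (\<exists>Fs. distinct Fs \<and> set Fs = facets \<Delta> \<and> shelling Fs)"
proof -
  have "(\<forall>i. 1 \<le> i \<and> i < length Fs \<longrightarrow>
           pure_of_dim (generated_complex {Fs ! i} \<inter> generated_complex (set (take i Fs)))
             (face_dim (Fs ! i) - 1)) \<longleftrightarrow> shelling Fs"
    if Fs: "distinct Fs" "set Fs = facets \<Delta>" for Fs
  proof -
    have "pure_of_dim (generated_complex {Fs ! i} \<inter> generated_complex (set (take i Fs)))
             (face_dim (Fs ! i) - 1) \<longleftrightarrow>
          (\<forall>j<i. \<exists>v\<in>Fs ! i - Fs ! j. \<exists>k<i. Fs ! i - {v} \<subseteq> Fs ! k)" if i: "1 \<le> i" "i < length Fs" for i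
    proof -
      have mem: "B \<in> set (take i Fs) \<longleftrightarrow> (\<exists>j<i. B = Fs ! j)" for B
        using i by (auto simp: in_set_conv_nth)
      have fac: "Fs ! m \<in> facets \<Delta>" if "m < length Fs" for m using Fs(2) nth_mem[OF that] by simp
      have ne: "\<not> Fs ! i \<subseteq> B" if B: "B \<in> set (take i Fs)" for B
      proof
        assume sub: "Fs ! i \<subseteq> B"
        obtain j where j: "j < i" "B = Fs ! j" using B mem by blast
        then have "Fs ! j = Fs ! i"
          using fac[of i] fac[of j] i sub unfolding facets_def by simp
        then show False using j i Fs(1) by (simp add: nth_eq_iff_index_eq)
      qed
      have "finite (Fs ! i)" using fac[OF i(2)] assms(2) unfolding facets_def by blast
      moreover have "take i Fs \<noteq> []" using i by auto
      ultimately have "pure_of_dim (generated_complex {Fs ! i} \<inter> generated_complex (set (take i Fs)))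
             (face_dim (Fs ! i) - 1) \<longleftrightarrow>
          (\<forall>A\<in>set (take i Fs). \<exists>v\<in>Fs ! i - A. \<exists>B\<in>set (take i Fs). Fs ! i - {v} \<subseteq> B)"
        using ne by (subst pure_intersection_iff) auto
      moreover have "set (take i Fs) = (!) Fs ` {..<i}" using mem by auto
      then have "(\<forall>A\<in>set (take i Fs). \<exists>v\<in>Fs ! i - A. \<exists>B\<in>set (take i Fs). Fs ! i - {v} \<subseteq> B) \<longleftrightarrow>
          (\<forall>j<i. \<exists>v\<in>Fs ! i - Fs ! j. \<exists>k<i. Fs ! i - {v} \<subseteq> Fs ! k)"
        by (simp, simp add: Ball_def Bex_def)
      ultimately show ?thesis by (simp only:)
    qed
    then show ?thesis unfolding shelling_def by (metis One_nat_def Suc_le_eq not_less_zero gr_zeroI)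
  qed
  then show ?thesis unfolding shellable_def by blast
qed

text \<open>For a new facet \<open>insert x L\<close> against a facet of \<open>Ds\<close>, the
  vertex to drop is \<open>x\<close>, because \<open>L\<close> lies in some member of
  \<open>Ds\<close>. Against an earlier facet through \<open>x\<close>, the shelling of the link
  supplies the vertex.\<close>

lemma shelling_append:
  assumes "shelling Ds" "shelling Ls"
    and "\<And>D. D \<in> set Ds \<Longrightarrow> x \<notin> D" "\<And>L. L \<in> set Ls \<Longrightarrow> x \<notin> L"
    and "\<And>L. L \<in> set Ls \<Longrightarrow> \<exists>D\<in>set Ds. L \<subseteq> D"
  shows "shelling (Ds @ map (insert x) Ls)"
  unfolding shelling_def
proof (intro allI impI)
  let ?F = "Ds @ map (insert x) Ls"
  fix i j assume ij: "i < length ?F" "j < i"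
  show "\<exists>v\<in>?F ! i - ?F ! j. \<exists>k<i. ?F ! i - {v} \<subseteq> ?F ! k"
  proof (cases "i < length Ds")
    case True
    then obtain v k where "v \<in> Ds ! i - Ds ! j" "k < i" "Ds ! i - {v} \<subseteq> Ds ! k"
      using assms(1) ij unfolding shelling_def by blast
    then show ?thesis using True ij by (intro bexI[of _ v] exI[of _ k]) (auto simp: nth_append)
  next
    case False
    define l where "l = i - length Ds"
    have l: "l < length Ls" "i = length Ds + l" using False ij by (auto simp: l_def)
    then have Fi: "?F ! i = insert x (Ls ! l)" by (simp add: nth_append)
    have xl: "x \<notin> Ls ! l" using assms(4) l by simp
    show ?thesis
    proof (cases "j < length Ds")
      case True
      obtain D where "D \<in> set Ds" "Ls ! l \<subseteq> D" using assms(5) l by (meson nth_mem)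
      then obtain k where k: "k < length Ds" "Ls ! l \<subseteq> Ds ! k" by (metis in_set_conv_nth)
      have "x \<notin> Ds ! j" using assms(3) True by simp
      then show ?thesis unfolding Fi using k l True xl
        by (intro bexI[of _ x] exI[of _ k]) (auto simp: nth_append)
    next
      case Fj: False
      define m where "m = j - length Ds"
      have m: "m < l" "j = length Ds + m" using Fj ij l by (auto simp: m_def)
      then obtain v k where v: "v \<in> Ls ! l - Ls ! m" "k < l" "Ls ! l - {v} \<subseteq> Ls ! k"
        using assms(2) l unfolding shelling_def by blast
      have "?F ! j = insert x (Ls ! m)" "?F ! (length Ds + k) = insert x (Ls ! k)"
        using m v l by (auto simp: nth_append)
      then show ?thesis unfolding Fi using v xl l
        by (intro bexI[of _ v] exI[of _ "length Ds + k"]) auto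
    qed
  qed
qed

text \<open>A facet of the complex avoiding \<open>x\<close> is always a facet of the deletion; the
  shedding condition is the converse.\<close>

lemma facets_link_deletion:
  assumes closed: "\<And>A B. A \<in> \<Delta> \<Longrightarrow> B \<subseteq> A \<Longrightarrow> B \<in> \<Delta>"
    and "facets (deletion \<Delta> x) \<subseteq> facets \<Delta>"
  shows "facets \<Delta> = facets (deletion \<Delta> x) \<union> insert x ` facets (link \<Delta> x)"
proof (intro equalityI subsetI)
  fix F assume F: "F \<in> facets \<Delta>"
  show "F \<in> facets (deletion \<Delta> x) \<union> insert x ` facets (link \<Delta> x)"
  proof (cases "x \<in> F")
    case True
    have "F - {x} \<in> facets (link \<Delta> x)"
      unfolding facets_def link_def
    proof (clarsimp, intro conjI allI impI)
      show "insert x F \<in> \<Delta>" using F True by (simp add: facets_def insert_absorb)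
      fix A assume A: "x \<notin> A \<and> insert x A \<in> \<Delta>" "F - {x} \<subseteq> A"
      then have "insert x A = F" using F True by (auto simp: facets_def)
      then show "A = F - {x}" using A by auto
    qed
    then show ?thesis using True by (metis UnI2 image_eqI insert_Diff)
  next
    case False
    then show ?thesis using F by (auto simp: facets_def deletion_def)
  qed
next
  fix F assume "F \<in> facets (deletion \<Delta> x) \<union> insert x ` facets (link \<Delta> x)"
  then consider "F \<in> facets (deletion \<Delta> x)" | L where "L \<in> facets (link \<Delta> x)" "F = insert x L" by blast
  then show "F \<in> facets \<Delta>"
  proof cases
    case 2
    then have L: "x \<notin> L" "F \<in> \<Delta>" by (auto simp: facets_def link_def)
    have "A = F" if A: "A \<in> \<Delta>" "F \<subseteq> A" for A
    proof -
      have "A - {x} \<in> link \<Delta> x" "L \<subseteq> A - {x}"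
        using A 2 L(1) closed[OF A(1)] by (auto simp: link_def insert_absorb)
      then have "A - {x} = L" using 2 by (auto simp: facets_def)
      then show ?thesis using A 2 by auto
    qed
    then show ?thesis using L by (simp add: facets_def)
  qed (use assms(2) in blast)
qed

lemma shellable_of_vertex_decomposable:
  assumes "vertex_decomposable \<Delta>" "finite \<Delta>" "\<And>A. A \<in> \<Delta> \<Longrightarrow> finite A"
    and "\<And>A B. A \<in> \<Delta> \<Longrightarrow> B \<subseteq> A \<Longrightarrow> B \<in> \<Delta>"
  shows "shellable \<Delta>"
proof -
  have "\<exists>Fs. distinct Fs \<and> set Fs = facets \<Delta> \<and> shelling Fs"
    using assms
  proof (induction rule: vertex_decomposable.induct)
    case void
    show ?case by (intro exI[of _ "[]"]) (auto simp: facets_def shelling_def)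
  next
    case empty
    show ?case by (intro exI[of _ "[{}]"]) (auto simp: facets_def shelling_def)
  next
    case (simplex F)
    show ?case by (intro exI[of _ "[F]"]) (auto simp: facets_def shelling_def)
  next
    case (shedding x \<Delta>)
    have "link \<Delta> x \<subseteq> \<Delta>" using shedding.prems(3) unfolding link_def by blast
    then have linkfin: "finite (link \<Delta> x)" "\<And>A. A \<in> link \<Delta> x \<Longrightarrow> finite A"
      using shedding.prems(1,2) finite_subset by blast+
    have "B \<in> link \<Delta> x" if "A \<in> link \<Delta> x" "B \<subseteq> A" for A B
      using that shedding.prems(3)[of "insert x A" "insert x B"] unfolding link_def by blast
    then obtain Ls where Ls: "distinct Ls" "set Ls = facets (link \<Delta> x)" "shelling Ls"
      using shedding.IH(1) linkfin by metis
    have "deletion \<Delta> x \<subseteq> \<Delta>" unfolding deletion_def by blast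
    then have delfin: "finite (deletion \<Delta> x)" "\<And>A. A \<in> deletion \<Delta> x \<Longrightarrow> finite A"
      using shedding.prems(1,2) finite_subset by blast+
    have "B \<in> deletion \<Delta> x" if "A \<in> deletion \<Delta> x" "B \<subseteq> A" for A B
      using that shedding.prems(3)[of A B] unfolding deletion_def by blast
    then obtain Ds where Ds: "distinct Ds" "set Ds = facets (deletion \<Delta> x)" "shelling Ds"
      using shedding.IH(2) delfin by metis
    have xD: "x \<notin> D" if "D \<in> set Ds" for D using that Ds(2) by (auto simp: facets_def deletion_def)
    have xL: "x \<notin> L" if "L \<in> set Ls" for L using that Ls(2) by (auto simp: facets_def link_def)
    have LD: "\<exists>D\<in>set Ds. L \<subseteq> D" if L: "L \<in> set Ls" for L
    proof -
      have "insert x L \<in> \<Delta>" using L Ls(2) by (simp add: facets_def link_def)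
      then have "L \<in> deletion \<Delta> x" using shedding.prems(3) xL[OF L] unfolding deletion_def by blast
      then show ?thesis using face_subset_facet[OF delfin(1)] Ds(2) by metis
    qed
    have "set (Ds @ map (insert x) Ls) = facets \<Delta>"
      using facets_link_deletion[OF shedding.prems(3) shedding.hyps(4)] Ds(2) Ls(2) by simp
    moreover have "inj_on (insert x) (set Ls)"
      using xL by (intro inj_onI) (metis insert_ident)
    then have "distinct (Ds @ map (insert x) Ls)"
      using Ds(1) Ls(1) xD by (auto simp: distinct_map)
    ultimately show ?case using shelling_append[OF Ds(3) Ls(3) xD xL LD] by blast
  qed
  then show ?thesis using shellable_iff_shelling[OF assms(2,3)] by blast
qed

lemma Sigma_complex_finite:
  assumes "finite (verts G)"
  shows "finite (Sigma_complex r G)" "A \<in> Sigma_complex r G \<Longrightarrow> A \<subseteq> verts G"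
    "A \<in> Sigma_complex r G \<Longrightarrow> B \<subseteq> A \<Longrightarrow> B \<in> Sigma_complex r G"
proof -
  show sub: "A \<subseteq> verts G" if "A \<in> Sigma_complex r G" for A
    using that by (auto simp: Sigma_complex_def generated_complex_def)
  then show "finite (Sigma_complex r G)" using assms by (meson PowI finite_Pow_iff finite_subset subsetI)
qed (auto simp: Sigma_complex_def intro: generated_complex_closed)

text \<open>The generating faces all have the same size, so none of them properly contains
  another.\<close>

lemma facets_Sigma_complex:
  assumes "finite (verts G)"
  shows "facets (Sigma_complex r G) = (\<lambda>W. verts G - W) ` Con r G"
    "F \<in> facets (Sigma_complex r G) \<Longrightarrow> card F = card (verts G) - r"
proof -
  have card: "card (verts G - W) = card (verts G) - r" if "W \<in> Con r G" for W
    using that assms by (auto simp: Con_def card_Diff_subset finite_subset)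
  show eq: "facets (Sigma_complex r G) = (\<lambda>W. verts G - W) ` Con r G"
  proof (intro equalityI subsetI)
    fix F assume F: "F \<in> facets (Sigma_complex r G)"
    then obtain W where W: "W \<in> Con r G" "F \<subseteq> verts G - W"
      by (auto simp: facets_def Sigma_complex_def generated_complex_def)
    then have "verts G - W \<in> Sigma_complex r G" by (auto simp: Sigma_complex_def generated_complex_def)
    then have "F = verts G - W" using F W(2) by (auto simp: facets_def)
    then show "F \<in> (\<lambda>W. verts G - W) ` Con r G" using W by blast
  next
    fix F assume "F \<in> (\<lambda>W. verts G - W) ` Con r G"
    then obtain W where W: "W \<in> Con r G" "F = verts G - W" by blast
    have "A = F" if A: "A \<in> Sigma_complex r G" "F \<subseteq> A" for A
    proof -
      obtain W' where W': "W' \<in> Con r G" "A \<subseteq> verts G - W'"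
        using A(1) by (auto simp: Sigma_complex_def generated_complex_def)
      have "F = verts G - W'"
        using card[OF W(1)] card[OF W'(1)] W(2) W'(2) A(2) assms by (intro card_subset_eq) auto
      then show ?thesis using W'(2) A(2) by blast
    qed
    moreover have "F \<in> Sigma_complex r G" using W by (auto simp: Sigma_complex_def generated_complex_def)
    ultimately show "F \<in> facets (Sigma_complex r G)" by (simp add: facets_def)
  qed
  show "card F = card (verts G) - r" if "F \<in> facets (Sigma_complex r G)"
    using that card unfolding eq by blast
qed

section \<open>Weakly regular sequences\<close>

text \<open>Ideals and primes are treated as subsets of a whole type-class ring, where computation
  needs no membership conditions; \<open>ring_presentation\<close> carries the results over to the
  carrier-based quotient.\<close>

definition ideal_set :: "'a::comm_ring_1 set \<Rightarrow> bool" where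
  "ideal_set I \<longleftrightarrow> 0 \<in> I \<and> (\<forall>a\<in>I. \<forall>b\<in>I. a + b \<in> I) \<and> (\<forall>a\<in>I. \<forall>c. c * a \<in> I)"

definition prime_set :: "'a::comm_ring_1 set \<Rightarrow> bool" where
  "prime_set P \<longleftrightarrow> ideal_set P \<and> 1 \<notin> P \<and> (\<forall>a b. a * b \<in> P \<longrightarrow> a \<in> P \<or> b \<in> P)"

definition ext_ideal :: "'a::comm_ring_1 set \<Rightarrow> 'a \<Rightarrow> 'a set" where
  "ext_ideal I x = {i + x * a | i a. i \<in> I}"

definition colon_ideal :: "'a::comm_ring_1 set \<Rightarrow> 'a \<Rightarrow> 'a set" where
  "colon_ideal I f = {a. f * a \<in> I}"

primrec ext_ideals :: "'a::comm_ring_1 set \<Rightarrow> 'a list \<Rightarrow> 'a set" where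
  "ext_ideals I [] = I"
| "ext_ideals I (x # xs) = ext_ideals (ext_ideal I x) xs"

text \<open>The ideal generated along the way may become the whole ring. This makes the notion pass
  through colon ideals and extensions; properness is tracked separately as
  \<open>1 \<notin> ext_ideals I xs\<close>.\<close>

primrec weakly_regular :: "'a::comm_ring_1 set \<Rightarrow> 'a list \<Rightarrow> bool" where
  "weakly_regular I [] \<longleftrightarrow> True"
| "weakly_regular I (x # xs) \<longleftrightarrow> (\<forall>a. x * a \<in> I \<longrightarrow> a \<in> I) \<and> weakly_regular (ext_ideal I x) xs"

lemma ideal_setD:
  assumes "ideal_set I"
  shows "0 \<in> I" "a \<in> I \<Longrightarrow> b \<in> I \<Longrightarrow> a + b \<in> I" "a \<in> I \<Longrightarrow> c * a \<in> I" "a \<in> I \<Longrightarrow> a * c \<in> I"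
    "a \<in> I \<Longrightarrow> - a \<in> I" "a \<in> I \<Longrightarrow> b \<in> I \<Longrightarrow> a - b \<in> I"
proof -
  show 1: "0 \<in> I" "a \<in> I \<Longrightarrow> b \<in> I \<Longrightarrow> a + b \<in> I" "\<And>a c. a \<in> I \<Longrightarrow> c * a \<in> I" for a b
    using assms unfolding ideal_set_def by blast+
  show "a \<in> I \<Longrightarrow> a * c \<in> I" using 1(3)[of a c] by (simp add: mult.commute)
  show 2: "a \<in> I \<Longrightarrow> - a \<in> I" for a using 1(3)[of a "-1"] by simp
  show "a \<in> I \<Longrightarrow> b \<in> I \<Longrightarrow> a - b \<in> I" using 1(2)[of a "- b"] 2[of b] by simp
qed

lemma ideal_set_sum: "ideal_set I \<Longrightarrow> (\<And>x. x \<in> A \<Longrightarrow> f x \<in> I) \<Longrightarrow> sum f A \<in> I"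
  by (induction A rule: infinite_finite_induct) (auto intro: ideal_setD)

lemma ideal_set_cong_mem: "ideal_set I \<Longrightarrow> a - b \<in> I \<Longrightarrow> a \<in> I \<longleftrightarrow> b \<in> I"
  using ideal_setD(2)[of I "a - b" b] ideal_setD(6)[of I a "a - b"] by auto

lemma ext_idealI: "i \<in> I \<Longrightarrow> i + x * a \<in> ext_ideal I x"
  unfolding ext_ideal_def by blast

lemma ext_idealE:
  assumes "b \<in> ext_ideal I x"
  obtains i a where "i \<in> I" "b = i + x * a"
  using assms unfolding ext_ideal_def by blast

lemma ideal_set_ext: "ideal_set I \<Longrightarrow> ideal_set (ext_ideal I x)"
  unfolding ideal_set_def[of "ext_ideal I x"]
proof (intro conjI ballI allI)
  assume I: "ideal_set I"
  show "0 \<in> ext_ideal I x" using ext_idealI[OF ideal_setD(1)[OF I], of x 0] by simp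
  fix a assume a: "a \<in> ext_ideal I x"
  then obtain i s where i: "i \<in> I" "a = i + x * s" by (rule ext_idealE)
  show "c * a \<in> ext_ideal I x" for c
    using ext_idealI[OF ideal_setD(3)[OF I i(1)], of c x "c * s"] i(2) by (simp add: algebra_simps)
  fix b assume "b \<in> ext_ideal I x"
  then obtain j t where j: "j \<in> I" "b = j + x * t" by (rule ext_idealE)
  show "a + b \<in> ext_ideal I x"
    using ext_idealI[OF ideal_setD(2)[OF I i(1) j(1)], of x "s + t"] i j by (simp add: algebra_simps)
qed

lemma ext_ideal_superset: "I \<subseteq> ext_ideal I x"
  using ext_idealI[of _ I x 0] by auto

lemma ext_ideal_gen: "ideal_set I \<Longrightarrow> x \<in> ext_ideal I x"
  using ext_idealI[OF ideal_setD(1), of I x 1] by simp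

lemma ext_ideal_least: "ideal_set J \<Longrightarrow> I \<subseteq> J \<Longrightarrow> x \<in> J \<Longrightarrow> ext_ideal I x \<subseteq> J"
  by (auto elim!: ext_idealE intro!: ideal_setD(2,4))

lemma ext_ideal_cong:
  assumes "ideal_set I" "x - y \<in> I"
  shows "ext_ideal I x = ext_ideal I y"
proof -
  have sub: "ext_ideal I x \<subseteq> ext_ideal I y" if "x - y \<in> I" for x y
  proof (rule ext_ideal_least[OF ideal_set_ext[OF assms(1)] ext_ideal_superset])
    show "x \<in> ext_ideal I y" using ext_idealI[OF that, of y 1] by simp
  qed
  have "y - x \<in> I" using ideal_setD(5)[OF assms] by simp
  then show ?thesis using sub assms(2) by blast
qed

lemma ideal_set_exts: "ideal_set I \<Longrightarrow> ideal_set (ext_ideals I xs)"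
  by (induction xs arbitrary: I) (auto intro: ideal_set_ext)

lemma ext_ideals_superset: "I \<subseteq> ext_ideals I xs"
  by (induction xs arbitrary: I) (auto dest: subsetD[OF ext_ideal_superset])

lemma ext_ideals_gens: "ideal_set I \<Longrightarrow> set xs \<subseteq> ext_ideals I xs"
proof (induction xs arbitrary: I)
  case (Cons x xs)
  have "x \<in> ext_ideals (ext_ideal I x) xs"
    using ext_ideal_gen[OF Cons.prems] ext_ideals_superset by blast
  then show ?case using Cons.IH[OF ideal_set_ext[OF Cons.prems]] by simp
qed simp

lemma ext_ideals_least: "ideal_set J \<Longrightarrow> I \<subseteq> J \<Longrightarrow> set xs \<subseteq> J \<Longrightarrow> ext_ideals I xs \<subseteq> J"
  by (induction xs arbitrary: I) (simp_all add: ext_ideal_least)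

lemma weakly_regular_nth:
  "weakly_regular I xs \<longleftrightarrow>
     (\<forall>i<length xs. \<forall>a. xs ! i * a \<in> ext_ideals I (take i xs) \<longrightarrow> a \<in> ext_ideals I (take i xs))"
  by (induction xs arbitrary: I) (simp_all add: All_less_Suc2)

lemma weakly_regular_cong:
  assumes "ideal_set I" "x - y \<in> I"
  shows "weakly_regular I (x # xs) \<longleftrightarrow> weakly_regular I (y # xs)"
proof -
  have "x * a \<in> I \<longleftrightarrow> y * a \<in> I" for a
    using ideal_setD(4)[OF assms, of a] by (intro ideal_set_cong_mem[OF assms(1)]) (simp add: algebra_simps)
  then show ?thesis using ext_ideal_cong[OF assms] by simp
qed

text \<open>A weakly regular sequence on both ends of
  \<open>0 \<rightarrow> R/(I:f) \<rightarrow> R/I \<rightarrow> R/(I+(f)) \<rightarrow> 0\<close> is weakly regular on the middle term.\<close>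

lemma weakly_regular_extension:
  assumes "ideal_set I" "weakly_regular (colon_ideal I f) xs" "weakly_regular (ext_ideal I f) xs"
  shows "weakly_regular I xs"
  using assms
proof (induction xs arbitrary: I)
  case (Cons x xs)
  note I = ideal_setD[OF Cons.prems(1)]
  have c1: "\<And>a. f * (x * a) \<in> I \<Longrightarrow> f * a \<in> I" and c2: "weakly_regular (ext_ideal (colon_ideal I f) x) xs"
    using Cons.prems(2) by (auto simp: colon_ideal_def)
  have e1: "\<And>a. x * a \<in> ext_ideal I f \<Longrightarrow> a \<in> ext_ideal I f"
    and e2: "weakly_regular (ext_ideal (ext_ideal I f) x) xs"
    using Cons.prems(3) by auto
  have "a \<in> I" if xa: "x * a \<in> I" for a
  proof -
    have "a \<in> ext_ideal I f" using e1 xa ext_ideal_superset by blast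
    then obtain i b where i: "i \<in> I" "a = i + f * b" by (rule ext_idealE)
    have "f * (x * b) = x * a - x * i" using i(2) by (simp add: algebra_simps)
    then have "f * b \<in> I" using c1 I(6)[OF xa I(3)[OF i(1)]] by metis
    then show ?thesis using i I(2) by blast
  qed
  moreover have "weakly_regular (ext_ideal I x) xs"
  proof (rule Cons.IH[OF ideal_set_ext[OF Cons.prems(1)]])
    \<comment> \<open>The snake lemma for multiplication by \<open>x\<close>: from
      \<open>f * b = i + x * c\<close> it follows that \<open>x * c\<close> lies in
      \<open>ext_ideal I f\<close>, where \<open>x\<close> is a nonzerodivisor. So
      \<open>c = j + f * d\<close>, and \<open>b - x * d\<close> lies in the colon ideal.\<close>
    have "colon_ideal (ext_ideal I x) f = ext_ideal (colon_ideal I f) x"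
    proof (intro equalityI subsetI)
      fix b assume "b \<in> colon_ideal (ext_ideal I x) f"
      then have "f * b \<in> ext_ideal I x" by (simp add: colon_ideal_def)
      then obtain i c where i: "i \<in> I" "f * b = i + x * c" by (rule ext_idealE)
      have "x * c = (- i) + f * b" using i(2) by simp
      then have "x * c \<in> ext_ideal I f" using ext_idealI[OF I(5)[OF i(1)], of f b] by simp
      then obtain j d where j: "j \<in> I" "c = j + f * d" using e1 ext_idealE by blast
      have "f * (b - x * d) = i + x * j" using i j by (simp add: algebra_simps)
      then have "b - x * d \<in> colon_ideal I f"
        using I(2)[OF i(1) I(3)[OF j(1)]] by (simp add: colon_ideal_def)
      then show "b \<in> ext_ideal (colon_ideal I f) x" using ext_idealI[of "b - x * d" _ x d] by simp
    next
      fix b assume "b \<in> ext_ideal (colon_ideal I f) x"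
      then obtain i a where i: "f * i \<in> I" "b = i + x * a" by (auto elim!: ext_idealE simp: colon_ideal_def)
      then show "b \<in> colon_ideal (ext_ideal I x) f"
        using ext_idealI[OF i(1), of x "f * a"] by (simp add: colon_ideal_def algebra_simps)
    qed
    then show "weakly_regular (colon_ideal (ext_ideal I x) f) xs" using c2 by simp
    have "ext_ideal (ext_ideal I x) f = ext_ideal (ext_ideal I f) x"
    proof -
      have "ext_ideal (ext_ideal I y) z \<subseteq> ext_ideal (ext_ideal I z) y" for y z
      proof -
        have id: "ideal_set (ext_ideal (ext_ideal I z) y)"
          using ideal_set_ext Cons.prems(1) by blast
        show ?thesis
        proof (intro ext_ideal_least[OF id])
          show "y \<in> ext_ideal (ext_ideal I z) y" "I \<subseteq> ext_ideal (ext_ideal I z) y"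
            using ext_ideal_gen[OF ideal_set_ext[OF Cons.prems(1)]] ext_ideal_superset by blast+
          show "z \<in> ext_ideal (ext_ideal I z) y"
            using ext_ideal_gen[OF Cons.prems(1)] by (rule subsetD[OF ext_ideal_superset])
        qed
      qed
      then show ?thesis by blast
    qed
    then show "weakly_regular (ext_ideal (ext_ideal I x) f) xs" using e2 by simp
  qed
  ultimately show ?case by simp
qed simp

section \<open>Chains of prime ideals\<close>

definition prime_chain :: "'a::comm_ring_1 set \<Rightarrow> nat \<Rightarrow> (nat \<Rightarrow> 'a set) \<Rightarrow> bool" where
  "prime_chain I n P \<longleftrightarrow>
     (\<forall>i\<le>n. prime_set (P i)) \<and> (\<forall>i<n. P i \<subset> P (Suc i)) \<and> I \<subseteq> P 0"

lemma prime_set_ideal: "prime_set P \<Longrightarrow> ideal_set P"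
  by (simp add: prime_set_def)

lemma prime_set_power: "prime_set P \<Longrightarrow> a ^ n \<in> P \<Longrightarrow> a \<in> P"
  by (induction n) (auto simp: prime_set_def)

lemma prime_set_prod:
  assumes "prime_set P" "finite A" "prod f A \<in> P"
  shows "\<exists>x\<in>A. f x \<in> P"
  using assms(2,3,1) by (induction A rule: finite_induct) (auto simp: prime_set_def)

text \<open>An ideal maximal among those containing \<open>I\<close> and avoiding the multiplicative
  set \<open>M\<close> is prime; Zorn's lemma supplies one.\<close>

lemma prime_avoiding_exists:
  assumes "ideal_set I" "1 \<in> M" "\<And>a b. a \<in> M \<Longrightarrow> b \<in> M \<Longrightarrow> a * b \<in> M" "I \<inter> M = {}"
  obtains P where "prime_set P" "I \<subseteq> P" "P \<inter> M = {}"
proof -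
  let ?A = "{J. ideal_set J \<and> I \<subseteq> J \<and> J \<inter> M = {}}"
  have "\<exists>P\<in>?A. \<forall>X\<in>?A. P \<subseteq> X \<longrightarrow> X = P"
  proof (rule subset_Zorn_nonempty)
    show "?A \<noteq> {}" using assms by blast
    fix \<C> assume C: "\<C> \<noteq> {}" "subset.chain ?A \<C>"
    then have CA: "\<And>J. J \<in> \<C> \<Longrightarrow> ideal_set J \<and> I \<subseteq> J \<and> J \<inter> M = {}"
      and lin: "\<And>J K. J \<in> \<C> \<Longrightarrow> K \<in> \<C> \<Longrightarrow> J \<subseteq> K \<or> K \<subseteq> J"
      unfolding subset_chain_def by blast+
    have "ideal_set (\<Union>\<C>)" unfolding ideal_set_def
    proof (intro conjI ballI allI)
      show "0 \<in> \<Union>\<C>" using C(1) CA ideal_setD(1) by blast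
      fix a assume a: "a \<in> \<Union>\<C>"
      then obtain J where J: "J \<in> \<C>" "a \<in> J" by blast
      then show "c * a \<in> \<Union>\<C>" for c using CA ideal_setD(3) by blast
      fix b assume "b \<in> \<Union>\<C>"
      then obtain K where K: "K \<in> \<C>" "b \<in> K" by blast
      have "a \<in> J \<union> K" "b \<in> J \<union> K" "J \<union> K \<in> \<C>" using J K lin[of J K] by (auto simp: Un_absorb1 Un_absorb2)
      then show "a + b \<in> \<Union>\<C>" using CA ideal_setD(2) by blast
    qed
    then show "\<Union>\<C> \<in> ?A" using C(1) CA by blast
  qed
  then obtain P where P: "ideal_set P" "I \<subseteq> P" "P \<inter> M = {}"
    and max: "\<And>X. ideal_set X \<Longrightarrow> I \<subseteq> X \<Longrightarrow> X \<inter> M = {} \<Longrightarrow> P \<subseteq> X \<Longrightarrow> X = P" by auto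
  have meet: "\<exists>p\<in>P. \<exists>s. p + a * s \<in> M" if "a \<notin> P" for a
  proof (rule ccontr)
    assume no: "\<not> ?thesis"
    have "ext_ideal P a \<inter> M = {}" using no by (auto elim!: ext_idealE)
    then have "ext_ideal P a = P"
      using max[of "ext_ideal P a"] ideal_set_ext[OF P(1)] P(2) ext_ideal_superset[of P a] by blast
    then show False using ext_ideal_gen[OF P(1), of a] that by simp
  qed
  have "a \<in> P \<or> b \<in> P" if ab: "a * b \<in> P" for a b
  proof (rule ccontr)
    assume no: "\<not> ?thesis"
    then obtain p s q t where p: "p \<in> P" "p + a * s \<in> M" "q \<in> P" "q + b * t \<in> M" using meet by metis
    then have "(p + a * s) * (q + b * t) \<in> M" using assms(3) by blast
    moreover have "(p + a * s) * (q + b * t) = p * (q + b * t) + (q * (a * s) + (a * b) * (s * t))"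
      by (simp add: algebra_simps)
    moreover have "\<dots> \<in> P" using p ab ideal_setD[OF P(1)] by simp
    ultimately show False using P(3) by auto
  qed
  then have "prime_set P" using P assms(2) unfolding prime_set_def by blast
  then show ?thesis using that P by blast
qed

text \<open>Localisation at \<open>P\<close> and \<open>x\<close> in elementary form: the products
  \<open>s * x ^ n\<close> with \<open>s \<notin> P\<close> avoid \<open>I\<close> because
  \<open>x\<close> is a nonzerodivisor modulo \<open>I\<close>. A prime avoiding them lies in
  \<open>P\<close> (take \<open>n = 0\<close>) and misses \<open>x\<close> (take
  \<open>s = 1\<close>).\<close>

lemma prime_below_nonzerodivisor:
  assumes "ideal_set I" "prime_set P" "I \<subseteq> P" "\<And>a. x * a \<in> I \<Longrightarrow> a \<in> I"
  obtains Q where "prime_set Q" "I \<subseteq> Q" "Q \<subseteq> P" "x \<notin> Q"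
proof -
  let ?M = "{s * x ^ n | s n. s \<notin> P}"
  have nzd: "a \<in> I" if "a * x ^ n \<in> I" for a n
    using that
  proof (induction n)
    case (Suc n)
    then have "x * (a * x ^ n) \<in> I" by (simp add: algebra_simps)
    then show ?case using assms(4) Suc.IH by blast
  qed simp
  have one: "1 \<notin> P" and pr: "\<And>a b. a * b \<in> P \<Longrightarrow> a \<in> P \<or> b \<in> P"
    using assms(2) unfolding prime_set_def by blast+
  have mult: "a * b \<in> ?M" if ab: "a \<in> ?M" "b \<in> ?M" for a b
  proof -
    obtain s m t n where st: "a = s * x ^ m" "s \<notin> P" "b = t * x ^ n" "t \<notin> P" using ab by blast
    then have "a * b = (s * t) * x ^ (m + n)" by (simp add: power_add algebra_simps)
    moreover have "s * t \<notin> P" using st pr by blast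
    ultimately show ?thesis by blast
  qed
  have base: "s \<in> ?M" if "s \<notin> P" for s
  proof -
    have "s = s * x ^ 0" by simp
    then show ?thesis using that by blast
  qed
  have "I \<inter> ?M = {}" using nzd assms(3) by blast
  obtain Q where Q: "prime_set Q" "I \<subseteq> Q" "Q \<inter> ?M = {}"
  proof (rule prime_avoiding_exists[OF assms(1) base[OF one] _ \<open>I \<inter> ?M = {}\<close>])
    show "a * b \<in> ?M" if "a \<in> ?M" "b \<in> ?M" for a b using that by (rule mult)
  qed
  have "Q \<subseteq> P" using Q(3) base by blast
  moreover have "x \<in> ?M"
  proof -
    have "x = 1 * x ^ 1" by simp
    then show ?thesis using one by blast
  qed
  ultimately show ?thesis using that Q by blast
qed

text \<open>The chain found modulo the first element is extended by one prime at the bottom that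
  misses this element. This is the inequality between depth and dimension.\<close>

lemma prime_chain_of_weakly_regular:
  assumes "ideal_set I" "weakly_regular I xs" "1 \<notin> ext_ideals I xs"
  shows "\<exists>P. prime_chain I (length xs) P"
  using assms
proof (induction xs arbitrary: I)
  case Nil
  have "I \<inter> {1} = {}" using Nil by simp
  then obtain P where "prime_set P" "I \<subseteq> P"
    using prime_avoiding_exists[OF Nil.prems(1), of "{1}"] by auto
  then show ?case by (intro exI[of _ "\<lambda>_. P"]) (simp add: prime_chain_def)
next
  case (Cons x xs)
  have "\<exists>P. prime_chain (ext_ideal I x) (length xs) P"
    using Cons.prems by (intro Cons.IH ideal_set_ext) simp_all
  then obtain P where P: "prime_chain (ext_ideal I x) (length xs) P" by blast
  then have P0: "prime_set (P 0)" "ext_ideal I x \<subseteq> P 0" unfolding prime_chain_def by auto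
  then have IP: "I \<subseteq> P 0" "x \<in> P 0"
    using ext_ideal_superset ext_ideal_gen[OF Cons.prems(1)] by blast+
  obtain Q where Q: "prime_set Q" "I \<subseteq> Q" "Q \<subseteq> P 0" "x \<notin> Q"
    using prime_below_nonzerodivisor[OF Cons.prems(1) P0(1) IP(1), of x] Cons.prems(2) by auto
  have "prime_chain I (Suc (length xs)) (\<lambda>i. case i of 0 \<Rightarrow> Q | Suc j \<Rightarrow> P j)"
    unfolding prime_chain_def
  proof (intro conjI allI impI)
    fix i assume "i \<le> Suc (length xs)"
    then show "prime_set (case i of 0 \<Rightarrow> Q | Suc j \<Rightarrow> P j)"
      using Q(1) P by (cases i) (auto simp: prime_chain_def)
  next
    fix i assume "i < Suc (length xs)"
    then show "(case i of 0 \<Rightarrow> Q | Suc j \<Rightarrow> P j) \<subset> (case Suc i of 0 \<Rightarrow> Q | Suc j \<Rightarrow> P j)"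
      using Q IP P by (cases i) (auto simp: prime_chain_def)
  qed (use Q in simp)
  then show ?case by (metis length_Cons)
qed

definition monomial_eval :: "'a::comm_ring_1 list \<Rightarrow> nat list \<Rightarrow> 'a" where
  "monomial_eval ys \<alpha> = prod_list (map2 (^) ys \<alpha>)"

text \<open>Elements \<open>y\<^sub>i \<in> P\<^sub>i\<^sub>+\<^sub>1 - P\<^sub>i\<close> are algebraically independent modulo \<open>P\<^sub>0\<close>: divide a relation by the
  lowest power of the first variable and pass to \<open>P\<^sub>1\<close>.\<close>

lemma prime_chain_independent:
  assumes "\<forall>i\<le>length ys. prime_set (P i)" "\<forall>i<length ys. P i \<subseteq> P (Suc i)"
    and "\<forall>i<length ys. ys ! i \<in> P (Suc i) - P i"
    and "finite X" "X \<noteq> {}" "\<forall>\<alpha>\<in>X. length \<alpha> = length ys" "\<forall>\<alpha>\<in>X. c \<alpha> dvd 1"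
  shows "(\<Sum>\<alpha>\<in>X. c \<alpha> * monomial_eval ys \<alpha>) \<notin> P 0"
  using assms
proof (induction ys arbitrary: P X c)
  case Nil
  then have X: "X = {[]}" by auto
  \<comment> \<open>Units lie outside every prime, which is why the coefficients are required to
    divide 1.\<close>
  obtain d where d: "1 = c [] * d" using Nil X by (auto simp: dvd_def)
  have "c [] \<notin> P 0"
  proof
    assume "c [] \<in> P 0"
    then have "c [] * d \<in> P 0" using Nil.prems(1) ideal_setD(4) prime_set_ideal by blast
    then show False using d Nil.prems(1) by (auto simp: prime_set_def)
  qed
  then show ?case by (simp add: X monomial_eval_def)
next
  case (Cons y ys)
  have prime0: "prime_set (P 0)" and prime1: "prime_set (P 1)" and y: "y \<in> P 1" "y \<notin> P 0" and P01: "P 0 \<subseteq> P 1"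
    using Cons.prems(1-3) by (auto simp: All_less_Suc2 less_Suc_eq_le)
  define m where "m = Min (hd ` X)"
  have m: "\<And>\<alpha>. \<alpha> \<in> X \<Longrightarrow> m \<le> hd \<alpha>" "m \<in> hd ` X"
    using Cons.prems(4,5) by (auto simp: m_def)
  let ?X0 = "{\<alpha> \<in> X. hd \<alpha> = m}" and ?X1 = "{\<alpha> \<in> X. hd \<alpha> \<noteq> m}"
  have len: "\<alpha> = hd \<alpha> # tl \<alpha>" "length (tl \<alpha>) = length ys" if "\<alpha> \<in> X" for \<alpha>
    using Cons.prems(6) that by (cases \<alpha>; auto)+
  have ev: "monomial_eval (y # ys) \<alpha> = y ^ hd \<alpha> * monomial_eval ys (tl \<alpha>)" if "\<alpha> \<in> X" for \<alpha>
    by (subst len(1)[OF that]) (simp add: monomial_eval_def)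
  \<comment> \<open>With \<open>m\<close> the lowest exponent of \<open>y\<close>, the relation is
    \<open>y ^ m * (?s0 + y * ?s1)\<close>. Since \<open>y \<notin> P 0\<close>, the second factor
    would lie in \<open>P 0\<close> and so in \<open>P 1\<close>; as \<open>y \<in> P 1\<close>, so
    would \<open>?s0\<close>, against the induction hypothesis for the chain starting at
    \<open>P 1\<close>.\<close>
  let ?s0 = "\<Sum>\<alpha>\<in>?X0. c \<alpha> * monomial_eval ys (tl \<alpha>)"
  let ?s1 = "\<Sum>\<alpha>\<in>?X1. c \<alpha> * (y ^ (hd \<alpha> - m - 1) * monomial_eval ys (tl \<alpha>))"
  have inj: "inj_on tl ?X0"
    by (intro inj_onI) (metis (mono_tags, lifting) len(1) mem_Collect_eq)
  have "?s0 = (\<Sum>\<beta>\<in>tl ` ?X0. c (m # \<beta>) * monomial_eval ys \<beta>)"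
    unfolding sum.reindex[OF inj] using len(1) by (intro sum.cong) auto
  moreover have "(\<Sum>\<beta>\<in>tl ` ?X0. c (m # \<beta>) * monomial_eval ys \<beta>) \<notin> P (Suc 0)"
  proof (rule Cons.IH[of "\<lambda>i. P (Suc i)"])
    show "tl ` ?X0 \<noteq> {}" using m(2) by auto
    show "\<forall>\<alpha>\<in>tl ` ?X0. length \<alpha> = length ys" using len(2) by auto
    show "\<forall>\<alpha>\<in>tl ` ?X0. c (m # \<alpha>) dvd 1"
    proof
      fix \<beta> assume "\<beta> \<in> tl ` ?X0"
      then obtain \<alpha> where "\<alpha> \<in> X" "hd \<alpha> = m" "\<beta> = tl \<alpha>" by blast
      then show "c (m # \<beta>) dvd 1" using len(1)[of \<alpha>] Cons.prems(7) by metis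
    qed
  qed (use Cons.prems in \<open>auto simp: All_less_Suc2\<close>)
  ultimately have s0: "?s0 \<notin> P 1" by simp
  have "(\<Sum>\<alpha>\<in>X. c \<alpha> * monomial_eval (y # ys) \<alpha>) =
      (\<Sum>\<alpha>\<in>?X0. c \<alpha> * monomial_eval (y # ys) \<alpha>) + (\<Sum>\<alpha>\<in>?X1. c \<alpha> * monomial_eval (y # ys) \<alpha>)"
    using Cons.prems(4) by (subst sum.union_disjoint[symmetric]) (auto intro: sum.cong)
  also have "(\<Sum>\<alpha>\<in>?X0. c \<alpha> * monomial_eval (y # ys) \<alpha>) = y ^ m * ?s0"
    unfolding sum_distrib_left by (intro sum.cong) (simp_all add: ev algebra_simps)
  also have "(\<Sum>\<alpha>\<in>?X1. c \<alpha> * monomial_eval (y # ys) \<alpha>) = y ^ m * (y * ?s1)"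
    unfolding sum_distrib_left
  proof (intro sum.cong refl)
    fix \<alpha> assume \<alpha>: "\<alpha> \<in> ?X1"
    then have "hd \<alpha> = m + Suc (hd \<alpha> - m - 1)" using m(1)[of \<alpha>] by auto
    then have "y ^ hd \<alpha> = y ^ m * (y * y ^ (hd \<alpha> - m - 1))" by (metis power_add power_Suc)
    then show "c \<alpha> * monomial_eval (y # ys) \<alpha> =
        y ^ m * (y * (c \<alpha> * (y ^ (hd \<alpha> - m - 1) * monomial_eval ys (tl \<alpha>))))"
      using \<alpha> by (simp add: ev algebra_simps)
  qed
  also have "y ^ m * ?s0 + y ^ m * (y * ?s1) = y ^ m * (?s0 + y * ?s1)" by (simp add: distrib_left)
  finally have eq: "(\<Sum>\<alpha>\<in>X. c \<alpha> * monomial_eval (y # ys) \<alpha>) = y ^ m * (?s0 + y * ?s1)" .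
  show ?case
  proof
    assume "(\<Sum>\<alpha>\<in>X. c \<alpha> * monomial_eval (y # ys) \<alpha>) \<in> P 0"
    then have "y ^ m * (?s0 + y * ?s1) \<in> P 0" by (simp only: eq)
    then have "?s0 + y * ?s1 \<in> P 0"
      using prime0 prime_set_power y(2) unfolding prime_set_def by blast
    then have "?s0 + y * ?s1 \<in> P 1" using P01 by blast
    moreover have "y * ?s1 \<in> P 1" using y(1) ideal_setD(4) prime_set_ideal[OF prime1] by blast
    ultimately have "?s0 \<in> P 1" using ideal_setD(6)[OF prime_set_ideal[OF prime1]] by fastforce
    then show False using s0 by blast
  qed
qed

section \<open>Koszul cohomology\<close>

text \<open>Cochains are functions on vertex sets; the differential is that of the iterated mapping cone
  over the list of indices, which takes care of all signs.\<close>

primrec koszul :: "('v \<Rightarrow> 'a::comm_ring_1) \<Rightarrow> 'v list \<Rightarrow> ('v set \<Rightarrow> 'a) \<Rightarrow> 'v set \<Rightarrow> 'a" where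
  "koszul y [] c S = 0"
| "koszul y (v # vs) c S =
     (if v \<in> S then y v * c (S - {v}) - koszul y vs (\<lambda>T. c (insert v T)) (S - {v}) else koszul y vs c S)"

text \<open>Contraction with the index \<open>w\<close>, with the signs dictated by the iterated
  cone.\<close>

primrec koszul_htpy :: "'v list \<Rightarrow> 'v \<Rightarrow> ('v set \<Rightarrow> 'a::comm_ring_1) \<Rightarrow> 'v set \<Rightarrow> 'a" where
  "koszul_htpy [] w c S = 0"
| "koszul_htpy (v # vs) w c S =
     (if v = w then (if v \<in> S then 0 else c (insert v S))
      else if v \<in> S then - koszul_htpy vs w (\<lambda>T. c (insert v T)) (S - {v}) else koszul_htpy vs w c S)"

text \<open>Unconditional unfolding would also rewrite \<open>koszul y (v # vs) c\<close> as a function.\<close>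

declare koszul.simps(2) [simp del] koszul_htpy.simps(2) [simp del]

lemma koszul_Cons [simp]:
  "v \<in> S \<Longrightarrow> koszul y (v # vs) c S = y v * c (S - {v}) - koszul y vs (\<lambda>T. c (insert v T)) (S - {v})"
  "v \<notin> S \<Longrightarrow> koszul y (v # vs) c S = koszul y vs c S"
  by (simp_all add: koszul.simps(2))

lemma koszul_htpy_Cons [simp]:
  "v \<in> S \<Longrightarrow> koszul_htpy (v # vs) v c S = 0"
  "v \<notin> S \<Longrightarrow> koszul_htpy (v # vs) v c S = c (insert v S)"
  "v \<noteq> w \<Longrightarrow> v \<in> S \<Longrightarrow> koszul_htpy (v # vs) w c S = - koszul_htpy vs w (\<lambda>T. c (insert v T)) (S - {v})"
  "v \<noteq> w \<Longrightarrow> v \<notin> S \<Longrightarrow> koszul_htpy (v # vs) w c S = koszul_htpy vs w c S"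
  by (simp_all add: koszul_htpy.simps(2))

text \<open>Degrees are integers so that the induction may pass to \<open>i - 1\<close> below 0,
  where the only cochain is zero.\<close>

definition cochain :: "'v list \<Rightarrow> int \<Rightarrow> ('v set \<Rightarrow> 'a::comm_ring_1) \<Rightarrow> bool" where
  "cochain vs i c \<longleftrightarrow> (\<forall>S. c S \<noteq> 0 \<longrightarrow> S \<subseteq> set vs \<and> int (card S) = i)"

lemma koszul_cong: "(\<And>T. T \<subseteq> S \<Longrightarrow> c T = c' T) \<Longrightarrow> koszul y vs c S = koszul y vs c' S"
proof (induction vs arbitrary: c c' S)
  case (Cons v vs)
  have "koszul y vs (\<lambda>T. c (insert v T)) (S - {v}) = koszul y vs (\<lambda>T. c' (insert v T)) (S - {v})" if "v \<in> S"
    using that by (intro Cons.IH Cons.prems) blast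
  moreover have "koszul y vs c S = koszul y vs c' S" using Cons by blast
  moreover have "c (S - {v}) = c' (S - {v})" using Cons.prems by blast
  ultimately show ?case by (cases "v \<in> S") simp_all
qed simp

lemma koszul_htpy_cong:
  "(\<And>T. T \<subseteq> insert w S \<Longrightarrow> c T = c' T) \<Longrightarrow> koszul_htpy vs w c S = koszul_htpy vs w c' S"
proof (induction vs arbitrary: c c' S)
  case (Cons v vs)
  have "koszul_htpy vs w (\<lambda>T. c (insert v T)) (S - {v}) = koszul_htpy vs w (\<lambda>T. c' (insert v T)) (S - {v})"
    if "v \<in> S" using that by (intro Cons.IH Cons.prems) blast
  moreover have "koszul_htpy vs w c S = koszul_htpy vs w c' S" using Cons by blast
  moreover have "c (insert w S) = c' (insert w S)" using Cons.prems by blast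
  ultimately show ?case by (simp add: koszul_htpy.simps(2))
qed simp

lemma koszul_linear:
  "koszul y vs (\<lambda>T. a * c T) S = a * koszul y vs c S"
  "koszul y vs (\<lambda>T. c T + c' T) S = koszul y vs c S + koszul y vs c' S"
  "koszul y vs (\<lambda>T. c T - c' T) S = koszul y vs c S - koszul y vs c' S"
  "koszul y vs (\<lambda>T. - c T) S = - koszul y vs c S"
  "koszul y vs (\<lambda>T. 0) S = 0"
  by (induction vs arbitrary: c c' S) (simp_all add: koszul.simps(2) algebra_simps)

lemma koszul_sum: "koszul y vs (\<lambda>T. \<Sum>w\<in>W. f w T) S = (\<Sum>w\<in>W. koszul y vs (f w) S)"
  by (induction W rule: infinite_finite_induct) (simp_all add: koszul_linear)

lemma koszul_htpy_linear:
  "koszul_htpy vs w (\<lambda>T. a * c T) S = a * koszul_htpy vs w c S"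
  "koszul_htpy vs w (\<lambda>T. c T - c' T) S = koszul_htpy vs w c S - koszul_htpy vs w c' S"
  by (induction vs arbitrary: c c' S) (simp_all add: koszul_htpy.simps(2) algebra_simps)

lemma koszul_koszul: "koszul y vs (koszul y vs c) S = 0"
proof (induction vs arbitrary: c S)
  case (Cons v vs)
  show ?case
  proof (cases "v \<in> S")
    case True
    have "koszul y vs (\<lambda>T. koszul y (v # vs) c (insert v T)) (S - {v}) =
        koszul y vs (\<lambda>T. y v * c T - koszul y vs (\<lambda>T. c (insert v T)) T) (S - {v})"
    proof (rule koszul_cong)
      fix T assume "T \<subseteq> S - {v}"
      then have "insert v T - {v} = T" by blast
      then show "koszul y (v # vs) c (insert v T) = y v * c T - koszul y vs (\<lambda>T. c (insert v T)) T"
        by simp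
    qed
    also have "\<dots> = y v * koszul y vs c (S - {v})" by (simp add: koszul_linear Cons.IH)
    finally have "koszul y vs (\<lambda>T. koszul y (v # vs) c (insert v T)) (S - {v}) = y v * koszul y vs c (S - {v})" .
    then show ?thesis using True by simp
  next
    case False
    have "koszul y vs (koszul y (v # vs) c) S = koszul y vs (koszul y vs c) S"
      using False by (intro koszul_cong koszul_Cons(2)) blast
    then show ?thesis using False Cons.IH by simp
  qed
qed simp

text \<open>Contraction with \<open>w\<close> is a null-homotopy for multiplication by
  \<open>y w\<close>; hence every \<open>y w\<close> annihilates the cohomology.\<close>

lemma koszul_homotopy:
  assumes "w \<in> set vs"
  shows "koszul y vs (koszul_htpy vs w c) S + koszul_htpy vs w (koszul y vs c) S = y w * c S"
  using assms
proof (induction vs arbitrary: c S)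
  case (Cons v vs)
  show ?case
  proof (cases "v = w")
    case vw: True
    show ?thesis
    proof (cases "v \<in> S")
      case True
      have "koszul y vs (\<lambda>T. koszul_htpy (v # vs) w c (insert v T)) (S - {v}) = 0"
        using vw by (simp add: koszul_linear)
      then show ?thesis using True vw by (simp add: insert_absorb)
    next
      case False
      have "koszul y vs (koszul_htpy (v # vs) w c) S = koszul y vs (\<lambda>T. c (insert v T)) S"
        using False unfolding vw[symmetric] by (intro koszul_cong koszul_htpy_Cons(2)) blast
      then show ?thesis using False vw by simp
    qed
  next
    case vw: False
    then have w: "w \<in> set vs" using Cons.prems by simp
    show ?thesis
    proof (cases "v \<in> S")
      case True
      let ?c = "\<lambda>T. c (insert v T)" and ?S = "S - {v}"
      have "koszul y vs (\<lambda>T. koszul_htpy (v # vs) w c (insert v T)) ?S =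
          koszul y vs (\<lambda>T. - koszul_htpy vs w ?c T) ?S"
      proof (rule koszul_cong)
        fix T assume "T \<subseteq> ?S"
        then have "insert v T - {v} = T" by blast
        then show "koszul_htpy (v # vs) w c (insert v T) = - koszul_htpy vs w ?c T" using vw by simp
      qed
      note A = this
      have B: "koszul_htpy vs w (\<lambda>T. koszul y (v # vs) c (insert v T)) ?S =
          koszul_htpy vs w (\<lambda>T. y v * c T - koszul y vs ?c T) ?S"
      proof (rule koszul_htpy_cong)
        fix T assume "T \<subseteq> insert w ?S"
        then have "insert v T - {v} = T" using vw by blast
        then show "koszul y (v # vs) c (insert v T) = y v * c T - koszul y vs ?c T" by simp
      qed
      have C: "koszul y vs (koszul_htpy vs w ?c) ?S + koszul_htpy vs w (koszul y vs ?c) ?S = y w * c S"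
        using Cons.IH[OF w, of ?c ?S] True by (simp add: insert_absorb)
      have D: "koszul_htpy (v # vs) w c ?S = koszul_htpy vs w c ?S" using vw by simp
      show ?thesis
        unfolding koszul_Cons(1)[OF True] koszul_htpy_Cons(3)[OF vw True] A B D
          koszul_linear koszul_htpy_linear C[symmetric]
        by (simp add: algebra_simps)
    next
      case False
      have "koszul y vs (koszul_htpy (v # vs) w c) S = koszul y vs (koszul_htpy vs w c) S"
        using False by (intro koszul_cong koszul_htpy_Cons(4) vw) blast
      moreover have "koszul_htpy vs w (koszul y (v # vs) c) S = koszul_htpy vs w (koszul y vs c) S"
        using False vw by (intro koszul_htpy_cong koszul_Cons(2)) blast
      ultimately show ?thesis using False vw Cons.IH[OF w] by simp
    qed
  qed
qed simp

text \<open>The signs are chosen before the cochain, so at a given \<open>S\<close> the same signs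
  serve for all cochains. The later comparison of coefficients depends on this order of
  quantifiers.\<close>

lemma koszul_formula:
  assumes "distinct vs"
  shows "\<exists>\<sigma> :: 'v \<Rightarrow> 'a::comm_ring_1. (\<forall>w. \<sigma> w = 1 \<or> \<sigma> w = - 1) \<and>
    (\<forall>c. koszul y vs c S = (\<Sum>w\<in>S \<inter> set vs. \<sigma> w * (y w * c (S - {w}))))"
  using assms
proof (induction vs arbitrary: S)
  case (Cons v vs)
  have v: "v \<notin> set vs" and dist: "distinct vs" using Cons.prems by auto
  show ?case
  proof (cases "v \<in> S")
    case True
    obtain \<sigma> :: "'v \<Rightarrow> 'a" where \<sigma>: "\<forall>w. \<sigma> w = 1 \<or> \<sigma> w = - 1"
      "\<forall>c. koszul y vs c (S - {v}) = (\<Sum>w\<in>(S - {v}) \<inter> set vs. \<sigma> w * (y w * c (S - {v} - {w})))"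
      using Cons.IH[OF dist] by blast
    let ?\<sigma> = "\<lambda>w. if w = v then 1 else - \<sigma> w"
    have "koszul y (v # vs) c S = (\<Sum>w\<in>S \<inter> set (v # vs). ?\<sigma> w * (y w * c (S - {w})))" for c
    proof -
      have set: "S \<inter> set (v # vs) = insert v ((S - {v}) \<inter> set vs)" using True by auto
      have "koszul y vs (\<lambda>T. c (insert v T)) (S - {v}) =
          (\<Sum>w\<in>(S - {v}) \<inter> set vs. \<sigma> w * (y w * c (S - {w})))"
        unfolding \<sigma>(2)[rule_format]
      proof (intro sum.cong refl)
        fix w assume "w \<in> (S - {v}) \<inter> set vs"
        then have "insert v (S - {v} - {w}) = S - {w}" using True by blast
        then show "\<sigma> w * (y w * c (insert v (S - {v} - {w}))) = \<sigma> w * (y w * c (S - {w}))" by simp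
      qed
      moreover have "(\<Sum>w\<in>(S - {v}) \<inter> set vs. ?\<sigma> w * (y w * c (S - {w}))) =
          - (\<Sum>w\<in>(S - {v}) \<inter> set vs. \<sigma> w * (y w * c (S - {w})))"
        unfolding sum_negf[symmetric] by (intro sum.cong) auto
      ultimately show ?thesis unfolding set using True by (subst sum.insert) simp_all
    qed
    moreover have "?\<sigma> w = 1 \<or> ?\<sigma> w = - 1" for w using \<sigma>(1)[rule_format, of w] by auto
    ultimately show ?thesis by (intro exI[of _ ?\<sigma>]) simp
  next
    case False
    then have "S \<inter> set (v # vs) = S \<inter> set vs" by auto
    then show ?thesis using False Cons.IH[OF dist, of S] by simp
  qed
qed auto

lemma koszul_in_ideal:
  "ideal_set I \<Longrightarrow> (\<And>T. c T \<in> I) \<Longrightarrow> koszul y vs c S \<in> I"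
  by (induction vs arbitrary: c S) (simp_all add: koszul.simps(2) ideal_setD)

lemma koszul_htpy_in_ideal:
  "ideal_set I \<Longrightarrow> (\<And>T. c T \<in> I) \<Longrightarrow> koszul_htpy vs w c S \<in> I"
  by (induction vs arbitrary: c S) (simp_all add: koszul_htpy.simps(2) ideal_setD)

lemma koszul_htpy_value:
  "koszul_htpy vs w c S = 0 \<or>
   w \<notin> S \<and> w \<in> set vs \<and> (koszul_htpy vs w c S = c (insert w S) \<or> koszul_htpy vs w c S = - c (insert w S))"
proof (induction vs arbitrary: c S)
  case (Cons v vs)
  show ?case
  proof (cases "v \<in> S \<and> v \<noteq> w")
    case True
    then have "insert v (insert w (S - {v})) = insert w S" by blast
    then show ?thesis using Cons.IH[of "\<lambda>T. c (insert v T)" "S - {v}"] True by auto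
  next
    case False
    then consider "v = w" | "v \<noteq> w" "v \<notin> S" by blast
    then show ?thesis
    proof cases
      case 1
      then show ?thesis by (cases "w \<in> S") simp_all
    next
      case 2
      then show ?thesis using Cons.IH[of c S] by simp
    qed
  qed
qed simp

lemma cochain_koszul:
  assumes "distinct vs" "cochain vs i c"
  shows "cochain vs (i + 1) (koszul y vs c)"
  unfolding cochain_def
proof (intro allI impI)
  fix S assume nz: "koszul y vs c S \<noteq> 0"
  obtain \<sigma> where "koszul y vs c S = (\<Sum>w\<in>S \<inter> set vs. \<sigma> w * (y w * c (S - {w})))"
    using koszul_formula[OF assms(1), of y S] by blast
  then have "(\<Sum>w\<in>S \<inter> set vs. \<sigma> w * (y w * c (S - {w}))) \<noteq> 0" using nz by simp
  then obtain w where w: "w \<in> S \<inter> set vs" "\<sigma> w * (y w * c (S - {w})) \<noteq> 0"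
    by (meson sum.not_neutral_contains_not_neutral)
  then have "c (S - {w}) \<noteq> 0" by auto
  then have "S - {w} \<subseteq> set vs" "int (card (S - {w})) = i" using assms(2) by (auto simp: cochain_def)
  moreover from this have "finite S" by (meson List.finite_set finite_Diff2 finite.emptyI finite_insert finite_subset)
  ultimately show "S \<subseteq> set vs \<and> int (card S) = i + 1" using w(1) card_Suc_Diff1[of S w] by auto
qed

lemma cochain_koszul_htpy: "cochain vs i c \<Longrightarrow> cochain vs (i - 1) (koszul_htpy vs w c)"
  unfolding cochain_def
proof (intro allI impI)
  fix S assume c: "\<forall>S. c S \<noteq> 0 \<longrightarrow> S \<subseteq> set vs \<and> int (card S) = i" and nz: "koszul_htpy vs w c S \<noteq> 0"
  then have "w \<notin> S" "c (insert w S) \<noteq> 0" using koszul_htpy_value[of vs w c S] by auto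
  then have "insert w S \<subseteq> set vs" "int (card (insert w S)) = i" using c by auto
  moreover from this have "finite S" by (meson List.finite_set finite_insert finite_subset)
  ultimately show "S \<subseteq> set vs \<and> int (card S) = i - 1" using \<open>w \<notin> S\<close> by auto
qed

text \<open>Multiplication by \<open>\<theta>\<close> on the cohomology is injective by the long exact sequence and the
  induction hypothesis modulo \<open>\<theta>\<close>, and nilpotent because the ideal \<open>(y)\<close> annihilates the cohomology.\<close>

lemma koszul_vanishing:
  assumes "distinct vs" "ideal_set I" "weakly_regular I \<theta>s"
    and "\<And>\<theta>. \<theta> \<in> set \<theta>s \<Longrightarrow> \<exists>N a. \<theta> ^ N - (\<Sum>w\<in>set vs. a w * y w) \<in> I"
    and "i < int (length \<theta>s)" "cochain vs i c" "\<And>S. koszul y vs c S \<in> I"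
  shows "\<exists>b. cochain vs (i - 1) b \<and> (\<forall>S. c S - koszul y vs b S \<in> I)"
  using assms(2-)
proof (induction \<theta>s arbitrary: I i c)
  case Nil
  then have "c S = 0" for S by (force simp: cochain_def)
  moreover have "cochain vs (i - 1) (\<lambda>S. 0 :: 'b)" by (simp add: cochain_def)
  ultimately show ?case using ideal_setD(1)[OF Nil.prems(1)]
    by (intro exI[of _ "\<lambda>S. 0"]) (simp add: koszul_linear)
next
  case (Cons \<theta> \<theta>s)
  note I = ideal_setD[OF Cons.prems(1)]
  have nzd: "\<And>a. \<theta> * a \<in> I \<Longrightarrow> a \<in> I" and reg: "weakly_regular (ext_ideal I \<theta>) \<theta>s"
    using Cons.prems(2) by auto
  \<comment> \<open>Injectivity of \<theta> on cohomology. The cochain \<open>b\<close> is a cocycle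
    modulo \<open>ext_ideal I \<theta>\<close> in a degree covered by the induction hypothesis, so
    it equals a coboundary plus \<open>j + \<theta> * t\<close>. Applying \<open>koszul\<close> and
    cancelling \<theta> shows that \<open>c'\<close> is the coboundary of \<open>t\<close> modulo
    \<open>I\<close>.\<close>
  have cancel: "\<exists>b. cochain vs (i - 1) b \<and> (\<forall>S. c' S - koszul y vs b S \<in> I)"
    if b: "cochain vs (i - 1) b" "\<And>S. \<theta> * c' S - koszul y vs b S \<in> I" for c' b
  proof -
    have "\<exists>b'. cochain vs (i - 1 - 1) b' \<and> (\<forall>S. b S - koszul y vs b' S \<in> ext_ideal I \<theta>)"
    proof (rule Cons.IH[OF ideal_set_ext[OF Cons.prems(1)] reg _ _ b(1)])
      show "\<exists>N a. \<theta>' ^ N - (\<Sum>w\<in>set vs. a w * y w) \<in> ext_ideal I \<theta>" if \<theta>': "\<theta>' \<in> set \<theta>s" for \<theta>'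
        using Cons.prems(3)[of \<theta>'] \<theta>' ext_ideal_superset by (metis list.set_intros(2) subsetD)
      show "koszul y vs b S \<in> ext_ideal I \<theta>" for S
        using ext_idealI[OF I(5)[OF b(2)[of S]], of \<theta> "c' S"] by (simp add: algebra_simps)
    qed (use Cons.prems(4) in simp)
    then obtain b' where b': "cochain vs (i - 1 - 1) b'" "\<And>S. b S - koszul y vs b' S \<in> ext_ideal I \<theta>"
      by blast
    \<comment> \<open>The representation is taken with \<open>t = 0\<close> wherever the difference
      vanishes, so that \<open>t\<close> is supported in degree \<open>i - 1\<close> again.\<close>
    have "\<exists>j t. j \<in> I \<and> b S - koszul y vs b' S = j + \<theta> * t \<and> (b S - koszul y vs b' S = 0 \<longrightarrow> t = 0)" for S
    proof (cases "b S - koszul y vs b' S = 0")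
      case True
      then show ?thesis using I(1) by (intro exI[of _ 0]) simp
    next
      case False
      then show ?thesis using b'(2)[of S] by (metis ext_idealE)
    qed
    then obtain j t where jt: "\<And>S. j S \<in> I" "\<And>S. b S - koszul y vs b' S = j S + \<theta> * t S"
      "\<And>S. b S - koszul y vs b' S = 0 \<Longrightarrow> t S = 0" by metis
    have "cochain vs (i - 1) t"
      unfolding cochain_def
    proof (intro allI impI)
      fix S assume "t S \<noteq> 0"
      then have "b S \<noteq> 0 \<or> koszul y vs b' S \<noteq> 0" using jt(3)[of S] by auto
      then show "S \<subseteq> set vs \<and> int (card S) = i - 1"
        using b(1) cochain_koszul[OF assms(1) b'(1), of y] by (auto simp: cochain_def)
    qed
    moreover have "c' S - koszul y vs t S \<in> I" for S
    proof (rule nzd)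
      have "b = (\<lambda>S. koszul y vs b' S + (j S + \<theta> * t S))" using jt(2) by (simp add: fun_eq_iff algebra_simps)
      then have "koszul y vs b S = koszul y vs j S + \<theta> * koszul y vs t S"
        by (simp add: koszul_linear koszul_koszul)
      then have "\<theta> * (c' S - koszul y vs t S) = (\<theta> * c' S - koszul y vs b S) + koszul y vs j S"
        by (simp add: algebra_simps)
      then show "\<theta> * (c' S - koszul y vs t S) \<in> I"
        using I(2)[OF b(2) koszul_in_ideal[OF Cons.prems(1) jt(1)]] by simp
    qed
    ultimately show ?thesis by blast
  qed
  obtain N a where N: "\<theta> ^ N - (\<Sum>w\<in>set vs. a w * y w) \<in> I" using Cons.prems(3)[of \<theta>] by auto
  \<comment> \<open>A high power of \<theta> kills the class; \<open>cancel\<close> strips off one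
    factor at a time, down to \<open>m = 0\<close>.\<close>
  have "\<exists>b. cochain vs (i - 1) b \<and> (\<forall>S. \<theta> ^ m * c S - koszul y vs b S \<in> I)" if "m \<le> N" for m
    using that
  proof (induction rule: inc_induct)
    case base
    \<comment> \<open>The contractions trivialise \<open>y w * c\<close> for each \<open>w\<close>,
      and \<open>\<theta> ^ N\<close> is a combination of the \<open>y w\<close> modulo
      \<open>I\<close>.\<close>
    let ?b = "\<lambda>S. \<Sum>w\<in>set vs. a w * koszul_htpy vs w c S"
    have "cochain vs (i - 1) ?b"
      unfolding cochain_def
    proof (intro allI impI)
      fix S assume "?b S \<noteq> 0"
      then obtain w where "a w * koszul_htpy vs w c S \<noteq> 0" by (meson sum.not_neutral_contains_not_neutral)
      then have "koszul_htpy vs w c S \<noteq> 0" by auto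
      then show "S \<subseteq> set vs \<and> int (card S) = i - 1"
        using cochain_koszul_htpy[OF Cons.prems(5), of w] by (simp add: cochain_def)
    qed
    moreover have "\<theta> ^ N * c S - koszul y vs ?b S \<in> I" for S
    proof -
      let ?h = "\<Sum>w\<in>set vs. a w * koszul_htpy vs w (koszul y vs c) S"
      have "koszul y vs ?b S = (\<Sum>w\<in>set vs. a w * koszul y vs (koszul_htpy vs w c) S)"
        by (simp add: koszul_sum koszul_linear)
      also have "\<dots> = (\<Sum>w\<in>set vs. a w * (y w * c S) - a w * koszul_htpy vs w (koszul y vs c) S)"
      proof (intro sum.cong refl)
        fix w assume "w \<in> set vs"
        then have "koszul y vs (koszul_htpy vs w c) S = y w * c S - koszul_htpy vs w (koszul y vs c) S"
          using koszul_homotopy[of w vs y c S] by (simp add: eq_diff_eq)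
        then show "a w * koszul y vs (koszul_htpy vs w c) S =
            a w * (y w * c S) - a w * koszul_htpy vs w (koszul y vs c) S" by (simp add: right_diff_distrib)
      qed
      also have "\<dots> = (\<Sum>w\<in>set vs. a w * y w) * c S - ?h"
        by (simp add: sum_subtractf sum_distrib_right mult.assoc)
      finally have "\<theta> ^ N * c S - koszul y vs ?b S = (\<theta> ^ N - (\<Sum>w\<in>set vs. a w * y w)) * c S + ?h"
        by (simp add: algebra_simps)
      moreover have "?h \<in> I"
        using Cons.prems(1,6) by (intro ideal_set_sum I(3) koszul_htpy_in_ideal)
      ultimately show ?thesis using I(2)[OF I(4)[OF N]] by simp
    qed
    ultimately show ?case by blast
  next
    case (step m)
    then obtain b where "cochain vs (i - 1) b" "\<And>S. \<theta> * (\<theta> ^ m * c S) - koszul y vs b S \<in> I"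
      by (auto simp: mult.assoc)
    then show ?case by (rule cancel)
  qed
  from this[of 0] show ?case by simp
qed

section \<open>Squarefree monomial ideals\<close>

abbreviation (input) exps :: "('v \<Rightarrow>\<^sub>0 nat) \<Rightarrow> 'v set" where "exps \<equiv> Poly_Mapping.keys"

abbreviation (input) monoms :: "(('v \<Rightarrow>\<^sub>0 nat) \<Rightarrow>\<^sub>0 'k::zero) \<Rightarrow> ('v \<Rightarrow>\<^sub>0 nat) set" where
  "monoms \<equiv> Poly_Mapping.keys"

abbreviation (input) coeff :: "('a \<Rightarrow>\<^sub>0 'b::zero) \<Rightarrow> 'a \<Rightarrow> 'b" where "coeff \<equiv> Poly_Mapping.lookup"

text \<open>The Stanley--Reisner ideal inside the ring of polynomials in all variables of the type; every
  variable outside the vertex set is a nonface and hence killed.\<close>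

definition nonface_ideal :: "'v set set \<Rightarrow> (('v \<Rightarrow>\<^sub>0 nat) \<Rightarrow>\<^sub>0 'k::field) set" where
  "nonface_ideal \<Delta> = {p. \<forall>m\<in>monoms p. exps m \<notin> \<Delta>}"

definition down_closed :: "'v set set \<Rightarrow> bool" where
  "down_closed \<Delta> \<longleftrightarrow> (\<forall>A\<in>\<Delta>. \<forall>B\<subseteq>A. B \<in> \<Delta>)"

definition expo :: "'v set \<Rightarrow> 'v \<Rightarrow>\<^sub>0 nat" where
  "expo B = (\<Sum>v\<in>B. Poly_Mapping.single v 1)"

definition sqfree_monom :: "'v set \<Rightarrow> ('v \<Rightarrow>\<^sub>0 nat) \<Rightarrow>\<^sub>0 'k::field" where
  "sqfree_monom B = Poly_Mapping.single (expo B) 1"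

lemma exps_add: "exps (m + n :: 'v \<Rightarrow>\<^sub>0 nat) = exps m \<union> exps n"
  by (auto simp: in_keys_iff lookup_add)

lemma lookup_expo: "finite B \<Longrightarrow> coeff (expo B) v = (if v \<in> B then 1 else 0)"
  unfolding expo_def by (simp add: lookup_sum lookup_single when_def)

lemma exps_expo: "finite B \<Longrightarrow> exps (expo B) = B"
  by (auto simp: in_keys_iff lookup_expo split: if_splits)

lemma expo_insert: "finite B \<Longrightarrow> v \<notin> B \<Longrightarrow> expo (insert v B) = Poly_Mapping.single v 1 + expo B"
  by (simp add: expo_def)

lemma prod_variable: "(\<Prod>v\<in>B. variable v) = sqfree_monom B" if "finite B"
  using that by induction (simp_all add: sqfree_monom_def expo_def variable_def mult_single)

lemma monoms_mult:
  fixes p q :: "('v \<Rightarrow>\<^sub>0 nat) \<Rightarrow>\<^sub>0 'k::field"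
  assumes "k \<in> monoms (p * q)"
  obtains m n where "m \<in> monoms p" "n \<in> monoms q" "k = m + n"
  using assms keys_mult[of p q] by blast

lemma lookup_single_mult:
  fixes p :: "('v \<Rightarrow>\<^sub>0 nat) \<Rightarrow>\<^sub>0 'k::field"
  shows "coeff (Poly_Mapping.single t c * p) (t + m) = c * coeff p m"
proof -
  have "coeff (Poly_Mapping.single t c * p) (t + m) =
      (\<Sum>l. (c when t = l) * (\<Sum>q. coeff p q when t + m = l + q))"
    by (simp add: lookup_mult lookup_single)
  also have "\<dots> = (\<Sum>l. (c * (\<Sum>q. coeff p q when t + m = l + q)) when t = l)"
    by (simp add: when_mult)
  also have "\<dots> = c * (\<Sum>q. coeff p q when m = q)" by simp
  also have "\<dots> = c * coeff p m" by simp
  finally show ?thesis .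
qed

lemma monoms_single_mult:
  fixes p :: "('v \<Rightarrow>\<^sub>0 nat) \<Rightarrow>\<^sub>0 'k::field"
  assumes "c \<noteq> 0"
  shows "monoms (Poly_Mapping.single t c * p) = (+) t ` monoms p"
proof (intro equalityI subsetI)
  fix k assume "k \<in> monoms (Poly_Mapping.single t c * p)"
  then obtain m n where "m \<in> monoms (Poly_Mapping.single t c)" "n \<in> monoms p" "k = m + n"
    by (rule monoms_mult)
  then show "k \<in> (+) t ` monoms p" using assms by simp
next
  fix k assume "k \<in> (+) t ` monoms p"
  then show "k \<in> monoms (Poly_Mapping.single t c * p)"
    using assms by (auto simp: in_keys_iff lookup_single_mult)
qed

lemma poly_expansion:
  fixes p :: "'a \<Rightarrow>\<^sub>0 'b::comm_monoid_add"
  shows "p = (\<Sum>m\<in>Poly_Mapping.keys p. Poly_Mapping.single m (coeff p m))"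
proof (rule poly_mapping_eqI)
  fix k
  have "coeff (\<Sum>m\<in>Poly_Mapping.keys p. Poly_Mapping.single m (coeff p m)) k =
      (\<Sum>m\<in>Poly_Mapping.keys p. if m = k then coeff p m else 0)"
    by (simp add: lookup_sum lookup_single when_def)
  also have "\<dots> = coeff p k" by (simp add: in_keys_iff)
  finally show "coeff p k = coeff (\<Sum>m\<in>Poly_Mapping.keys p. Poly_Mapping.single m (coeff p m)) k" ..
qed

lemma single_in_nonface_ideal: "Poly_Mapping.single m c \<in> nonface_ideal \<Delta> \<longleftrightarrow> c = 0 \<or> exps m \<notin> \<Delta>"
  by (auto simp: nonface_ideal_def)

lemma sqfree_in_nonface_ideal: "finite B \<Longrightarrow> sqfree_monom B \<in> nonface_ideal \<Delta> \<longleftrightarrow> B \<notin> \<Delta>"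
  by (simp add: sqfree_monom_def single_in_nonface_ideal exps_expo)

lemma nonface_idealI_monoms:
  assumes "ideal_set I" "\<And>m. m \<in> monoms p \<Longrightarrow> Poly_Mapping.single m (coeff p m) \<in> I"
  shows "p \<in> I"
  by (subst poly_expansion) (use assms in \<open>rule ideal_set_sum\<close>)

lemma ideal_set_nonface: "down_closed \<Delta> \<Longrightarrow> ideal_set (nonface_ideal \<Delta>)"
  unfolding ideal_set_def
proof (intro conjI ballI allI)
  assume D: "down_closed \<Delta>"
  show "0 \<in> nonface_ideal \<Delta>" by (simp add: nonface_ideal_def)
  fix a assume a: "a \<in> nonface_ideal \<Delta>"
  show "a + b \<in> nonface_ideal \<Delta>" if "b \<in> nonface_ideal \<Delta>" for b
    using a that keys_add[of a b] unfolding nonface_ideal_def by blast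
  fix c
  have "exps k \<notin> \<Delta>" if k: "k \<in> monoms (c * a)" for k
  proof -
    obtain m n where mn: "n \<in> monoms a" "k = m + n" using monoms_mult[OF k] by metis
    then have "exps n \<subseteq> exps k" "exps n \<notin> \<Delta>" using a by (auto simp: exps_add nonface_ideal_def)
    then show ?thesis using D unfolding down_closed_def by blast
  qed
  then show "c * a \<in> nonface_ideal \<Delta>" by (simp add: nonface_ideal_def)
qed

lemma nonface_ideal_antimono: "\<Delta>' \<subseteq> \<Delta> \<Longrightarrow> nonface_ideal \<Delta> \<subseteq> nonface_ideal \<Delta>'"
  unfolding nonface_ideal_def by blast

text \<open>Multiplication by a monomial shifts monomials without cancellation and adds
  \<open>B\<close> to their supports. The complex on the right is the star of \<open>B\<close> when
  \<Delta> is a complex.\<close>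

lemma colon_nonface:
  assumes "finite B"
  shows "colon_ideal (nonface_ideal \<Delta>) (sqfree_monom B) = nonface_ideal {A. A \<union> B \<in> \<Delta>}"
  unfolding colon_ideal_def nonface_ideal_def sqfree_monom_def
  by (simp add: monoms_single_mult exps_add exps_expo[OF assms] Un_commute)

text \<open>A monomial whose support contains \<open>B\<close> is divisible by the squarefree
  monomial of \<open>B\<close>, so adding this generator removes exactly the faces above
  \<open>B\<close>.\<close>

lemma ext_nonface:
  assumes "finite B" "down_closed \<Delta>"
  shows "ext_ideal (nonface_ideal \<Delta>) (sqfree_monom B) =
    (nonface_ideal {A \<in> \<Delta>. \<not> B \<subseteq> A} :: (_ \<Rightarrow>\<^sub>0 'k::field) set)" (is "?L = ?R")
proof
  let ?D = "{A \<in> \<Delta>. \<not> B \<subseteq> A}"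
  have "down_closed ?D" using assms(2) unfolding down_closed_def by blast
  then show "?L \<subseteq> ?R"
    using nonface_ideal_antimono[of ?D \<Delta>] assms(1)
    by (intro ext_ideal_least ideal_set_nonface) (auto simp: sqfree_in_nonface_ideal)
  have I: "ideal_set (nonface_ideal \<Delta> :: (_ \<Rightarrow>\<^sub>0 'k) set)" using ideal_set_nonface[OF assms(2)] .
  show "?R \<subseteq> ?L"
  proof
    fix p assume p: "p \<in> ?R"
    show "p \<in> ?L"
    proof (rule nonface_idealI_monoms[OF ideal_set_ext[OF I]])
      fix m assume "m \<in> monoms p"
      then consider "exps m \<notin> \<Delta>" | "B \<subseteq> exps m" using p unfolding nonface_ideal_def by blast
      then show "Poly_Mapping.single m (coeff p m) \<in> ?L"
      proof cases
        case 1
        then have "Poly_Mapping.single m (coeff p m) \<in> nonface_ideal \<Delta>"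
          by (simp add: single_in_nonface_ideal)
        then show ?thesis by (rule subsetD[OF ext_ideal_superset])
      next
        case 2
        have "m = expo B + (m - expo B)"
        proof (rule poly_mapping_eqI)
          fix v
          have "v \<in> B \<Longrightarrow> coeff m v \<ge> 1" using 2 by (auto simp: in_keys_iff Suc_le_eq)
          then show "coeff m v = coeff (expo B + (m - expo B)) v"
            by (simp add: lookup_add lookup_minus lookup_expo[OF assms(1)])
        qed
        then have "Poly_Mapping.single m (coeff p m) =
            sqfree_monom B * Poly_Mapping.single (m - expo B) (coeff p m)"
          by (simp add: sqfree_monom_def mult_single)
        then show ?thesis using ideal_setD(4)[OF ideal_set_ext[OF I] ext_ideal_gen[OF I]] by metis
      qed
    qed
  qed
qed

section \<open>The elementary symmetric functions as a regular sequence\<close>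

definition elem_sym :: "'v set \<Rightarrow> nat \<Rightarrow> ('v \<Rightarrow>\<^sub>0 nat) \<Rightarrow>\<^sub>0 'k::field" where
  "elem_sym V d = (\<Sum>B | B \<subseteq> V \<and> card B = d. sqfree_monom B)"

text \<open>Highest degree first: modulo a simplex on \<open>d\<close> vertices of \<open>V\<close>,
  the first entry is then a single monomial.\<close>

primrec elem_syms :: "'v set \<Rightarrow> nat \<Rightarrow> (('v \<Rightarrow>\<^sub>0 nat) \<Rightarrow>\<^sub>0 'k::field) list" where
  "elem_syms V 0 = []"
| "elem_syms V (Suc d) = elem_sym V (Suc d) # elem_syms V d"

lemma length_elem_syms: "length (elem_syms V d) = d"
  by (induction d) simp_all

lemma elem_sym_mod_simplex:
  assumes "finite V" "T \<subseteq> V" "card T = d"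
  shows "elem_sym V d - sqfree_monom T \<in> (nonface_ideal (Pow T) :: (_ \<Rightarrow>\<^sub>0 'k::field) set)"
proof -
  have I: "ideal_set (nonface_ideal (Pow T) :: (_ \<Rightarrow>\<^sub>0 'k) set)" by (rule ideal_set_nonface) (auto simp: down_closed_def)
  let ?S = "{B. B \<subseteq> V \<and> card B = d}"
  have fin: "finite ?S" using assms(1) by simp
  have "elem_sym V d - sqfree_monom T = (\<Sum>B\<in>?S - {T}. sqfree_monom B :: _ \<Rightarrow>\<^sub>0 'k)"
    unfolding elem_sym_def using assms fin by (subst sum.remove[of ?S T]) auto
  also have "\<dots> \<in> (nonface_ideal (Pow T) :: (_ \<Rightarrow>\<^sub>0 'k) set)"
  proof (rule ideal_set_sum[OF I])
    fix B assume B: "B \<in> ?S - {T}"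
    then have "finite B" "finite T" using assms finite_subset by auto
    moreover have "\<not> B \<subseteq> T" using B assms(3) card_subset_eq[OF \<open>finite T\<close>] by auto
    ultimately show "sqfree_monom B \<in> (nonface_ideal (Pow T) :: (_ \<Rightarrow>\<^sub>0 'k) set)" by (simp add: sqfree_in_nonface_ideal)
  qed
  finally show ?thesis .
qed

text \<open>Modulo the nonfaces of the simplex \<open>T\<close>, the top symmetric function is the monomial of \<open>T\<close>,
  which cuts out the boundary; the boundary is assembled from its facets one at a time.\<close>

lemma elem_syms_regular_simplex:
  assumes "finite V" "T \<subseteq> V" "card T = d"
  shows "weakly_regular (nonface_ideal (Pow T) :: (_ \<Rightarrow>\<^sub>0 'k::field) set) (elem_syms V d)"
  using assms(2,3)
proof (induction d arbitrary: T)
  case (Suc d)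
  have finT: "finite T" using Suc.prems(1) assms(1) finite_subset by blast
  have I: "ideal_set (nonface_ideal (Pow T) :: (_ \<Rightarrow>\<^sub>0 'k) set)" by (rule ideal_set_nonface) (auto simp: down_closed_def)
  \<comment> \<open>The sets not containing \<open>U\<close> interpolate between one facet of the
    boundary, \<open>U = {t}\<close>, and the whole boundary, \<open>U = T\<close>. Enlarging
    \<open>U\<close> by \<open>t\<close> glues on the facet \<open>T - {t}\<close>: the colon by the
    monomial of \<open>U\<close> is that simplex, and adding the monomial gives back the complex for
    \<open>U\<close>.\<close>
  have bd: "weakly_regular (nonface_ideal {A. A \<subseteq> T \<and> \<not> U \<subseteq> A} :: (_ \<Rightarrow>\<^sub>0 'k) set) (elem_syms V d)"
    if "finite U" "U \<noteq> {}" "U \<subseteq> T" for U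
    using that
  proof (induction U rule: finite_ne_induct)
    case (singleton t)
    have "{A. A \<subseteq> T \<and> \<not> {t} \<subseteq> A} = Pow (T - {t})" by blast
    then show ?case using Suc.IH[of "T - {t}"] Suc.prems finT singleton by auto
  next
    case (insert t U)
    let ?D = "{A. A \<subseteq> T \<and> \<not> insert t U \<subseteq> A}"
    have dc: "down_closed ?D" unfolding down_closed_def by blast
    show ?case
    proof (rule weakly_regular_extension[OF ideal_set_nonface[OF dc], of "sqfree_monom U"])
      have "{A. A \<union> U \<in> ?D} = Pow (T - {t})" using insert by blast
      then show "weakly_regular (colon_ideal (nonface_ideal ?D) (sqfree_monom U) :: (_ \<Rightarrow>\<^sub>0 'k) set) (elem_syms V d)"
        using Suc.IH[of "T - {t}"] Suc.prems finT insert by (auto simp: colon_nonface)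
      have eq: "{A \<in> ?D. \<not> U \<subseteq> A} = {A. A \<subseteq> T \<and> \<not> U \<subseteq> A}" by blast
      show "weakly_regular (ext_ideal (nonface_ideal ?D) (sqfree_monom U) :: (_ \<Rightarrow>\<^sub>0 'k) set) (elem_syms V d)"
        unfolding ext_nonface[OF insert.hyps(1) dc] eq using insert by blast
    qed
  qed
  have "T \<noteq> {}" using Suc.prems by auto
  then have "weakly_regular (nonface_ideal {A. A \<subseteq> T \<and> \<not> T \<subseteq> A} :: (_ \<Rightarrow>\<^sub>0 'k) set) (elem_syms V d)"
    using bd finT by simp
  moreover have "ext_ideal (nonface_ideal (Pow T)) (sqfree_monom T) =
      (nonface_ideal {A. A \<subseteq> T \<and> \<not> T \<subseteq> A} :: (_ \<Rightarrow>\<^sub>0 'k) set)"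
    by (subst ext_nonface[OF finT]) (auto simp: down_closed_def Pow_def)
  moreover have "a \<in> nonface_ideal (Pow T)" if "sqfree_monom T * a \<in> nonface_ideal (Pow T)" for a :: "_ \<Rightarrow>\<^sub>0 'k"
  proof -
    have "a \<in> colon_ideal (nonface_ideal (Pow T)) (sqfree_monom T)" using that by (simp add: colon_ideal_def)
    moreover have "{A. A \<union> T \<in> Pow T} = Pow T" by blast
    ultimately show ?thesis by (simp only: colon_nonface[OF finT])
  qed
  ultimately have "weakly_regular (nonface_ideal (Pow T) :: (_ \<Rightarrow>\<^sub>0 'k) set) (sqfree_monom T # elem_syms V d)"
    by simp
  then show ?case
    using weakly_regular_cong[OF I elem_sym_mod_simplex[OF assms(1) Suc.prems]] by simp
qed simp

text \<open>For the last facet \<open>F\<close>, let \<open>?R\<close> be its restriction set, the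
  vertices whose removal leads into the earlier complex. The new faces are those of \<open>F\<close>
  containing \<open>?R\<close>, so the colon by the monomial of \<open>?R\<close> is the simplex on
  \<open>F\<close>, and adding the monomial leaves the earlier complex.\<close>

lemma elem_syms_regular_shelling:
  assumes "finite V" "shelling Fs" "Fs \<noteq> []" "\<And>F. F \<in> set Fs \<Longrightarrow> F \<subseteq> V \<and> card F = d"
  shows "weakly_regular (nonface_ideal (generated_complex (set Fs)) :: (_ \<Rightarrow>\<^sub>0 'k::field) set) (elem_syms V d)"
  using assms(2-)
proof (induction Fs rule: rev_induct)
  case (snoc F Fs)
  have F: "F \<subseteq> V" "card F = d" "finite F" using snoc.prems(3)[of F] assms(1) finite_subset by auto
  let ?D = "generated_complex (set (Fs @ [F]))"
  have sh: "\<exists>v\<in>F - Fs ! j. \<exists>k<length Fs. F - {v} \<subseteq> Fs ! k" if jl: "j < length Fs" for j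
  proof -
    obtain v k where "v \<in> (Fs @ [F]) ! length Fs - (Fs @ [F]) ! j" "k < length Fs"
      "(Fs @ [F]) ! length Fs - {v} \<subseteq> (Fs @ [F]) ! k"
      using snoc.prems(1)[unfolded shelling_def, rule_format, of "length Fs" j] jl by auto
    then show ?thesis using jl by (intro bexI[of _ v] exI[of _ k]) (auto simp: nth_append)
  qed
  have shFs: "shelling Fs"
    unfolding shelling_def
  proof (intro allI impI)
    fix i j assume ij: "i < length Fs" "j < i"
    then obtain v k where "v \<in> (Fs @ [F]) ! i - (Fs @ [F]) ! j" "k < i" "(Fs @ [F]) ! i - {v} \<subseteq> (Fs @ [F]) ! k"
      using snoc.prems(1)[unfolded shelling_def, rule_format, of i j] by auto
    then show "\<exists>v\<in>Fs ! i - Fs ! j. \<exists>k<i. Fs ! i - {v} \<subseteq> Fs ! k"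
      using ij by (intro bexI[of _ v] exI[of _ k]) (auto simp: nth_append)
  qed
  show ?case
  proof (cases "Fs = []")
    case True
    then have "?D = Pow F" by (auto simp: generated_complex_def)
    then show ?thesis using elem_syms_regular_simplex[OF assms(1) F(1,2)] by simp
  next
    case False
    let ?R = "{v \<in> F. F - {v} \<in> generated_complex (set Fs)}"
    have finR: "finite ?R" using F(3) by simp
    \<comment> \<open>If \<open>?R\<close> lay in an earlier facet, the shelling condition against
      that facet would produce a vertex of \<open>?R\<close> outside it.\<close>
    have Rnot: "?R \<notin> generated_complex (set Fs)"
    proof
      assume "?R \<in> generated_complex (set Fs)"
      then obtain j where j: "j < length Fs" "?R \<subseteq> Fs ! j" by (auto simp: generated_complex_def in_set_conv_nth)
      then obtain v k where v: "v \<in> F - Fs ! j" "k < length Fs" "F - {v} \<subseteq> Fs ! k" using sh by blast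
      then have "v \<in> ?R" by (auto simp: generated_complex_def)
      then show False using j v by blast
    qed
    have dc: "down_closed ?D" using generated_complex_closed unfolding down_closed_def by blast
    have D: "?D = generated_complex (set Fs) \<union> Pow F" by (auto simp: generated_complex_def)
    show ?thesis
    proof (rule weakly_regular_extension[OF ideal_set_nonface[OF dc], of "sqfree_monom ?R"])
      have "{A. A \<union> ?R \<in> ?D} = Pow F"
        unfolding D using Rnot generated_complex_closed[of _ "set Fs" ?R] by blast
      then show "weakly_regular (colon_ideal (nonface_ideal ?D) (sqfree_monom ?R) :: (_ \<Rightarrow>\<^sub>0 'k) set) (elem_syms V d)"
        using elem_syms_regular_simplex[OF assms(1) F(1,2)] by (simp add: colon_nonface[OF finR])
      have eq: "{A \<in> ?D. \<not> ?R \<subseteq> A} = generated_complex (set Fs)"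
      proof (intro equalityI subsetI)
        fix A assume A: "A \<in> {A \<in> ?D. \<not> ?R \<subseteq> A}"
        show "A \<in> generated_complex (set Fs)"
        proof (rule ccontr)
          assume no: "A \<notin> generated_complex (set Fs)"
          then have "A \<subseteq> F" using A D by blast
          moreover obtain v where v: "v \<in> ?R" "v \<notin> A" using A by blast
          ultimately have "A \<subseteq> F - {v}" by blast
          then show False using v no generated_complex_closed by blast
        qed
      next
        fix A assume A: "A \<in> generated_complex (set Fs)"
        then show "A \<in> {A \<in> ?D. \<not> ?R \<subseteq> A}"
          using D Rnot generated_complex_closed[OF A, of ?R] by blast
      qed
      show "weakly_regular (ext_ideal (nonface_ideal ?D) (sqfree_monom ?R) :: (_ \<Rightarrow>\<^sub>0 'k) set) (elem_syms V d)"
        unfolding ext_nonface[OF finR dc] eq using snoc.IH[OF shFs False] snoc.prems(3) by simp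
    qed
  qed
qed simp

lemma elem_sym_constant_term:
  "finite V \<Longrightarrow> d \<ge> 1 \<Longrightarrow> coeff (elem_sym V d :: _ \<Rightarrow>\<^sub>0 'k::field) 0 = 0"
proof -
  assume "finite V" "d \<ge> 1"
  have "coeff (sqfree_monom B :: _ \<Rightarrow>\<^sub>0 'k) 0 = 0" if B: "B \<subseteq> V" "card B = d" for B
  proof -
    have "finite B" "B \<noteq> {}" using B \<open>finite V\<close> \<open>d \<ge> 1\<close> finite_subset by auto
    then have "expo B \<noteq> 0" using exps_expo[of B] by auto
    then show ?thesis by (simp add: sqfree_monom_def lookup_single)
  qed
  then show ?thesis by (simp add: elem_sym_def lookup_sum)
qed

section \<open>Chains of primes over a squarefree monomial ideal\<close>

text \<open>Take minima one coordinate of \<open>T\<close> after another, as in a lexicographic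
  order. Outside \<open>T\<close> the exponents are constant on each set, so finitely many
  coordinates suffice.\<close>

lemma unique_product:
  fixes X Y :: "('v \<Rightarrow>\<^sub>0 nat) set"
  assumes "finite T" "finite X" "X \<noteq> {}" "finite Y" "Y \<noteq> {}"
    and "\<And>x x' v. x \<in> X \<Longrightarrow> x' \<in> X \<Longrightarrow> v \<notin> T \<Longrightarrow> coeff x v = coeff x' v"
    and "\<And>y y' v. y \<in> Y \<Longrightarrow> y' \<in> Y \<Longrightarrow> v \<notin> T \<Longrightarrow> coeff y v = coeff y' v"
  shows "\<exists>x\<in>X. \<exists>y\<in>Y. \<forall>x'\<in>X. \<forall>y'\<in>Y. x' + y' = x + y \<longrightarrow> x' = x \<and> y' = y"
  using assms
proof (induction T arbitrary: X Y rule: finite_induct)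
  case empty
  then have "x = x'" if "x \<in> X" "x' \<in> X" for x x' using that by (intro poly_mapping_eqI) blast
  moreover have "y = y'" if "y \<in> Y" "y' \<in> Y" for y y' using that empty by (intro poly_mapping_eqI) blast
  ultimately show ?case using empty.prems(2,4) by blast
next
  case (insert t T)
  have minset: "finite {x \<in> Z. coeff x t = Min ((\<lambda>x. coeff x t) ` Z)}"
    "{x \<in> Z. coeff x t = Min ((\<lambda>x. coeff x t) ` Z)} \<noteq> {}"
    "\<And>x. x \<in> Z \<Longrightarrow> Min ((\<lambda>x. coeff x t) ` Z) \<le> coeff x t"
    if "finite Z" "Z \<noteq> {}" for Z :: "('v \<Rightarrow>\<^sub>0 nat) set"
  proof -
    show "finite {x \<in> Z. coeff x t = Min ((\<lambda>x. coeff x t) ` Z)}" using that by simp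
    have "Min ((\<lambda>x. coeff x t) ` Z) \<in> (\<lambda>x. coeff x t) ` Z" using that by (intro Min_in) auto
    then show "{x \<in> Z. coeff x t = Min ((\<lambda>x. coeff x t) ` Z)} \<noteq> {}" by force
    show "\<And>x. x \<in> Z \<Longrightarrow> Min ((\<lambda>x. coeff x t) ` Z) \<le> coeff x t" using that by simp
  qed
  define mx my where "mx = Min ((\<lambda>x. coeff x t) ` X)" and "my = Min ((\<lambda>x. coeff x t) ` Y)"
  let ?X = "{x \<in> X. coeff x t = mx}" and ?Y = "{y \<in> Y. coeff y t = my}"
  note mX = minset[OF insert.prems(1,2), folded mx_def] and mY = minset[OF insert.prems(3,4), folded my_def]
  have "\<exists>x\<in>?X. \<exists>y\<in>?Y. \<forall>x'\<in>?X. \<forall>y'\<in>?Y. x' + y' = x + y \<longrightarrow> x' = x \<and> y' = y"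
  proof (rule insert.IH[OF mX(1,2) mY(1,2)])
    fix x x' v assume "x \<in> ?X" "x' \<in> ?X" "v \<notin> T"
    then show "coeff x v = coeff x' v" using insert.prems(5)[of x x' v] by (cases "v = t") auto
  next
    fix x x' v assume "x \<in> ?Y" "x' \<in> ?Y" "v \<notin> T"
    then show "coeff x v = coeff x' v" using insert.prems(6)[of x x' v] by (cases "v = t") auto
  qed
  then obtain x y where xy: "x \<in> ?X" "y \<in> ?Y"
    "\<And>x' y'. x' \<in> ?X \<Longrightarrow> y' \<in> ?Y \<Longrightarrow> x' + y' = x + y \<Longrightarrow> x' = x \<and> y' = y" by blast
  have "x' = x \<and> y' = y" if x': "x' \<in> X" "y' \<in> Y" "x' + y' = x + y" for x' y'
  proof -
    have "coeff x' t + coeff y' t = mx + my"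
      using xy(1,2) arg_cong[OF x'(3), of "\<lambda>z. coeff z t"] by (simp add: lookup_add)
    then have "coeff x' t = mx" "coeff y' t = my" using mX(3)[OF x'(1)] mY(3)[OF x'(2)] by linarith+
    then show ?thesis using xy(3) x' by blast
  qed
  then show ?case using xy(1,2) by blast
qed

lemma coeff_mult_unique:
  fixes p q :: "('v \<Rightarrow>\<^sub>0 nat) \<Rightarrow>\<^sub>0 'k::field"
  assumes "\<And>x' y'. x' \<in> monoms p \<Longrightarrow> y' \<in> monoms q \<Longrightarrow> x' + y' = x + y \<Longrightarrow> x' = x \<and> y' = y"
    and "x \<in> monoms p" "y \<in> monoms q"
  shows "coeff (p * q) (x + y) = coeff p x * coeff q y"
proof -
  define p' where "p' = p - Poly_Mapping.single x (coeff p x)"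
  have p: "p = Poly_Mapping.single x (coeff p x) + p'" by (simp add: p'_def)
  have "coeff p' x = 0" by (simp add: p'_def lookup_minus)
  moreover have "coeff p' m = coeff p m" if "m \<noteq> x" for m
    using that by (simp add: p'_def lookup_minus lookup_single)
  ultimately have p': "m \<in> monoms p \<and> m \<noteq> x" if "m \<in> monoms p'" for m
    using that by (metis in_keys_iff)
  have "x + y \<notin> monoms (p' * q)"
  proof
    assume "x + y \<in> monoms (p' * q)"
    then obtain m n where mn: "m \<in> monoms p'" "n \<in> monoms q" "x + y = m + n" by (rule monoms_mult)
    then show False using assms(1)[of m n] p'[OF mn(1)] by auto
  qed
  then have "coeff (p' * q) (x + y) = 0" by (simp add: in_keys_iff)
  moreover have "p * q = Poly_Mapping.single x (coeff p x) * q + p' * q"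
    using p by (metis distrib_right)
  ultimately show ?thesis by (simp add: lookup_add lookup_single_mult)
qed

text \<open>Modulo this ideal only monomials supported in \<open>T\<close> remain. A pair of these
  with a unique product leaves a nonzero coefficient in \<open>p * q\<close>; other monomials cannot
  interfere, since supports unite under multiplication.\<close>

lemma prime_set_nonface_simplex:
  assumes "finite T"
  shows "prime_set (nonface_ideal (Pow T) :: (_ \<Rightarrow>\<^sub>0 'k::field) set)"
  unfolding prime_set_def
proof (intro conjI allI impI)
  show "ideal_set (nonface_ideal (Pow T) :: (_ \<Rightarrow>\<^sub>0 'k) set)"
    by (rule ideal_set_nonface) (auto simp: down_closed_def)
  show "1 \<notin> (nonface_ideal (Pow T) :: (_ \<Rightarrow>\<^sub>0 'k) set)" by (simp add: nonface_ideal_def)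
  fix p q :: "_ \<Rightarrow>\<^sub>0 'k" assume pq: "p * q \<in> nonface_ideal (Pow T)"
  show "p \<in> nonface_ideal (Pow T) \<or> q \<in> nonface_ideal (Pow T)"
  proof (rule ccontr)
    assume no: "\<not> ?thesis"
    let ?X = "{m \<in> monoms p. exps m \<subseteq> T}" and ?Y = "{m \<in> monoms q. exps m \<subseteq> T}"
    have ne: "?X \<noteq> {}" "?Y \<noteq> {}" using no by (auto simp: nonface_ideal_def)
    have zero: "coeff m v = 0" if "exps m \<subseteq> T" "v \<notin> T" for m :: "'a \<Rightarrow>\<^sub>0 nat" and v
      using that by (metis in_keys_iff subsetD)
    have "\<exists>x\<in>?X. \<exists>y\<in>?Y. \<forall>x'\<in>?X. \<forall>y'\<in>?Y. x' + y' = x + y \<longrightarrow> x' = x \<and> y' = y"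
      using ne assms by (intro unique_product[of T]) (auto simp: zero)
    then obtain x y where xy: "x \<in> ?X" "y \<in> ?Y"
      "\<And>x' y'. x' \<in> ?X \<Longrightarrow> y' \<in> ?Y \<Longrightarrow> x' + y' = x + y \<Longrightarrow> x' = x \<and> y' = y" by blast
    have "coeff (p * q) (x + y) = coeff p x * coeff q y"
    proof (rule coeff_mult_unique)
      fix x' y' assume *: "x' \<in> monoms p" "y' \<in> monoms q" "x' + y' = x + y"
      have "exps x' \<union> exps y' = exps x \<union> exps y" using *(3) by (metis exps_add)
      then have "x' \<in> ?X" "y' \<in> ?Y" using * xy(1,2) by auto
      then show "x' = x \<and> y' = y" using xy(3) *(3) by blast
    qed (use xy in auto)
    then have "x + y \<in> monoms (p * q)" using xy(1,2) by (auto simp: in_keys_iff)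
    moreover have "exps (x + y) \<subseteq> T" using xy(1,2) by (simp add: exps_add)
    ultimately show False using pq by (auto simp: nonface_ideal_def)
  qed
qed

text \<open>Killing the variables of \<open>F\<close> one at a time climbs through the primes of
  smaller and smaller simplices; this bounds the dimension from below.\<close>

lemma prime_chain_of_face:
  assumes "down_closed \<Delta>" "F \<in> \<Delta>" "finite F"
  shows "\<exists>P. prime_chain (nonface_ideal \<Delta> :: (_ \<Rightarrow>\<^sub>0 'k::field) set) (card F) P"
proof -
  obtain vs where vs: "set vs = F" "distinct vs" using finite_distinct_list[OF assms(3)] by blast
  have len: "length vs = card F" using vs distinct_card by metis
  let ?P = "\<lambda>i. nonface_ideal (Pow (set (drop i vs))) :: (_ \<Rightarrow>\<^sub>0 'k) set"
  have "?P i \<subset> ?P (Suc i)" if i: "i < card F" for i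
  proof
    have sub: "set (drop (Suc i) vs) \<subseteq> set (drop i vs)" by (simp add: set_drop_subset_set_drop)
    then show "?P i \<subseteq> ?P (Suc i)" by (intro nonface_ideal_antimono) auto
    have vi: "vs ! i \<in> set (drop i vs)" "vs ! i \<notin> set (drop (Suc i) vs)"
      using i len vs(2) by (auto simp: Cons_nth_drop_Suc[symmetric] distinct_conv_nth in_set_conv_nth)
    have "sqfree_monom {vs ! i} \<in> ?P (Suc i)" "sqfree_monom {vs ! i} \<notin> ?P i"
      using vi by (simp_all add: sqfree_in_nonface_ideal)
    then show "?P i \<noteq> ?P (Suc i)" by blast
  qed
  moreover have "nonface_ideal \<Delta> \<subseteq> ?P 0"
    using assms(1,2) vs(1) by (intro nonface_ideal_antimono) (auto simp: down_closed_def)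
  ultimately show ?thesis
    by (intro exI[of _ ?P]) (simp add: prime_chain_def prime_set_nonface_simplex)
qed

text \<open>The bound is on each exponent separately rather than on the total degree, which makes
  the number of monomials a plain power.\<close>

definition bounded_polys :: "'v set \<Rightarrow> nat \<Rightarrow> (('v \<Rightarrow>\<^sub>0 nat) \<Rightarrow>\<^sub>0 'k::field) set" where
  "bounded_polys T M = {p. \<forall>m\<in>monoms p. exps m \<subseteq> T \<and> (\<forall>v. coeff m v \<le> M)}"

lemma bounded_polys_mult:
  assumes "p \<in> bounded_polys T M" "q \<in> bounded_polys T N"
  shows "p * q \<in> bounded_polys T (M + N)"
  unfolding bounded_polys_def
proof (intro CollectI ballI)
  fix k assume "k \<in> monoms (p * q)"
  then obtain m n where "m \<in> monoms p" "n \<in> monoms q" "k = m + n" by (rule monoms_mult)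
  then show "exps k \<subseteq> T \<and> (\<forall>v. coeff k v \<le> M + N)"
    using assms by (auto simp: bounded_polys_def exps_add lookup_add intro: add_mono)
qed

lemma bounded_polys_1: "1 \<in> bounded_polys T 0"
  by (simp add: bounded_polys_def)

lemma bounded_polys_power: "p \<in> bounded_polys T M \<Longrightarrow> p ^ n \<in> bounded_polys T (n * M)"
  by (induction n) (auto intro: bounded_polys_1 bounded_polys_mult)

lemma bounded_polys_mono: "p \<in> bounded_polys T M \<Longrightarrow> M \<le> N \<Longrightarrow> p \<in> bounded_polys T N"
  by (auto simp: bounded_polys_def intro: order_trans)

lemma bounded_polys_monomial_eval:
  assumes "set ys \<subseteq> bounded_polys T D" "set \<alpha> \<subseteq> {..N}" "length \<alpha> = length ys"
  shows "monomial_eval ys \<alpha> \<in> bounded_polys T (length ys * (N * D))"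
  using assms(3,1,2)
proof (induction \<alpha> ys rule: list_induct2)
  case Nil
  then show ?case by (simp add: monomial_eval_def bounded_polys_1)
next
  case (Cons a \<alpha> y ys)
  have "y ^ a \<in> bounded_polys T (N * D)"
    using Cons.prems by (intro bounded_polys_mono[OF bounded_polys_power]) auto
  then have "y ^ a * monomial_eval ys \<alpha> \<in> bounded_polys T (N * D + length ys * (N * D))"
    using Cons by (intro bounded_polys_mult) auto
  then show ?case by (simp add: monomial_eval_def)
qed

definition poly_scale :: "'k::field \<Rightarrow> (('v \<Rightarrow>\<^sub>0 nat) \<Rightarrow>\<^sub>0 'k) \<Rightarrow> ('v \<Rightarrow>\<^sub>0 nat) \<Rightarrow>\<^sub>0 'k" where
  "poly_scale c p = Poly_Mapping.single 0 c * p"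

interpretation poly_vs: vector_space poly_scale
  by unfold_locales
    (simp_all add: poly_scale_def distrib_left distrib_right single_add mult_single mult.assoc[symmetric])

lemma bounded_polys_span:
  assumes "finite T"
  obtains B :: "(('v \<Rightarrow>\<^sub>0 nat) \<Rightarrow>\<^sub>0 'k::field) set"
  where "finite B" "card B \<le> (M + 1) ^ card T" "bounded_polys T M \<subseteq> poly_vs.span B"
proof -
  let ?m = "\<lambda>f. \<Sum>v\<in>T. Poly_Mapping.single v (f v :: nat)"
  let ?B = "(\<lambda>f. Poly_Mapping.single (?m f) 1 :: _ \<Rightarrow>\<^sub>0 'k) ` (T \<rightarrow>\<^sub>E {..M})"
  have fin: "finite (T \<rightarrow>\<^sub>E {..M})" using assms by (simp add: finite_PiE)
  have "card ?B \<le> card (T \<rightarrow>\<^sub>E {..M})" by (rule card_image_le[OF fin])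
  also have "\<dots> = (M + 1) ^ card T" using assms by (simp add: card_PiE)
  finally have "card ?B \<le> (M + 1) ^ card T" .
  moreover have "p \<in> poly_vs.span ?B" if p: "p \<in> bounded_polys T M" for p :: "_ \<Rightarrow>\<^sub>0 'k"
  proof -
    have "(\<Sum>m\<in>monoms p. Poly_Mapping.single m (coeff p m)) \<in> poly_vs.span ?B"
    proof (rule poly_vs.span_sum)
      fix m assume m: "m \<in> monoms p"
      let ?f = "restrict (coeff m) T"
      have "m = ?m ?f"
      proof (rule poly_mapping_eqI)
        fix v
        have "exps m \<subseteq> T" using p m by (simp add: bounded_polys_def)
        then have "v \<notin> T \<Longrightarrow> coeff m v = 0" by (metis in_keys_iff subsetD)
        then show "coeff m v = coeff (?m ?f) v" using assms by (simp add: lookup_sum lookup_single when_def)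
      qed
      then have e: "Poly_Mapping.single m (1 :: 'k) = Poly_Mapping.single (?m ?f) 1" by (rule arg_cong)
      have "?f \<in> T \<rightarrow>\<^sub>E {..M}" using p m by (auto simp: bounded_polys_def)
      then have "Poly_Mapping.single (?m ?f) 1 \<in> ?B" by (rule imageI)
      then have "Poly_Mapping.single m 1 \<in> ?B" by (simp only: e)
      then have "poly_scale (coeff p m) (Poly_Mapping.single m 1) \<in> poly_vs.span ?B"
        by (intro poly_vs.span_scale poly_vs.span_base)
      then show "Poly_Mapping.single m (coeff p m) \<in> poly_vs.span ?B"
        by (simp add: poly_scale_def mult_single)
    qed
    then show ?thesis using poly_expansion[of p] by simp
  qed
  ultimately show ?thesis using that[of ?B] fin by blast
qed

text \<open>Stated for an indexed family, where a repeated value is itself a relation; otherwise the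
  image has more elements than a spanning set.\<close>

lemma linear_relation:
  fixes g :: "'a \<Rightarrow> ('v \<Rightarrow>\<^sub>0 nat) \<Rightarrow>\<^sub>0 'k::field"
  assumes "finite X" "finite B" "card B < card X" "g ` X \<subseteq> poly_vs.span B"
  obtains c where "\<exists>x\<in>X. c x \<noteq> 0" "(\<Sum>x\<in>X. Poly_Mapping.single 0 (c x) * g x) = 0"
proof (cases "inj_on g X")
  case True
  have "poly_vs.dependent (g ` X)"
  proof (rule ccontr)
    assume "\<not> ?thesis"
    then have "card (g ` X) \<le> card B" using poly_vs.independent_span_bound assms by blast
    then show False using assms(3) card_image[OF True] by simp
  qed
  then obtain u where u: "\<exists>v\<in>g ` X. u v \<noteq> 0" "(\<Sum>v\<in>g ` X. poly_scale (u v) v) = 0"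
    using poly_vs.dependent_finite[of "g ` X"] assms(1) by auto
  show ?thesis
  proof (rule that[of "u \<circ> g"])
    show "(\<Sum>x\<in>X. Poly_Mapping.single 0 ((u \<circ> g) x) * g x) = 0"
      using u(2) by (simp add: sum.reindex[OF True] poly_scale_def)
  qed (use u in auto)
next
  case False
  then obtain x x' where x: "x \<in> X" "x' \<in> X" "x \<noteq> x'" "g x = g x'" by (auto simp: inj_on_def)
  let ?c = "\<lambda>z. if z = x then 1 else if z = x' then -1 else 0 :: 'k"
  have "(\<Sum>z\<in>X. Poly_Mapping.single 0 (?c z) * g z) = (\<Sum>z\<in>{x, x'}. Poly_Mapping.single 0 (?c z) * g z)"
    using x assms(1) by (intro sum.mono_neutral_right) auto
  also have "\<dots> = 0" using x by (simp add: single_uminus)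
  finally have "(\<Sum>z\<in>X. Poly_Mapping.single 0 (?c z) * g z) = 0" .
  moreover have "\<exists>z\<in>X. ?c z \<noteq> 0" using x by (intro bexI[of _ x]) simp_all
  ultimately show ?thesis by (intro that[of ?c])
qed

lemma variable_eq: "variable v = sqfree_monom {v}"
  by (simp add: variable_def sqfree_monom_def expo_def)

lemma prime_mod_simplex:
  fixes p :: "('v \<Rightarrow>\<^sub>0 nat) \<Rightarrow>\<^sub>0 'k::field"
  assumes "prime_set P" "\<And>v. v \<notin> T \<Longrightarrow> variable v \<in> P"
  obtains q D where "p - q \<in> P" "q \<in> bounded_polys T D"
proof -
  let ?X = "{m \<in> monoms p. exps m \<subseteq> T}"
  define q where "q = (\<Sum>m\<in>?X. Poly_Mapping.single m (coeff p m))"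
  have I: "ideal_set P" using prime_set_ideal assms(1) .
  have "p = (\<Sum>m\<in>?X. Poly_Mapping.single m (coeff p m)) +
      (\<Sum>m\<in>monoms p - ?X. Poly_Mapping.single m (coeff p m))"
    by (subst (1) poly_expansion) (simp add: sum.subset_diff[of ?X "monoms p"] add.commute)
  then have "p - q = (\<Sum>m\<in>monoms p - ?X. Poly_Mapping.single m (coeff p m))"
    unfolding q_def[symmetric] by (simp only: diff_eq_eq add.commute)
  also have "\<dots> \<in> P"
  proof (rule ideal_set_sum[OF I])
    fix m assume "m \<in> monoms p - ?X"
    then obtain v where v: "v \<in> exps m" "v \<notin> T" by blast
    have "m = expo {v} + (m - expo {v})"
    proof (rule poly_mapping_eqI)
      fix w
      have "coeff m v \<ge> 1" using v(1) by (simp add: in_keys_iff Suc_le_eq)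
      then show "coeff m w = coeff (expo {v} + (m - expo {v})) w"
        by (simp add: lookup_add lookup_minus lookup_expo)
    qed
    then have "Poly_Mapping.single m (coeff p m) = variable v * Poly_Mapping.single (m - expo {v}) (coeff p m)"
      by (simp add: variable_eq sqfree_monom_def mult_single)
    then show "Poly_Mapping.single m (coeff p m) \<in> P"
      using assms(2)[OF v(2)] ideal_setD(4)[OF I] by metis
  qed
  finally have "p - q \<in> P" .
  moreover have mq: "monoms q \<subseteq> ?X"
  proof
    fix k assume "k \<in> monoms q"
    then have "coeff q k \<noteq> 0" by (simp add: in_keys_iff)
    then have "(\<Sum>m\<in>?X. coeff (Poly_Mapping.single m (coeff p m)) k) \<noteq> 0"
      unfolding q_def by (simp add: lookup_sum)
    then obtain m where "m \<in> ?X" "coeff (Poly_Mapping.single m (coeff p m)) k \<noteq> 0"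
      by (meson sum.not_neutral_contains_not_neutral)
    then show "k \<in> ?X" by (auto simp: lookup_single when_def split: if_splits)
  qed
  have "\<exists>D. \<forall>m\<in>monoms q. \<forall>v. coeff m v \<le> D"
  proof -
    let ?S = "\<Union>m\<in>monoms q. coeff m ` exps m"
    have "coeff m v \<le> Max (insert 0 ?S)" if "m \<in> monoms q" for m v
    proof (cases "v \<in> exps m")
      case True
      then show ?thesis using that by (intro Max_ge) auto
    qed (simp add: in_keys_iff)
    then show ?thesis by blast
  qed
  then obtain D where "\<forall>m\<in>monoms q. \<forall>v. coeff m v \<le> D" by blast
  then have "q \<in> bounded_polys T D" using mq by (auto simp: bounded_polys_def)
  ultimately show ?thesis using that by blast
qed

lemma single_0_dvd_1: "(c :: 'k::field) \<noteq> 0 \<Longrightarrow> Poly_Mapping.single (0 :: 'v \<Rightarrow>\<^sub>0 nat) c dvd 1"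
  by (rule dvdI[of _ _ "Poly_Mapping.single 0 (inverse c)"]) (simp add: mult_single single_one[symmetric] del: single_one)

text \<open>The transcendence degree bound, by counting: the \<open>(N+1)\<^sup>d\<^sup>+\<^sup>1\<close> monomials of degree at most
  \<open>N\<close> in each of \<open>d+1\<close> elements lie in a space whose dimension is \<open>O(N\<^sup>d)\<close>.\<close>

lemma prime_chain_length_le:
  assumes "finite V" "\<Delta> \<subseteq> Pow V" "\<And>A. A \<in> \<Delta> \<Longrightarrow> card A \<le> d"
    and chain: "prime_chain (nonface_ideal \<Delta> :: (_ \<Rightarrow>\<^sub>0 'k::field) set) n P"
  shows "n \<le> d"
proof (rule ccontr)
  assume "\<not> n \<le> d"
  then have dn: "Suc d \<le> n" by simp
  have prime: "\<And>i. i \<le> Suc d \<Longrightarrow> prime_set (P i)" and lt: "\<And>i. i < Suc d \<Longrightarrow> P i \<subset> P (Suc i)"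
    and I0: "nonface_ideal \<Delta> \<subseteq> P 0"
    using chain dn unfolding prime_chain_def by auto
  have P0: "P 0 \<subseteq> P i" if "i \<le> Suc d" for i
    using that
  proof (induction i)
    case (Suc i)
    then show ?case using lt[of i] by auto
  qed simp
  define T where "T = {v. variable v \<notin> P 0}"
  have "T \<subseteq> V"
  proof
    fix v assume "v \<in> T"
    then have "variable v \<notin> (nonface_ideal \<Delta> :: (_ \<Rightarrow>\<^sub>0 'k) set)" using I0 by (auto simp: T_def)
    then have "{v} \<in> \<Delta>" by (simp add: variable_eq sqfree_in_nonface_ideal)
    then show "v \<in> V" using assms(2) by blast
  qed
  then have finT: "finite T" using assms(1) finite_subset by blast
  \<comment> \<open>For a nonface \<open>T\<close>, the product of its variables would lie in the
    prime \<open>P 0\<close>, hence one of them would, against the choice of \<open>T\<close>. So at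
    most \<open>d\<close> variables survive modulo \<open>P 0\<close>.\<close>
  have "T \<in> \<Delta>"
  proof (rule ccontr)
    assume "T \<notin> \<Delta>"
    then have "sqfree_monom T \<in> P 0" using I0 finT by (auto simp: sqfree_in_nonface_ideal)
    then have "prod variable T \<in> P 0" by (simp add: prod_variable[OF finT])
    then show False using prime_set_prod[OF prime finT] by (auto simp: T_def)
  qed
  then have cardT: "card T \<le> d" using assms(3) by blast
  have "\<exists>q D. q \<in> P (Suc i) - P i \<and> q \<in> bounded_polys T D" if i: "i < Suc d" for i
  proof -
    obtain p where p: "p \<in> P (Suc i)" "p \<notin> P i" using lt[OF i] by blast
    obtain q D where q: "p - q \<in> P 0" "q \<in> bounded_polys T D"
      using prime_mod_simplex[OF prime, of 0 T p] by (auto simp: T_def)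
    have "p - q \<in> P (Suc i)" "p - q \<in> P i" using q(1) P0[of i] P0[of "Suc i"] i by auto
    then have "q \<in> P (Suc i) - P i"
      using p ideal_set_cong_mem[OF prime_set_ideal[OF prime]] i by (metis DiffI Suc_leI less_imp_le)
    then show ?thesis using q(2) by blast
  qed
  then obtain q D where q: "\<And>i. i < Suc d \<Longrightarrow> q i \<in> P (Suc i) - P i"
    "\<And>i. i < Suc d \<Longrightarrow> q i \<in> bounded_polys T (D i)" by metis
  define E where "E = Max (D ` {..<Suc d})"
  define ys where "ys = map q [0..<Suc d]"
  have ysB: "set ys \<subseteq> bounded_polys T E"
  proof
    fix y assume "y \<in> set ys"
    then obtain i where i: "i < Suc d" "y = q i" by (auto simp: ys_def simp del: upt_Suc)
    then have "D i \<le> E" unfolding E_def by (intro Max_ge) auto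
    then show "y \<in> bounded_polys T E" using q(2)[OF i(1)] i(2) bounded_polys_mono by blast
  qed
  have len: "length ys = Suc d" by (simp add: ys_def)
  \<comment> \<open>\<open>M\<close> bounds the exponents in products of powers, up to
    \<open>N\<close>, of the \<open>d + 1\<close> elements with exponents at most \<open>E\<close>.
    The choice of \<open>K\<close> gives \<open>M + 1 \<le> K * (N + 1)\<close>, and
    \<open>N = K ^ d\<close> then yields \<open>(M + 1) ^ d \<le> N * (N + 1) ^ d\<close>, just
    below the number \<open>(N + 1) ^ Suc d\<close> of exponent lists.\<close>
  define K where "K = Suc d * E + 1"
  define N where "N = K ^ d"
  define M where "M = Suc d * (N * E)"
  let ?X = "{\<alpha>. set \<alpha> \<subseteq> {..N} \<and> length \<alpha> = Suc d}"
  have finX: "finite ?X" by (rule finite_lists_length_eq) simp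
  have cardX: "card ?X = (N + 1) ^ Suc d" by (subst card_lists_length_eq) simp_all
  obtain B :: "(_ \<Rightarrow>\<^sub>0 'k) set" where B: "finite B" "card B \<le> (M + 1) ^ card T"
    "bounded_polys T M \<subseteq> poly_vs.span B"
    using bounded_polys_span[OF finT, of M] by blast
  have "card B \<le> (M + 1) ^ d"
    using B(2) power_increasing[OF cardT, of "M + 1"] by linarith
  also have "\<dots> \<le> (K * (N + 1)) ^ d"
    by (intro power_mono) (auto simp: M_def K_def algebra_simps)
  also have "\<dots> = N * (N + 1) ^ d" by (simp only: power_mult_distrib N_def)
  also have "\<dots> < (N + 1) ^ Suc d" by simp
  finally have "card B < card ?X" using cardX by simp
  moreover have "monomial_eval ys ` ?X \<subseteq> poly_vs.span B"
    using bounded_polys_monomial_eval[OF ysB] B(3) len unfolding M_def by fastforce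
  ultimately obtain c where c: "\<exists>\<alpha>\<in>?X. c \<alpha> \<noteq> 0"
    "(\<Sum>\<alpha>\<in>?X. Poly_Mapping.single 0 (c \<alpha>) * monomial_eval ys \<alpha>) = 0"
    by (rule linear_relation[OF finX B(1)])
  \<comment> \<open>Only nonzero scalars are units, so the vanishing terms are dropped before
    \<open>prime_chain_independent\<close> applies.\<close>
  let ?Y = "{\<alpha> \<in> ?X. c \<alpha> \<noteq> 0}"
  have "(\<Sum>\<alpha>\<in>?Y. Poly_Mapping.single 0 (c \<alpha>) * monomial_eval ys \<alpha>) \<notin> P 0"
  proof (rule prime_chain_independent)
    show "\<forall>i<length ys. ys ! i \<in> P (Suc i) - P i" using q(1) by (simp add: ys_def del: upt_Suc)
    show "\<forall>i<length ys. P i \<subseteq> P (Suc i)" using lt len by auto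
    show "\<forall>i\<le>length ys. prime_set (P i)" using prime len by simp
    show "\<forall>\<alpha>\<in>?Y. Poly_Mapping.single (0 :: 'a \<Rightarrow>\<^sub>0 nat) (c \<alpha>) dvd 1" by (simp add: single_0_dvd_1)
    show "finite ?Y" using finX by (rule finite_subset[rotated]) blast
    show "?Y \<noteq> {}" using c(1) by blast
  qed (use len in auto)
  moreover have "(\<Sum>\<alpha>\<in>?Y. Poly_Mapping.single 0 (c \<alpha>) * monomial_eval ys \<alpha>) = 0"
    using c(2) finX by (subst (asm) sum.mono_neutral_right[of ?X ?Y]) auto
  ultimately show False using ideal_setD(1)[OF prime_set_ideal[OF prime]] by simp
qed

section \<open>A gap bounds the depth\<close>

text \<open>Without constant term, every monomial of the power \<open>|V| + 1\<close> that is
  supported in \<open>V\<close> has degree above \<open>|V|\<close>. So it contains some variable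
  twice and is divisible by the corresponding \<open>y v\<close>; monomials that leave
  \<open>V\<close> lie in the ideal.\<close>

lemma nilpotent_mod_squares:
  fixes \<theta> :: "('v \<Rightarrow>\<^sub>0 nat) \<Rightarrow>\<^sub>0 'k::field"
  assumes "finite V" "\<Delta> \<subseteq> Pow V" "coeff \<theta> 0 = 0"
    and y: "\<And>v. v \<in> V \<Longrightarrow> y v dvd Poly_Mapping.single (Poly_Mapping.single v 2) 1"
  shows "\<exists>N a. \<theta> ^ N - (\<Sum>w\<in>V. a w * y w) \<in> nonface_ideal \<Delta>"
proof -
  let ?deg = "\<lambda>m. \<Sum>v\<in>V. coeff m v"
  have powdeg: "\<forall>m\<in>monoms (\<theta> ^ k). exps m \<subseteq> V \<longrightarrow> k \<le> ?deg m" for k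
  proof (induction k)
    case (Suc k)
    show ?case
    proof (intro ballI impI)
      fix m assume m: "m \<in> monoms (\<theta> ^ Suc k)" "exps m \<subseteq> V"
      have "m \<in> monoms (\<theta> * \<theta> ^ k)" using m(1) by simp
      then obtain a b where ab: "a \<in> monoms \<theta>" "b \<in> monoms (\<theta> ^ k)" "m = a + b" by (rule monoms_mult)
      then have sub: "exps a \<subseteq> V" "exps b \<subseteq> V" using m(2) by (auto simp: exps_add)
      have "a \<noteq> 0" using ab(1) assms(3) by (auto simp: in_keys_iff)
      then obtain v where v: "v \<in> exps a" by (metis ex_in_conv keys_eq_empty)
      have "1 \<le> coeff a v" using v by (simp add: in_keys_iff Suc_le_eq)
      also have "\<dots> \<le> ?deg a" using v sub(1) assms(1) by (intro member_le_sum) auto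
      finally have "1 \<le> ?deg a" .
      moreover have "k \<le> ?deg b" using Suc.IH ab(2) sub(2) by blast
      moreover have "?deg m = ?deg a + ?deg b" by (simp add: ab(3) lookup_add sum.distrib)
      ultimately show "Suc k \<le> ?deg m" by linarith
    qed
  qed simp
  have single_case: "\<exists>a. Poly_Mapping.single m c - (\<Sum>w\<in>V. a w * y w) \<in> nonface_ideal \<Delta>"
    if m: "exps m \<subseteq> V \<Longrightarrow> card V < ?deg m" for m and c :: 'k
  proof (cases "exps m \<subseteq> V")
    case False
    then have "exps m \<notin> \<Delta>" using assms(2) by blast
    then show ?thesis by (intro exI[of _ "\<lambda>_. 0"]) (simp add: single_in_nonface_ideal)
  next
    case True
    have "\<exists>v\<in>V. 2 \<le> coeff m v"
    proof (rule ccontr)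
      assume "\<not> ?thesis"
      then have "?deg m \<le> (\<Sum>v\<in>V. 1)" by (intro sum_mono) auto
      then show False using m[OF True] by simp
    qed
    then obtain v where v: "v \<in> V" "2 \<le> coeff m v" by blast
    have "m = Poly_Mapping.single v 2 + (m - Poly_Mapping.single v 2)"
    proof (rule poly_mapping_eqI)
      show "coeff m w = coeff (Poly_Mapping.single v 2 + (m - Poly_Mapping.single v 2)) w" for w
        using v(2) by (cases "w = v") (simp_all add: lookup_add lookup_minus lookup_single)
    qed
    then have "Poly_Mapping.single m c =
        Poly_Mapping.single (Poly_Mapping.single v 2) 1 * Poly_Mapping.single (m - Poly_Mapping.single v 2) c"
      by (simp add: mult_single)
    then obtain b where b: "Poly_Mapping.single m c = y v * b"
      using y[OF v(1)] by (metis dvd_mult2 dvd_def)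
    let ?a = "\<lambda>w. if w = v then b else 0"
    have "(\<Sum>w\<in>V. ?a w * y w) = (\<Sum>w\<in>{v}. ?a w * y w)"
      using v(1) assms(1) by (intro sum.mono_neutral_right) auto
    then have "Poly_Mapping.single m c - (\<Sum>w\<in>V. ?a w * y w) = 0" using b by (simp add: mult.commute)
    then show ?thesis by (intro exI[of _ ?a]) (simp add: nonface_ideal_def)
  qed
  let ?p = "\<theta> ^ Suc (card V)"
  have "\<exists>a. m \<in> monoms ?p \<longrightarrow>
      Poly_Mapping.single m (coeff ?p m) - (\<Sum>w\<in>V. a w * y w) \<in> nonface_ideal \<Delta>" for m
  proof (cases "m \<in> monoms ?p")
    case True
    have "exps m \<subseteq> V \<Longrightarrow> card V < ?deg m" using powdeg[of "Suc (card V)"] True by (auto dest: bspec)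
    then show ?thesis using single_case by blast
  qed simp
  then obtain a where a: "\<And>m. m \<in> monoms ?p \<longrightarrow>
      Poly_Mapping.single m (coeff ?p m) - (\<Sum>w\<in>V. a m w * y w) \<in> nonface_ideal \<Delta>"
    using choice[where Q = "\<lambda>m a. m \<in> monoms ?p \<longrightarrow>
      Poly_Mapping.single m (coeff ?p m) - (\<Sum>w\<in>V. a w * y w) \<in> nonface_ideal \<Delta>"] by blast
  let ?b = "\<lambda>w. \<Sum>m\<in>monoms ?p. a m w"
  have add: "f + g \<in> nonface_ideal \<Delta>" if "f \<in> nonface_ideal \<Delta>" "g \<in> nonface_ideal \<Delta>" for f g :: "_ \<Rightarrow>\<^sub>0 'k"
    using that keys_add[of f g] unfolding nonface_ideal_def by blast
  have sum: "sum f S \<in> nonface_ideal \<Delta>" if "\<And>x. x \<in> S \<Longrightarrow> f x \<in> nonface_ideal \<Delta>"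
    for f :: "('v \<Rightarrow>\<^sub>0 nat) \<Rightarrow> _ \<Rightarrow>\<^sub>0 'k" and S
    using that
  proof (induction S rule: infinite_finite_induct)
    case (insert x S)
    then show ?case by (simp add: add)
  qed (simp_all add: nonface_ideal_def)
  have "(\<Sum>m\<in>monoms ?p. Poly_Mapping.single m (coeff ?p m) - (\<Sum>w\<in>V. a m w * y w)) \<in> nonface_ideal \<Delta>"
    by (rule sum) (rule a[rule_format])
  moreover have "(\<Sum>m\<in>monoms ?p. Poly_Mapping.single m (coeff ?p m) - (\<Sum>w\<in>V. a m w * y w)) =
      ?p - (\<Sum>w\<in>V. ?b w * y w)"
    unfolding sum_subtractf poly_expansion[of ?p, symmetric]
    by (subst sum.swap) (simp add: sum_distrib_right)
  ultimately have "?p - (\<Sum>w\<in>V. ?b w * y w) \<in> nonface_ideal \<Delta>" by simp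
  then show ?thesis by (intro exI[of _ "Suc (card V)"] exI[of _ ?b])
qed

text \<open>The class is the local cohomology class of the disconnected link \<open>A \<union> B\<close> of \<open>F\<close>: the coboundary
  of \<open>x\<^sup>F\<close> at \<open>F\<close>, truncated to the sets meeting \<open>A\<close>.\<close>

lemma weakly_regular_length_gap:
  fixes \<theta>s :: "(('v \<Rightarrow>\<^sub>0 nat) \<Rightarrow>\<^sub>0 'k::field) list"
  assumes "finite V" "V = F \<union> A \<union> B" "F \<inter> (A \<union> B) = {}" "A \<inter> B = {}" "a0 \<in> A" "b0 \<in> B"
    and D: "down_closed \<Delta>" "\<Delta> \<subseteq> Pow V" "\<And>u. u \<in> A \<union> B \<Longrightarrow> insert u F \<in> \<Delta>"
      "\<And>a b. a \<in> A \<Longrightarrow> b \<in> B \<Longrightarrow> insert a (insert b F) \<notin> \<Delta>"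
    and reg: "weakly_regular (nonface_ideal \<Delta>) \<theta>s"
    and const: "\<And>\<theta>. \<theta> \<in> set \<theta>s \<Longrightarrow> coeff \<theta> 0 = 0"
  shows "length \<theta>s \<le> Suc (card F)"
proof (rule ccontr)
  assume "\<not> ?thesis"
  then have long: "int (card F) + 1 < int (length \<theta>s)" by simp
  let ?I = "nonface_ideal \<Delta> :: (_ \<Rightarrow>\<^sub>0 'k) set"
  have I: "ideal_set ?I" by (rule ideal_set_nonface[OF D(1)])
  have finF: "finite F" using assms(1,2) by simp
  obtain vs where vs: "set vs = V" "distinct vs" using finite_distinct_list[OF assms(1)] by blast
  \<comment> \<open>Squares on \<open>F\<close>: a coboundary term from \<open>w \<in> F\<close> has
    exponent at least 2 at \<open>w\<close> and cannot contribute to the squarefree monomial of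
    \<open>insert u F\<close>. First powers off \<open>F\<close> keep \<open>y u * f\<close>
    squarefree.\<close>
  define y :: "'v \<Rightarrow> ('v \<Rightarrow>\<^sub>0 nat) \<Rightarrow>\<^sub>0 'k" where
    "y v = Poly_Mapping.single (Poly_Mapping.single v (if v \<in> F then 2 else 1)) 1" for v
  define f :: "_ \<Rightarrow>\<^sub>0 'k" where "f = sqfree_monom F"
  define e where "e = (\<lambda>S. if S = F then f else 0)"
  define c where "c = (\<lambda>S. if S \<inter> A \<noteq> {} then koszul y vs e S else 0)"
  have yf: "y w * f = sqfree_monom (insert w F)" if "w \<notin> F" for w
    using that finF by (simp add: y_def f_def sqfree_monom_def mult_single expo_insert)
  have e_cochain: "cochain vs (int (card F)) e"
    using assms(2) vs by (auto simp: cochain_def e_def)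
  have c_cochain: "cochain vs (int (card F) + 1) c"
    using cochain_koszul[OF vs(2) e_cochain, of y] by (auto simp: cochain_def c_def split: if_splits)
  have ke: "(\<exists>u. u \<in> V - F \<and> T = insert u F \<and>
      (koszul y vs e T = y u * f \<or> koszul y vs e T = - (y u * f)))" if nz: "koszul y vs e T \<noteq> 0" for T
  proof -
    obtain \<sigma> :: "'v \<Rightarrow> _ \<Rightarrow>\<^sub>0 'k" where \<sigma>: "\<And>w. \<sigma> w = 1 \<or> \<sigma> w = - 1"
      "\<And>c. koszul y vs c T = (\<Sum>w\<in>T \<inter> set vs. \<sigma> w * (y w * c (T - {w})))"
      using koszul_formula[OF vs(2), of y T] by blast
    have "(\<Sum>w\<in>T \<inter> set vs. \<sigma> w * (y w * e (T - {w}))) \<noteq> 0" using nz \<sigma>(2) by simp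
    then obtain u where u: "u \<in> T \<inter> set vs" "\<sigma> u * (y u * e (T - {u})) \<noteq> 0"
      by (meson sum.not_neutral_contains_not_neutral)
    then have "e (T - {u}) \<noteq> 0" by auto
    then have Tu: "T - {u} = F" by (auto simp: e_def split: if_splits)
    then have T: "T = insert u F" "u \<in> V - F" using u(1) vs(1) by auto
    have "koszul y vs e T = (\<Sum>w\<in>{u}. \<sigma> w * (y w * e (T - {w})))"
      unfolding \<sigma>(2)
    proof (rule sum.mono_neutral_right)
      show "\<forall>w\<in>T \<inter> set vs - {u}. \<sigma> w * (y w * e (T - {w})) = 0"
      proof
        fix w assume "w \<in> T \<inter> set vs - {u}"
        then have "u \<in> T - {w}" using T by auto
        then have "T - {w} \<noteq> F" using T by auto
        then show "\<sigma> w * (y w * e (T - {w})) = 0" by (simp add: e_def)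
      qed
    qed (use u in auto)
    then have "koszul y vs e T = \<sigma> u * (y u * f)" using Tu by (simp add: e_def)
    then show ?thesis using T \<sigma>(1)[of u] by auto
  qed
  \<comment> \<open>Below a set missing \<open>A\<close> all values of \<open>c\<close> vanish.
    Below a set missing \<open>B\<close> the truncation is invisible, and
    \<open>koszul_koszul\<close> applies. At a set meeting both, each term is zero or, up to sign,
    the squarefree monomial of a nonface.\<close>
  have cocycle: "koszul y vs c S \<in> ?I" for S
  proof -
    obtain \<sigma> :: "'v \<Rightarrow> _ \<Rightarrow>\<^sub>0 'k" where \<sigma>: "\<And>w. \<sigma> w = 1 \<or> \<sigma> w = - 1"
      "\<And>c. koszul y vs c S = (\<Sum>w\<in>S \<inter> set vs. \<sigma> w * (y w * c (S - {w})))"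
      using koszul_formula[OF vs(2), of y S] by blast
    show ?thesis
    proof (cases "S \<inter> A = {}")
      case True
      then have "c (S - {w}) = 0" for w by (auto simp: c_def)
      then have "koszul y vs c S = 0" by (simp add: \<sigma>(2))
      then show ?thesis using ideal_setD(1)[OF I] by simp
    next
      case SA: False
      show ?thesis
      proof (cases "S \<inter> B = {}")
        case True
        have "c (S - {w}) = koszul y vs e (S - {w})" for w
        proof (cases "(S - {w}) \<inter> A = {}")
          case empty: True
          have "koszul y vs e (S - {w}) = 0"
          proof (rule ccontr)
            assume "koszul y vs e (S - {w}) \<noteq> 0"
            then obtain u where "u \<in> V - F" "S - {w} = insert u F" using ke by blast
            then have "u \<in> A \<union> B" "u \<in> S - {w}" using assms(2) by auto
            then show False using empty True by blast
          qed
          then show ?thesis using empty by (simp add: c_def)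
        qed (simp add: c_def)
        then have "koszul y vs c S = koszul y vs (koszul y vs e) S" by (simp only: \<sigma>(2))
        then show ?thesis using ideal_setD(1)[OF I] by (simp add: koszul_koszul)
      next
        case SB: False
        have "\<sigma> w * (y w * c (S - {w})) \<in> ?I" if w: "w \<in> S \<inter> set vs" for w
        proof (cases "c (S - {w}) = 0")
          case True
          then show ?thesis using ideal_setD(1)[OF I] by simp
        next
          case False
          then have nz: "koszul y vs e (S - {w}) \<noteq> 0" "c (S - {w}) = koszul y vs e (S - {w})"
            by (auto simp: c_def split: if_splits)
          then obtain u where u: "u \<in> V - F" "S - {w} = insert u F"
            "c (S - {w}) = y u * f \<or> c (S - {w}) = - (y u * f)" using ke by metis
          have S: "S = insert w (insert u F)" "u \<noteq> w" "w \<notin> F" using w u(2) by auto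
          have "S \<notin> \<Delta>"
          proof -
            have "A \<inter> F = {}" "B \<inter> F = {}" using assms(3) by auto
            then have "w \<in> A \<and> u \<in> B \<or> w \<in> B \<and> u \<in> A" using SA SB S assms(4) by blast
            then show ?thesis using D(4)[of w u] D(4)[of u w] S by (auto simp: insert_commute)
          qed
          have "y w * (y u * f) = sqfree_monom S"
            using yf[of u] u(1) S finF by (simp add: y_def sqfree_monom_def mult_single expo_insert)
          then have "y w * (y u * f) \<in> ?I"
            using \<open>S \<notin> \<Delta>\<close> S finF by (simp add: sqfree_in_nonface_ideal)
          then have "y w * c (S - {w}) \<in> ?I" using u(3) ideal_setD(5)[OF I] by auto
          then show ?thesis by (rule ideal_setD(3)[OF I])
        qed
        then show ?thesis unfolding \<sigma>(2) by (rule ideal_set_sum[OF I])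
      qed
    qed
  qed
  have "\<exists>b. cochain vs (int (card F) + 1 - 1) b \<and> (\<forall>S. c S - koszul y vs b S \<in> ?I)"
  proof (rule koszul_vanishing[OF vs(2) I reg _ long c_cochain cocycle])
    fix \<theta> assume "\<theta> \<in> set \<theta>s"
    then show "\<exists>N a. \<theta> ^ N - (\<Sum>w\<in>set vs. a w * y w) \<in> ?I"
      unfolding vs(1)
    proof (intro nilpotent_mod_squares[OF assms(1) D(2)] const)
      fix v
      have "Poly_Mapping.single (Poly_Mapping.single v 2) 1 =
          y v * Poly_Mapping.single (Poly_Mapping.single v (if v \<in> F then 0 else 1)) 1"
        by (simp add: y_def mult_single single_add[symmetric] numeral_2_eq_2)
      then show "y v dvd Poly_Mapping.single (Poly_Mapping.single v 2) 1" by simp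
    qed
  qed
  then obtain b where b: "\<And>S. c S - koszul y vs b S \<in> ?I" by blast
  \<comment> \<open>Compare coefficients at the squarefree monomial of the face
    \<open>insert u F\<close>. If \<open>c\<close> were the coboundary of \<open>b\<close> modulo
    the ideal, the coefficient of \<open>b F\<close> at \<open>expo F\<close> would be 1 because of
    \<open>u \<in> A\<close> and 0 because of \<open>u \<in> B\<close>.\<close>
  have key: "c (insert u F) = 0 \<longrightarrow> coeff (b F) (expo F) = 0"
    "c (insert u F) = koszul y vs e (insert u F) \<longrightarrow> coeff (b F) (expo F) = 1" if u: "u \<in> A \<union> B" for u
  proof -
    let ?S = "insert u F" and ?m = "expo (insert u F)"
    have uF: "u \<notin> F" "u \<in> set vs" using u assms(2,3) vs(1) by auto
    have m: "?m = Poly_Mapping.single u 1 + expo F" using uF finF by (simp add: expo_insert)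
    obtain \<sigma> :: "'v \<Rightarrow> _ \<Rightarrow>\<^sub>0 'k" where \<sigma>: "\<And>w. \<sigma> w = 1 \<or> \<sigma> w = - 1"
      "\<And>c. koszul y vs c ?S = (\<Sum>w\<in>?S \<inter> set vs. \<sigma> w * (y w * c (?S - {w})))"
      using koszul_formula[OF vs(2), of y ?S] by blast
    define s :: 'k where "s = (if \<sigma> u = 1 then 1 else - 1)"
    have s: "\<sigma> u * p = Poly_Mapping.single 0 s * p" for p
      using \<sigma>(1)[of u] by (auto simp: s_def single_uminus)
    have coeff_s: "coeff (Poly_Mapping.single 0 s * p) ?m = s * coeff p ?m" for p
      using lookup_single_mult[of 0 s p ?m] by simp
    have S_vs: "?S \<inter> set vs = insert u F" using uF assms(2) vs(1) by auto
    have Su: "?S - {u} = F" using uF by auto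
    have main: "coeff (koszul y vs p ?S) ?m = s * coeff (p F) (expo F)" for p
    proof -
      have "coeff (\<sigma> w * (y w * p (?S - {w}))) ?m = 0" if w: "w \<in> F" for w
      proof -
        have "?m \<notin> monoms (y w * q)" for q
        proof
          assume "?m \<in> monoms (y w * q)"
          then obtain n where "?m = Poly_Mapping.single w 2 + n"
            using w by (auto simp: y_def monoms_single_mult)
          then have "coeff ?m w = 2 + coeff n w" by (simp add: lookup_add)
          then show False using finF by (simp add: lookup_expo split: if_splits)
        qed
        moreover have "\<sigma> w * (y w * p (?S - {w})) = y w * (\<sigma> w * p (?S - {w}))" by (simp add: mult.left_commute)
        ultimately show ?thesis by (metis in_keys_iff)
      qed
      then have "coeff (koszul y vs p ?S) ?m = coeff (\<sigma> u * (y u * p F)) ?m"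
        unfolding \<sigma>(2) S_vs lookup_sum using uF finF Su by simp
      also have "\<dots> = s * coeff (y u * p F) ?m" by (simp only: s coeff_s)
      also have "coeff (y u * p F) ?m = coeff (p F) (expo F)"
        using uF by (simp add: m y_def lookup_single_mult)
      finally show ?thesis .
    qed
    have "coeff (c ?S - koszul y vs b ?S) ?m = 0"
    proof (rule ccontr)
      assume "\<not> ?thesis"
      then have "exps ?m \<notin> \<Delta>" using b[of ?S] unfolding nonface_ideal_def by (simp add: in_keys_iff)
      then show False using D(3)[OF u] finF by (simp add: exps_expo)
    qed
    then have eq: "coeff (c ?S) ?m = s * coeff (b F) (expo F)" by (simp add: lookup_minus main)
    have s0: "s \<noteq> 0" by (simp add: s_def)
    show "c ?S = 0 \<longrightarrow> coeff (b F) (expo F) = 0"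
    proof
      assume "c ?S = 0"
      then have "s * coeff (b F) (expo F) = 0" using eq by simp
      then show "coeff (b F) (expo F) = 0" using s0 by simp
    qed
    have "coeff (e F) (expo F) = 1" by (simp add: e_def f_def sqfree_monom_def)
    then show "c ?S = koszul y vs e ?S \<longrightarrow> coeff (b F) (expo F) = 1" using eq s0 main[of e] by auto
  qed
  have "coeff (b F) (expo F) = 1" using key(2)[of a0] assms(5) by (simp add: c_def)
  moreover have "insert b0 F \<inter> A = {}" using assms(3,4,6) by auto
  then have "coeff (b F) (expo F) = 0" using key(1)[of b0] assms(6) by (simp add: c_def)
  ultimately show False by simp
qed

section \<open>Presentations of rings\<close>

text \<open>A surjection from a type-class ring onto a carrier-based ring translates ideals, primes and
  regular sequences into ideals and sequences of the type-class ring.\<close>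

locale ring_presentation = cring R for R (structure) +
  fixes \<phi> :: "'c::comm_ring_1 \<Rightarrow> 'a"
  assumes surj: "\<phi> ` UNIV = carrier R"
    and add: "\<phi> (a + b) = \<phi> a \<oplus> \<phi> b"
    and mult: "\<phi> (a * b) = \<phi> a \<otimes> \<phi> b"
    and one: "\<phi> 1 = \<one>"
begin

definition ker :: "'c set" where "ker = {a. \<phi> a = \<zero>}"

lemma closed [simp]: "\<phi> a \<in> carrier R" using surj by blast

lemma zero [simp]: "\<phi> 0 = \<zero>"
  using add[of 0 0] by (metis add_0 closed add.l_cancel_one')

lemma neg: "\<phi> (- a) = \<ominus> \<phi> a"
  using add[of "- a" a] by (simp add: minus_equality)

lemma eq_iff: "\<phi> a = \<phi> b \<longleftrightarrow> a - b \<in> ker"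
proof
  assume "\<phi> a = \<phi> b"
  then show "a - b \<in> ker" using add[of a "- b"] by (simp add: ker_def neg r_neg)
next
  assume "a - b \<in> ker"
  then show "\<phi> a = \<phi> b" using add[of "a - b" b] by (simp add: ker_def)
qed

lemma ideal_set_ker: "ideal_set ker"
  by (simp add: ideal_set_def ker_def add mult)

lemma vimage_ideal:
  assumes "ideal J R"
  shows "ideal_set (\<phi> -` J)" "ker \<subseteq> \<phi> -` J"
proof -
  interpret J: ideal J R by fact
  show "ideal_set (\<phi> -` J)"
    by (auto simp: ideal_set_def add mult J.I_l_closed)
  show "ker \<subseteq> \<phi> -` J" by (auto simp: ker_def)
qed

lemma vimage_image:
  assumes "ideal_set I" "ker \<subseteq> I"
  shows "\<phi> -` \<phi> ` I = I"
proof
  show "\<phi> -` \<phi> ` I \<subseteq> I"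
  proof
    fix a assume "a \<in> \<phi> -` \<phi> ` I"
    then obtain b where b: "b \<in> I" "\<phi> a = \<phi> b" by auto
    then have "a - b \<in> I" using assms(2) eq_iff by blast
    then show "a \<in> I" using ideal_set_cong_mem[OF assms(1)] b(1) by blast
  qed
qed auto

lemma image_vimage: "J \<subseteq> carrier R \<Longrightarrow> \<phi> ` (\<phi> -` J) = J"
  by (simp add: image_vimage_eq surj inf_absorb1)

lemma image_ideal:
  assumes "ideal_set I"
  shows "ideal (\<phi> ` I) R"
proof (rule idealI[OF ring_axioms])
  show "subgroup (\<phi> ` I) (add_monoid R)"
  proof (rule add.subgroupI)
    show "\<phi> ` I \<subseteq> carrier R" by auto
    show "\<phi> ` I \<noteq> {}" using ideal_setD(1)[OF assms] by blast
    show "\<ominus> a \<in> \<phi> ` I" if "a \<in> \<phi> ` I" for a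
      using that ideal_setD(5)[OF assms] neg by (metis imageE imageI)
    show "a \<oplus> b \<in> \<phi> ` I" if ab: "a \<in> \<phi> ` I" "b \<in> \<phi> ` I" for a b
    proof -
      obtain x y where "x \<in> I" "y \<in> I" "a = \<phi> x" "b = \<phi> y" using ab by blast
      then show ?thesis using ideal_setD(2)[OF assms] add[of x y] by (metis imageI)
    qed
  qed
  show l: "x \<otimes> a \<in> \<phi> ` I" if "a \<in> \<phi> ` I" "x \<in> carrier R" for a x
  proof -
    obtain b y where "a = \<phi> b" "b \<in> I" "x = \<phi> y" using \<open>a \<in> \<phi> ` I\<close> \<open>x \<in> carrier R\<close> surj by blast
    then show ?thesis using ideal_setD(3)[OF assms] mult by (metis imageI)
  qed
  show "a \<otimes> x \<in> \<phi> ` I" if "a \<in> \<phi> ` I" "x \<in> carrier R" for a x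
  proof -
    have "a \<in> carrier R" using that(1) by auto
    then show ?thesis using l[OF that] m_comm that(2) by metis
  qed
qed

lemma genideal_image: "genideal R (\<phi> ` set xs) = \<phi> ` ext_ideals ker xs"
proof
  have "\<phi> ` set xs \<subseteq> \<phi> ` ext_ideals ker xs"
    using ext_ideals_gens[OF ideal_set_ker] by blast
  then show "genideal R (\<phi> ` set xs) \<subseteq> \<phi> ` ext_ideals ker xs"
    by (intro genideal_minimal image_ideal ideal_set_exts ideal_set_ker)
  have id: "ideal (genideal R (\<phi> ` set xs)) R" by (rule genideal_ideal) auto
  have "\<phi> ` set xs \<subseteq> carrier R" by auto
  then have "set xs \<subseteq> \<phi> -` genideal R (\<phi> ` set xs)" using genideal_self by blast
  then have "ext_ideals ker xs \<subseteq> \<phi> -` genideal R (\<phi> ` set xs)"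
    by (intro ext_ideals_least vimage_ideal id)
  then show "\<phi> ` ext_ideals ker xs \<subseteq> genideal R (\<phi> ` set xs)" by blast
qed

lemma mem_genideal: "\<phi> a \<in> genideal R (\<phi> ` set xs) \<longleftrightarrow> a \<in> ext_ideals ker xs"
  using vimage_image[OF ideal_set_exts[OF ideal_set_ker] ext_ideals_superset]
  unfolding genideal_image by blast

text \<open>Ideals generated in \<open>R\<close> pull back to \<open>ext_ideals ker\<close>; the
  condition on 1 is the properness that weak regularity leaves open.\<close>

lemma regular_sequence_iff:
  "regular_sequence R (map \<phi> xs) \<longleftrightarrow> weakly_regular ker xs \<and> 1 \<notin> ext_ideals ker xs"
proof -
  have proper: "genideal R (\<phi> ` set xs) \<noteq> carrier R \<longleftrightarrow> 1 \<notin> ext_ideals ker xs"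
  proof -
    have id: "ideal (genideal R (\<phi> ` set xs)) R" by (rule genideal_ideal) auto
    have "genideal R (\<phi> ` set xs) = carrier R \<longleftrightarrow> \<one> \<in> genideal R (\<phi> ` set xs)"
      using ideal.one_imp_carrier[OF id] by auto
    then show ?thesis using mem_genideal[of 1 xs] by (simp add: one)
  qed
  have ball: "(\<forall>a\<in>carrier R. P a) \<longleftrightarrow> (\<forall>a. P (\<phi> a))" for P using surj by (metis imageE imageI UNIV_I)
  have "(\<forall>i<length (map \<phi> xs). \<forall>a\<in>carrier R.
      map \<phi> xs ! i \<otimes> a \<in> genideal R (set (take i (map \<phi> xs))) \<longrightarrow> a \<in> genideal R (set (take i (map \<phi> xs))))
    \<longleftrightarrow> weakly_regular ker xs"
    unfolding weakly_regular_nth ball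
    by (simp add: take_map mult[symmetric] mem_genideal)
  then show ?thesis unfolding regular_sequence_def using proper by auto
qed

lemma vimage_prime:
  assumes "primeideal P R"
  shows "prime_set (\<phi> -` P)"
proof -
  interpret P: primeideal P R by fact
  have "\<one> \<notin> P" using P.one_imp_carrier P.I_notcarr by blast
  moreover have "a \<in> \<phi> -` P \<or> b \<in> \<phi> -` P" if "a * b \<in> \<phi> -` P" for a b
    using that P.I_prime[of "\<phi> a" "\<phi> b"] by (simp add: mult)
  ultimately show ?thesis
    unfolding prime_set_def using vimage_ideal(1)[OF P.is_ideal] by (auto simp: one)
qed

lemma image_prime:
  assumes "prime_set Q" "ker \<subseteq> Q"
  shows "primeideal (\<phi> ` Q) R"
proof (rule primeidealI)
  have Q: "ideal_set Q" using prime_set_ideal[OF assms(1)] .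
  have mem: "\<phi> a \<in> \<phi> ` Q \<longleftrightarrow> a \<in> Q" for a using vimage_image[OF Q assms(2)] by blast
  show "ideal (\<phi> ` Q) R" using image_ideal[OF Q] .
  show "cring R" by (rule is_cring)
  have "\<one> \<notin> \<phi> ` Q" using mem[of 1] assms(1) by (simp add: one prime_set_def)
  then show "carrier R \<noteq> \<phi> ` Q" by blast
  fix a b assume ab: "a \<in> carrier R" "b \<in> carrier R" "a \<otimes> b \<in> \<phi> ` Q"
  then obtain x y where xy: "a = \<phi> x" "b = \<phi> y" using surj by blast
  then have "x * y \<in> Q" using ab(3) mem[of "x * y"] by (simp add: mult)
  then show "a \<in> \<phi> ` Q \<or> b \<in> \<phi> ` Q" using assms(1) xy mem unfolding prime_set_def by blast
qed

text \<open>Image and preimage are inverse to each other between the primes of \<open>R\<close> and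
  the primes containing the kernel, and they preserve strict inclusion.\<close>

lemma krull_dim_eq: "krull_dim R = Sup {enat n | n. \<exists>P. prime_chain ker n P}"
proof -
  have "(\<exists>P. (\<forall>i\<le>n. primeideal (P i) R) \<and> (\<forall>i<n. P i \<subset> P (Suc i))) \<longleftrightarrow> (\<exists>P. prime_chain ker n P)"
    (is "?L \<longleftrightarrow> ?R") for n
  proof
    assume ?L
    then obtain P where P: "\<And>i. i \<le> n \<Longrightarrow> primeideal (P i) R" "\<And>i. i < n \<Longrightarrow> P i \<subset> P (Suc i)" by blast
    have id: "ideal (P i) R" if "i \<le> n" for i using P(1)[OF that] by (rule primeideal.axioms(1))
    have img: "\<phi> ` (\<phi> -` P i) = P i" if "i \<le> n" for i
      using additive_subgroup.a_subset[OF ideal.axioms(1)[OF id[OF that]]] by (rule image_vimage)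
    have "\<phi> -` P i \<subset> \<phi> -` P (Suc i)" if i: "i < n" for i
    proof
      show "\<phi> -` P i \<subseteq> \<phi> -` P (Suc i)" using P(2)[OF i] by blast
      show "\<phi> -` P i \<noteq> \<phi> -` P (Suc i)"
        using P(2)[OF i] img[of i] img[of "Suc i"] i by (metis Suc_leI less_imp_le psubset_eq)
    qed
    then have "prime_chain ker n (\<lambda>i. \<phi> -` P i)"
      unfolding prime_chain_def using vimage_prime[OF P(1)] vimage_ideal(2)[OF id[of 0]] by blast
    then show ?R by blast
  next
    assume ?R
    then obtain Q where Q: "\<And>i. i \<le> n \<Longrightarrow> prime_set (Q i)" "\<And>i. i < n \<Longrightarrow> Q i \<subset> Q (Suc i)" "ker \<subseteq> Q 0"
      unfolding prime_chain_def by blast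
    have ker: "ker \<subseteq> Q i" if "i \<le> n" for i
      using that
    proof (induction i)
      case (Suc i)
      then show ?case using Q(2)[of i] by auto
    qed (use Q in simp)
    have vim: "\<phi> -` \<phi> ` Q i = Q i" if "i \<le> n" for i
      using vimage_image[OF prime_set_ideal[OF Q(1)[OF that]] ker[OF that]] .
    have "\<phi> ` Q i \<subset> \<phi> ` Q (Suc i)" if i: "i < n" for i
    proof
      show "\<phi> ` Q i \<subseteq> \<phi> ` Q (Suc i)" using Q(2)[OF i] by blast
      show "\<phi> ` Q i \<noteq> \<phi> ` Q (Suc i)"
        using Q(2)[OF i] vim[of i] vim[of "Suc i"] i by (metis Suc_leI less_imp_le psubset_eq)
    qed
    then have "(\<forall>i\<le>n. primeideal (\<phi> ` Q i) R) \<and> (\<forall>i<n. \<phi> ` Q i \<subset> \<phi> ` Q (Suc i))"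
      using image_prime[OF Q(1) ker] by simp
    then show ?L by (intro exI[of _ "\<lambda>i. \<phi> ` Q i"])
  qed
  then show ?thesis unfolding krull_dim_def by simp
qed

end

section \<open>The Stanley--Reisner ring\<close>

lemma polynomial_ring_simps [simp]:
  "carrier (polynomial_ring k V) = {p. \<forall>m\<in>monoms p. exps m \<subseteq> V}"
  "mult (polynomial_ring k V) = (*)" "one (polynomial_ring k V) = 1"
  "zero (polynomial_ring k V) = 0" "add (polynomial_ring k V) = (+)"
  by (simp_all add: polynomial_ring_def)

lemma polynomial_ring_closed:
  fixes p q :: "('v \<Rightarrow>\<^sub>0 nat) \<Rightarrow>\<^sub>0 'k::field"
  assumes "p \<in> carrier (polynomial_ring TYPE('k) V)" "q \<in> carrier (polynomial_ring TYPE('k) V)"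
  shows "p + q \<in> carrier (polynomial_ring TYPE('k) V)" "p * q \<in> carrier (polynomial_ring TYPE('k) V)"
    "- p \<in> carrier (polynomial_ring TYPE('k) V)"
proof -
  show "p + q \<in> carrier (polynomial_ring TYPE('k) V)" using assms keys_add[of p q] by auto
  show "p * q \<in> carrier (polynomial_ring TYPE('k) V)"
    unfolding polynomial_ring_simps
  proof (intro CollectI ballI)
    fix m assume "m \<in> monoms (p * q)"
    then obtain a b where "a \<in> monoms p" "b \<in> monoms q" "m = a + b" by (rule monoms_mult)
    then show "exps m \<subseteq> V" using assms by (simp add: exps_add)
  qed
  show "- p \<in> carrier (polynomial_ring TYPE('k) V)"
    using assms by (simp add: in_keys_iff)
qed

lemma cring_polynomial_ring: "cring (polynomial_ring TYPE('k::field) V)" (is "cring ?P")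
proof (rule cringI)
  show "abelian_group ?P"
  proof (rule abelian_groupI)
    fix p assume "p \<in> carrier ?P"
    then show "\<exists>q\<in>carrier ?P. q \<oplus>\<^bsub>?P\<^esub> p = \<zero>\<^bsub>?P\<^esub>"
      using polynomial_ring_closed(3)[of p V p] by (intro bexI[of _ "- p"]) simp_all
  qed (use polynomial_ring_closed in \<open>auto simp: algebra_simps simp del: polynomial_ring_simps(1)\<close>,
      simp)
  show "comm_monoid ?P"
  proof (rule comm_monoidI)
    show "\<one>\<^bsub>?P\<^esub> \<in> carrier ?P" by simp
  qed (use polynomial_ring_closed in \<open>auto simp: algebra_simps simp del: polynomial_ring_simps(1)\<close>)
qed (simp add: distrib_right)

text \<open>A monomial whose support is a nonface inside \<open>V\<close> is a multiple of the
  generator belonging to that support.\<close>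

lemma stanley_reisner_ideal_eq:
  assumes "finite V" "down_closed \<Delta>"
  shows "stanley_reisner_ideal TYPE('k::field) V \<Delta> =
    carrier (polynomial_ring TYPE('k) V) \<inter> nonface_ideal \<Delta>" (is "_ = carrier ?P \<inter> _")
proof
  interpret P: cring ?P by (rule cring_polynomial_ring)
  let ?G = "{\<Prod>v\<in>A. variable v | A. A \<subseteq> V \<and> A \<notin> \<Delta>} :: (('a \<Rightarrow>\<^sub>0 nat) \<Rightarrow>\<^sub>0 'k) set"
  have finA: "finite A" if "A \<subseteq> V" for A using that assms(1) finite_subset by blast
  have I: "ideal_set (nonface_ideal \<Delta> :: (_ \<Rightarrow>\<^sub>0 'k) set)" by (rule ideal_set_nonface[OF assms(2)])
  have G: "?G \<subseteq> carrier ?P \<inter> nonface_ideal \<Delta>"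
    using finA by (auto simp: prod_variable sqfree_in_nonface_ideal sqfree_monom_def exps_expo single_in_nonface_ideal)
  have "ideal (carrier ?P \<inter> nonface_ideal \<Delta>) ?P"
  proof (rule idealI[OF P.ring_axioms])
    show "subgroup (carrier ?P \<inter> nonface_ideal \<Delta>) (add_monoid ?P)"
    proof (rule P.add.subgroupI)
      have "0 \<in> carrier ?P \<inter> nonface_ideal \<Delta>" using ideal_setD(1)[OF I] by simp
      then show "carrier ?P \<inter> nonface_ideal \<Delta> \<noteq> {}" by blast
      fix p assume p: "p \<in> carrier ?P \<inter> nonface_ideal \<Delta>"
      then have "\<ominus>\<^bsub>?P\<^esub> p = - p"
        using polynomial_ring_closed(3)[of p V p] by (intro P.minus_equality) simp_all
      then show "\<ominus>\<^bsub>?P\<^esub> p \<in> carrier ?P \<inter> nonface_ideal \<Delta>"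
        using p polynomial_ring_closed(3)[of p V p] ideal_setD(5)[OF I] by simp
      fix q assume "q \<in> carrier ?P \<inter> nonface_ideal \<Delta>"
      then show "p \<oplus>\<^bsub>?P\<^esub> q \<in> carrier ?P \<inter> nonface_ideal \<Delta>"
        using p polynomial_ring_closed(1)[of p V q] ideal_setD(2)[OF I] by simp
    qed auto
  qed (use polynomial_ring_closed(2) ideal_setD(3,4)[OF I] in \<open>auto simp del: polynomial_ring_simps(1)\<close>)
  then show "stanley_reisner_ideal TYPE('k) V \<Delta> \<subseteq> carrier ?P \<inter> nonface_ideal \<Delta>"
    unfolding stanley_reisner_ideal_def using G by (rule P.genideal_minimal)
  have GP: "?G \<subseteq> carrier ?P" using G by blast
  interpret J: ideal "stanley_reisner_ideal TYPE('k) V \<Delta>" ?P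
    unfolding stanley_reisner_ideal_def by (rule P.genideal_ideal[OF GP])
  show "carrier ?P \<inter> nonface_ideal \<Delta> \<subseteq> stanley_reisner_ideal TYPE('k) V \<Delta>"
  proof
    fix p assume p: "p \<in> carrier ?P \<inter> nonface_ideal \<Delta>"
    have "(\<Sum>m\<in>M. Poly_Mapping.single m (coeff p m)) \<in> stanley_reisner_ideal TYPE('k) V \<Delta>"
      if "finite M" "M \<subseteq> monoms p" for M
      using that
    proof (induction M rule: finite_induct)
      case empty
      then show ?case using J.zero_closed by simp
    next
      case (insert m M)
      then have m: "exps m \<subseteq> V" "exps m \<notin> \<Delta>" using p by (auto simp: nonface_ideal_def)
      have "m = expo (exps m) + (m - expo (exps m))"
        by (intro poly_mapping_eqI) (simp add: lookup_add lookup_minus lookup_expo in_keys_iff)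
      then have eq: "Poly_Mapping.single m (coeff p m) =
          Poly_Mapping.single (m - expo (exps m)) (coeff p m) * (\<Prod>v\<in>exps m. variable v)"
        by (simp add: prod_variable sqfree_monom_def mult_single add.commute)
      have "(\<Prod>v\<in>exps m. variable v) \<in> ?G" using m by blast
      then have "(\<Prod>v\<in>exps m. variable v) \<in> stanley_reisner_ideal TYPE('k) V \<Delta>"
        using P.genideal_self[OF GP] unfolding stanley_reisner_ideal_def by blast
      moreover have "exps (m - expo (exps m)) \<subseteq> exps m" by (auto simp: in_keys_iff lookup_minus)
      then have "Poly_Mapping.single (m - expo (exps m)) (coeff p m) \<in> carrier ?P" using m(1) by auto
      ultimately have "Poly_Mapping.single m (coeff p m) \<in> stanley_reisner_ideal TYPE('k) V \<Delta>"
        unfolding eq using J.I_l_closed by (metis polynomial_ring_simps(2))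
      then show ?case
        using insert J.a_closed[of "Poly_Mapping.single m (coeff p m)"
            "\<Sum>m\<in>M. Poly_Mapping.single m (coeff p m)"] by simp
    qed
    from this[of "monoms p"] show "p \<in> stanley_reisner_ideal TYPE('k) V \<Delta>"
      using poly_expansion[of p] by simp
  qed
qed

text \<open>The retraction that sets the variables outside \<open>V\<close> to 0. It turns the ring
  in all variables of the type into a presentation of the carrier-based one.\<close>

definition restrict_vars :: "'v set \<Rightarrow> (('v \<Rightarrow>\<^sub>0 nat) \<Rightarrow>\<^sub>0 'k::field) \<Rightarrow> ('v \<Rightarrow>\<^sub>0 nat) \<Rightarrow>\<^sub>0 'k" where
  "restrict_vars V p = (\<Sum>m | m \<in> monoms p \<and> exps m \<subseteq> V. Poly_Mapping.single m (coeff p m))"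

lemma coeff_restrict_vars: "coeff (restrict_vars V p) m = (if exps m \<subseteq> V then coeff p m else 0)"
proof -
  have "coeff (restrict_vars V p) m =
      (\<Sum>n | n \<in> monoms p \<and> exps n \<subseteq> V. if n = m then coeff p n else 0)"
    by (simp add: restrict_vars_def lookup_sum lookup_single when_def)
  also have "\<dots> = (if exps m \<subseteq> V then coeff p m else 0)" by (simp add: in_keys_iff)
  finally show ?thesis .
qed

lemma restrict_vars_unique:
  assumes "q \<in> carrier (polynomial_ring TYPE('k::field) V)" "p - q \<in> nonface_ideal (Pow V)"
  shows "restrict_vars V p = q"
proof (rule poly_mapping_eqI)
  fix m
  show "coeff (restrict_vars V p) m = coeff q m"
  proof (cases "exps m \<subseteq> V")
    case True
    then have "m \<notin> monoms (p - q)" using assms(2) by (auto simp: nonface_ideal_def)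
    then show ?thesis using True by (simp add: coeff_restrict_vars in_keys_iff lookup_minus)
  next
    case False
    then have "m \<notin> monoms q" using assms(1) by auto
    then show ?thesis using False by (simp add: coeff_restrict_vars in_keys_iff)
  qed
qed

lemma restrict_vars_closed: "restrict_vars V p \<in> carrier (polynomial_ring TYPE('k::field) V)"
proof -
  have "exps m \<subseteq> V" if "m \<in> monoms (restrict_vars V p)" for m
  proof (rule ccontr)
    assume "\<not> exps m \<subseteq> V"
    then show False using that by (simp add: in_keys_iff coeff_restrict_vars)
  qed
  then show ?thesis by simp
qed

lemma restrict_vars_diff: "p - restrict_vars V p \<in> nonface_ideal (Pow V)"
  by (auto simp: nonface_ideal_def in_keys_iff coeff_restrict_vars lookup_minus)

lemma restrict_vars_id:
  "p \<in> carrier (polynomial_ring TYPE('k::field) V) \<Longrightarrow> restrict_vars V p = p"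
  by (rule restrict_vars_unique) (simp_all add: nonface_ideal_def)

definition sr_proj :: "'v set \<Rightarrow> 'v set set \<Rightarrow> (('v \<Rightarrow>\<^sub>0 nat) \<Rightarrow>\<^sub>0 'k::field) \<Rightarrow> (('v \<Rightarrow>\<^sub>0 nat) \<Rightarrow>\<^sub>0 'k) set" where
  "sr_proj V \<Delta> p =
     stanley_reisner_ideal TYPE('k) V \<Delta> +>\<^bsub>polynomial_ring TYPE('k) V\<^esub> restrict_vars V p"

locale stanley_reisner =
  fixes k :: "'k::field itself" and V :: "'v set" and \<Delta> :: "'v set set"
  assumes finite_V: "finite V" and sub_V: "\<Delta> \<subseteq> Pow V" and closed_\<Delta>: "down_closed \<Delta>"
begin

abbreviation "P \<equiv> polynomial_ring TYPE('k) V"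
abbreviation "I \<equiv> stanley_reisner_ideal TYPE('k) V \<Delta>"
abbreviation "K \<equiv> nonface_ideal \<Delta> :: (('v \<Rightarrow>\<^sub>0 nat) \<Rightarrow>\<^sub>0 'k) set"
abbreviation "proj \<equiv> sr_proj V \<Delta> :: (('v \<Rightarrow>\<^sub>0 nat) \<Rightarrow>\<^sub>0 'k) \<Rightarrow> _"

lemma ideal_I: "ideal I P"
proof -
  interpret P: cring P by (rule cring_polynomial_ring)
  have "{\<Prod>v\<in>A. variable v | A. A \<subseteq> V \<and> A \<notin> \<Delta>} \<subseteq> carrier P"
    using finite_V by (auto simp: prod_variable sqfree_monom_def exps_expo finite_subset)
  then show ?thesis unfolding stanley_reisner_ideal_def by (rule P.genideal_ideal)
qed

sublocale ring_presentation "stanley_reisner_ring TYPE('k) V \<Delta>" proj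
proof (intro ring_presentation.intro ring_presentation_axioms.intro)
  interpret P: cring P by (rule cring_polynomial_ring)
  interpret I: ideal I P by (rule ideal_I)
  interpret Q: cring "stanley_reisner_ring TYPE('k) V \<Delta>"
    unfolding stanley_reisner_ring_def by (rule I.quotient_is_cring[OF cring_polynomial_ring])
  show "cring (stanley_reisner_ring TYPE('k) V \<Delta>)" by (rule Q.is_cring)
  have hom: "(+>\<^bsub>P\<^esub>) I \<in> ring_hom P (stanley_reisner_ring TYPE('k) V \<Delta>)"
    unfolding stanley_reisner_ring_def by (rule I.rcos_ring_hom)
  have N: "ideal_set (nonface_ideal (Pow V) :: (('v \<Rightarrow>\<^sub>0 nat) \<Rightarrow>\<^sub>0 'k) set)"
    by (rule ideal_set_nonface) (auto simp: down_closed_def)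
  have radd: "restrict_vars V (a + b) = restrict_vars V a + restrict_vars V b"
    for a b :: "('v \<Rightarrow>\<^sub>0 nat) \<Rightarrow>\<^sub>0 'k"
    by (rule poly_mapping_eqI) (simp add: coeff_restrict_vars lookup_add)
  have rmult: "restrict_vars V (a * b) = restrict_vars V a * restrict_vars V b"
    for a b :: "('v \<Rightarrow>\<^sub>0 nat) \<Rightarrow>\<^sub>0 'k"
  proof (rule restrict_vars_unique)
    show "restrict_vars V a * restrict_vars V b \<in> carrier P"
      by (rule polynomial_ring_closed(2)[OF restrict_vars_closed restrict_vars_closed])
    have "a * b - restrict_vars V a * restrict_vars V b =
        (a - restrict_vars V a) * b + restrict_vars V a * (b - restrict_vars V b)"
      by (simp add: algebra_simps)
    also have "\<dots> \<in> nonface_ideal (Pow V)"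
      by (intro ideal_setD(2)[OF N] ideal_setD(3)[OF N] ideal_setD(4)[OF N] restrict_vars_diff)
    finally show "a * b - restrict_vars V a * restrict_vars V b \<in> nonface_ideal (Pow V)" .
  qed
  show "proj ` UNIV = carrier (stanley_reisner_ring TYPE('k) V \<Delta>)"
  proof
    show "proj ` UNIV \<subseteq> carrier (stanley_reisner_ring TYPE('k) V \<Delta>)"
      unfolding sr_proj_def using ring_hom_closed[OF hom restrict_vars_closed] by blast
    show "carrier (stanley_reisner_ring TYPE('k) V \<Delta>) \<subseteq> proj ` UNIV"
    proof
      fix C assume "C \<in> carrier (stanley_reisner_ring TYPE('k) V \<Delta>)"
      then obtain q where "q \<in> carrier P" "C = I +>\<^bsub>P\<^esub> q"
        by (auto simp: stanley_reisner_ring_def FactRing_def A_RCOSETS_def' simp del: polynomial_ring_simps)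
      then have "C = proj q" by (simp add: sr_proj_def restrict_vars_id del: polynomial_ring_simps)
      then show "C \<in> proj ` UNIV" by blast
    qed
  qed
  fix a b
  show "proj (a + b) = proj a \<oplus>\<^bsub>stanley_reisner_ring TYPE('k) V \<Delta>\<^esub> proj b"
    unfolding sr_proj_def radd
    using ring_hom_add[OF hom restrict_vars_closed restrict_vars_closed] by simp
  show "proj (a * b) = proj a \<otimes>\<^bsub>stanley_reisner_ring TYPE('k) V \<Delta>\<^esub> proj b"
    unfolding sr_proj_def rmult
    using ring_hom_mult[OF hom restrict_vars_closed restrict_vars_closed] by simp
  have "restrict_vars V (1 :: ('v \<Rightarrow>\<^sub>0 nat) \<Rightarrow>\<^sub>0 'k) = 1" by (rule restrict_vars_id) simp
  then show "proj 1 = \<one>\<^bsub>stanley_reisner_ring TYPE('k) V \<Delta>\<^esub>"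
    unfolding sr_proj_def using ring_hom_one[OF hom] by simp
qed

text \<open>As \<Delta> lies in \<open>Pow V\<close>, a monomial with a variable outside
  \<open>V\<close> is supported on a nonface, so the retraction changes nothing modulo
  \<open>K\<close>.\<close>

lemma ker_eq: "ker = K"
proof -
  interpret P: cring P by (rule cring_polynomial_ring)
  interpret I: ideal I P by (rule ideal_I)
  have KI: "ideal_set K" by (rule ideal_set_nonface[OF closed_\<Delta>])
  have "p \<in> ker \<longleftrightarrow> p \<in> K" for p
  proof -
    have "\<zero>\<^bsub>stanley_reisner_ring TYPE('k) V \<Delta>\<^esub> = I"
      by (simp add: stanley_reisner_ring_def FactRing_def)
    then have "p \<in> ker \<longleftrightarrow> I +>\<^bsub>P\<^esub> restrict_vars V p = I"
      by (simp add: ker_def sr_proj_def)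
    also have "\<dots> \<longleftrightarrow> restrict_vars V p \<in> I"
      using I.rcos_const_imp_mem[OF restrict_vars_closed] I.a_rcos_const by metis
    also have "\<dots> \<longleftrightarrow> restrict_vars V p \<in> K"
      using stanley_reisner_ideal_eq[OF finite_V closed_\<Delta>, where 'k = 'k] restrict_vars_closed by blast
    also have "\<dots> \<longleftrightarrow> p \<in> K"
      using restrict_vars_diff[of p V] nonface_ideal_antimono[OF sub_V] ideal_set_cong_mem[OF KI] by blast
    finally show ?thesis .
  qed
  then show ?thesis by blast
qed

section \<open>The graded maximal ideal and criteria for the Cohen-Macaulay property\<close>

lemma graded_maximal_ideal_eq:
  "graded_maximal_ideal TYPE('k) V \<Delta> =
    genideal (stanley_reisner_ring TYPE('k) V \<Delta>) (proj ` variable ` V)"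
proof -
  have "proj (variable v) = I +>\<^bsub>P\<^esub> variable v" if "v \<in> V" for v
  proof -
    have "restrict_vars V (variable v :: _ \<Rightarrow>\<^sub>0 'k) = variable v"
      using that by (intro restrict_vars_id) (simp add: variable_def)
    then show ?thesis by (simp add: sr_proj_def)
  qed
  then have "{I +>\<^bsub>P\<^esub> variable v | v. v \<in> V} = proj ` variable ` V"
    by (auto simp: image_iff)
  then show ?thesis unfolding graded_maximal_ideal_def by simp
qed

text \<open>The ideal \<open>nonface_ideal {{}}\<close> consists of the polynomials without constant
  term, and its image contains the classes of all variables in \<open>V\<close>. Such
  representatives are what the depth bound for a gap asks for.\<close>

lemma graded_maximal_ideal_elem:
  assumes "{} \<in> \<Delta>" "x \<in> graded_maximal_ideal TYPE('k) V \<Delta>"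
  shows "\<exists>p. x = proj p \<and> coeff p 0 = 0"
proof -
  let ?M = "nonface_ideal {{}} :: (('v \<Rightarrow>\<^sub>0 nat) \<Rightarrow>\<^sub>0 'k) set"
  have M: "ideal_set ?M" by (rule ideal_set_nonface) (auto simp: down_closed_def)
  have "variable ` V \<subseteq> ?M" by (auto simp: variable_def single_in_nonface_ideal)
  then have "graded_maximal_ideal TYPE('k) V \<Delta> \<subseteq> proj ` ?M"
    unfolding graded_maximal_ideal_eq by (intro genideal_minimal image_ideal[OF M]) blast
  then obtain p where p: "x = proj p" "p \<in> ?M" using assms(2) by blast
  then have "0 \<notin> monoms p" by (auto simp: nonface_ideal_def)
  then show ?thesis using p(1) by (auto simp: in_keys_iff)
qed

lemma elem_sym_in_graded_maximal_ideal:
  assumes "d \<ge> 1"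
  shows "proj (elem_sym V d) \<in> graded_maximal_ideal TYPE('k) V \<Delta>"
proof -
  let ?gm = "graded_maximal_ideal TYPE('k) V \<Delta>"
  have id: "ideal ?gm (stanley_reisner_ring TYPE('k) V \<Delta>)"
    unfolding graded_maximal_ideal_eq by (rule genideal_ideal) auto
  have "proj ` variable ` V \<subseteq> carrier (stanley_reisner_ring TYPE('k) V \<Delta>)" by auto
  then have sub: "proj ` variable ` V \<subseteq> ?gm"
    unfolding graded_maximal_ideal_eq by (rule genideal_self)
  have gens: "variable v \<in> proj -` ?gm" if "v \<in> V" for v
    using subsetD[OF sub, of "proj (variable v)"] that by simp
  have J: "ideal_set (proj -` ?gm)" by (rule vimage_ideal(1)[OF id])
  have "sqfree_monom B \<in> proj -` ?gm" if B: "B \<subseteq> V" "card B = d" for B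
  proof -
    have "finite B" "B \<noteq> {}" using B finite_V assms finite_subset by auto
    then obtain v where v: "v \<in> B" by blast
    then have "sqfree_monom B = (variable v :: _ \<Rightarrow>\<^sub>0 'k) * (\<Prod>w\<in>B - {v}. variable w)"
      using prod.remove[OF \<open>finite B\<close> v, of "variable :: _ \<Rightarrow> _ \<Rightarrow>\<^sub>0 'k"] prod_variable[OF \<open>finite B\<close>] by metis
    then show ?thesis using ideal_setD(4)[OF J gens] v B(1) by (metis subsetD)
  qed
  then have "elem_sym V d \<in> proj -` ?gm"
    unfolding elem_sym_def by (intro ideal_set_sum[OF J]) auto
  then show ?thesis by simp
qed

text \<open>In the zero ring no ideal is proper, so there are no primes and not even the empty list
  is a regular sequence; both suprema are taken over the empty set.\<close>

lemma cohen_macaulay_void: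
  assumes "\<Delta> = {}"
  shows "cohen_macaulay TYPE('k) V \<Delta>"
proof -
  have K: "ker = UNIV" unfolding ker_eq using assms by (simp add: nonface_ideal_def)
  have "\<not> prime_chain ker n Q" for n and Q :: "nat \<Rightarrow> (('v \<Rightarrow>\<^sub>0 nat) \<Rightarrow>\<^sub>0 'k) set"
    unfolding K prime_chain_def prime_set_def by blast
  then have "krull_dim (stanley_reisner_ring TYPE('k) V \<Delta>) = Sup {}" by (simp add: krull_dim_eq)
  moreover have "\<not> regular_sequence (stanley_reisner_ring TYPE('k) V \<Delta>) ys" for ys
  proof
    assume reg: "regular_sequence (stanley_reisner_ring TYPE('k) V \<Delta>) ys"
    then have "set ys \<subseteq> proj ` UNIV" unfolding surj by (simp add: regular_sequence_def)
    then obtain xs where "ys = map proj xs" by (metis ex_map_conv subset_iff rangeE)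
    then have "1 \<notin> ext_ideals ker xs" using reg regular_sequence_iff by blast
    then show False using ext_ideals_superset[of ker xs] K by blast
  qed
  then have "depth (stanley_reisner_ring TYPE('k) V \<Delta>) (graded_maximal_ideal TYPE('k) V \<Delta>) = Sup {}"
    by (simp add: depth_def)
  ultimately show ?thesis by (simp add: cohen_macaulay_def)
qed

text \<open>A closed circle of inequalities: the symmetric functions give depth at least
  \<open>d\<close>, regular sequences yield chains of primes, and counting bounds such chains by
  \<open>d\<close>.\<close>

lemma cohen_macaulay_shelling:
  assumes "shelling Fs" "Fs \<noteq> []" "\<Delta> = generated_complex (set Fs)" "\<And>F. F \<in> set Fs \<Longrightarrow> card F = d"
  shows "cohen_macaulay TYPE('k) V \<Delta>"
proof -
  let ?R = "stanley_reisner_ring TYPE('k) V \<Delta>" and ?gm = "graded_maximal_ideal TYPE('k) V \<Delta>"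
  let ?es = "elem_syms V d :: (('v \<Rightarrow>\<^sub>0 nat) \<Rightarrow>\<^sub>0 'k) list"
  have FV: "F \<subseteq> V" if "F \<in> set Fs" for F using that sub_V assms(3) by (auto simp: generated_complex_def)
  have emp: "{} \<in> \<Delta>" using assms(2,3) by (auto simp: generated_complex_def neq_Nil_conv)
  have KI: "ideal_set K" by (rule ideal_set_nonface[OF closed_\<Delta>])
  have card_le: "card A \<le> d" if A: "A \<in> \<Delta>" for A
  proof -
    obtain F where F: "F \<in> set Fs" "A \<subseteq> F" using A assms(3) by (auto simp: generated_complex_def)
    then have "card A \<le> card F" using FV finite_V by (meson card_mono finite_subset)
    then show ?thesis using assms(4) F(1) by simp
  qed
  have "weakly_regular K ?es"
    unfolding assms(3)
    by (rule elem_syms_regular_shelling[OF finite_V assms(1,2)]) (simp add: FV assms(4))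
  then have reg: "weakly_regular ker ?es" unfolding ker_eq .
  have es: "\<exists>e. p = elem_sym V e \<and> e \<ge> 1" if "p \<in> set (elem_syms V n)" for n and p :: "('v \<Rightarrow>\<^sub>0 nat) \<Rightarrow>\<^sub>0 'k"
    using that by (induction n) auto
  have "1 \<notin> ext_ideals ker ?es"
  proof
    let ?M = "nonface_ideal {{}} :: (('v \<Rightarrow>\<^sub>0 nat) \<Rightarrow>\<^sub>0 'k) set"
    have M: "ideal_set ?M" by (rule ideal_set_nonface) (auto simp: down_closed_def)
    assume one: "1 \<in> ext_ideals ker ?es"
    have "p \<in> ?M" if "p \<in> set ?es" for p
    proof -
      have p0: "coeff p 0 = 0" using es[OF that] elem_sym_constant_term[OF finite_V] by auto
      have "exps m \<noteq> {}" if "m \<in> monoms p" for m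
        using that p0 by (metis in_keys_iff keys_eq_empty)
      then show ?thesis by (simp add: nonface_ideal_def)
    qed
    then have "ext_ideals ker ?es \<subseteq> ?M"
      unfolding ker_eq using emp by (intro ext_ideals_least[OF M] nonface_ideal_antimono) auto
    then show False using one by (auto simp: nonface_ideal_def)
  qed
  then have "regular_sequence ?R (map proj ?es)" using reg regular_sequence_iff by blast
  moreover have "set (map proj ?es) \<subseteq> ?gm"
    using es elem_sym_in_graded_maximal_ideal by force
  ultimately have "enat d \<le> depth ?R ?gm"
    unfolding depth_def
    by (intro Sup_upper CollectI exI[of _ "map proj ?es"]) (simp add: length_elem_syms)
  moreover have "krull_dim ?R \<le> enat d"
    unfolding krull_dim_eq ker_eq
    by (rule Sup_least) (use prime_chain_length_le[OF finite_V sub_V card_le] in auto)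
  moreover have "depth ?R ?gm \<le> krull_dim ?R"
    unfolding depth_def
  proof (rule Sup_least)
    fix x assume "x \<in> {enat (length ys) |ys. regular_sequence ?R ys \<and> set ys \<subseteq> ?gm}"
    then obtain ys where ys: "x = enat (length ys)" "regular_sequence ?R ys" by blast
    then have "set ys \<subseteq> proj ` UNIV" unfolding surj by (simp add: regular_sequence_def)
    then obtain xs where xs: "ys = map proj xs" by (metis ex_map_conv subset_iff rangeE)
    then obtain Q where "prime_chain ker (length xs) Q"
      using prime_chain_of_weakly_regular[OF ideal_set_ker] ys(2) regular_sequence_iff by blast
    then show "x \<le> krull_dim ?R" unfolding krull_dim_eq using ys(1) xs by (intro Sup_upper) auto
  qed
  ultimately show ?thesis unfolding cohen_macaulay_def by (meson order_antisym order_trans)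
qed

text \<open>The depth is at most \<open>|F| + 1 < |E|\<close>, while the face \<open>E\<close>
  carries a chain of primes of length \<open>|E|\<close>.\<close>

lemma not_cohen_macaulay_gap:
  assumes "V = F \<union> A \<union> B" "F \<inter> (A \<union> B) = {}" "A \<inter> B = {}" "A \<noteq> {}" "B \<noteq> {}"
    and "\<And>u. u \<in> A \<union> B \<Longrightarrow> insert u F \<in> \<Delta>"
    and "\<And>a b. a \<in> A \<Longrightarrow> b \<in> B \<Longrightarrow> insert a (insert b F) \<notin> \<Delta>"
    and E: "E \<in> \<Delta>" "Suc (card F) < card E"
  shows "\<not> cohen_macaulay TYPE('k) V \<Delta>"
proof -
  let ?R = "stanley_reisner_ring TYPE('k) V \<Delta>" and ?gm = "graded_maximal_ideal TYPE('k) V \<Delta>"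
  obtain a0 b0 where ab: "a0 \<in> A" "b0 \<in> B" using assms(4,5) by blast
  have emp: "{} \<in> \<Delta>" using E(1) closed_\<Delta> unfolding down_closed_def by blast
  have "depth ?R ?gm \<le> enat (Suc (card F))"
    unfolding depth_def
  proof (rule Sup_least)
    fix x assume "x \<in> {enat (length ys) |ys. regular_sequence ?R ys \<and> set ys \<subseteq> ?gm}"
    then obtain ys where ys: "x = enat (length ys)" "regular_sequence ?R ys" "set ys \<subseteq> ?gm" by blast
    have "\<forall>y\<in>set ys. \<exists>p. y = proj p \<and> coeff p 0 = 0"
      using graded_maximal_ideal_elem[OF emp] ys(3) by blast
    then obtain g where g: "\<And>y. y \<in> set ys \<Longrightarrow> y = proj (g y) \<and> coeff (g y) 0 = 0" by metis
    let ?xs = "map g ys"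
    have "map proj ?xs = ys" using g by (simp add: map_idI)
    then have reg: "weakly_regular K ?xs" using regular_sequence_iff[of ?xs] ys(2) ker_eq by simp
    have "length ?xs \<le> Suc (card F)"
    proof (rule weakly_regular_length_gap[OF finite_V assms(1-3) ab closed_\<Delta> sub_V _ _ reg])
      show "coeff \<theta> 0 = 0" if "\<theta> \<in> set ?xs" for \<theta> using that g by auto
    qed (use assms(6,7) in blast)+
    then show "x \<le> enat (Suc (card F))" using ys(1) by simp
  qed
  also have "\<dots> < enat (card E)" using E(2) by simp
  also have "\<dots> \<le> krull_dim ?R"
  proof -
    have "finite E" using E(1) sub_V finite_V finite_subset by blast
    then obtain Q where "prime_chain ker (card E) Q"
      unfolding ker_eq using prime_chain_of_face[OF closed_\<Delta> E(1), where 'k = 'k] by blast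
    then show ?thesis unfolding krull_dim_eq by (intro Sup_upper) auto
  qed
  finally show ?thesis unfolding cohen_macaulay_def by simp
qed

end

section \<open>The equivalence\<close>

lemma stanley_reisner_Sigma:
  assumes "finite (verts G)"
  shows "stanley_reisner (verts G) (Sigma_complex r G)"
  using Sigma_complex_finite[OF assms] assms
  by (intro stanley_reisner.intro) (auto simp: down_closed_def)

lemma finite_face_Sigma_complex:
  "finite (verts G) \<Longrightarrow> A \<in> Sigma_complex r G \<Longrightarrow> finite A"
  using Sigma_complex_finite(2) finite_subset by metis

lemma cohen_macaulay_of_shellable_Sigma:
  assumes "finite (verts G)" "shellable (Sigma_complex r G)"
  shows "cohen_macaulay TYPE('k::field) (verts G) (Sigma_complex r G)"
proof -
  interpret stanley_reisner "TYPE('k)" "verts G" "Sigma_complex r G"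
    by (rule stanley_reisner_Sigma[OF assms(1)])
  obtain Fs where Fs: "set Fs = facets (Sigma_complex r G)" "shelling Fs"
    using shellable_iff_shelling[OF Sigma_complex_finite(1)[OF assms(1), of r] finite_face_Sigma_complex[OF assms(1), of _ r]] assms by blast
  have gen: "Sigma_complex r G = generated_complex (set Fs)"
    unfolding Fs(1) facets_Sigma_complex(1)[OF assms(1)] by (simp add: Sigma_complex_def)
  show ?thesis
  \<comment> \<open>An empty list of facets means that \<open>G\<close> has no connected r-set, and
    the complex is void.\<close>
  proof (cases "Fs = []")
    case True
    then show ?thesis using gen by (intro cohen_macaulay_void) (simp add: generated_complex_def)
  next
    case False
    then show ?thesis
      using cohen_macaulay_shelling[OF Fs(2) False gen] facets_Sigma_complex(2)[OF assms(1)] Fs(1) by blast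
  qed
qed

lemma gap_free_of_cohen_macaulay_Sigma:
  assumes "graph G" "r \<ge> 2" "cohen_macaulay TYPE('k::field) (verts G) (Sigma_complex r G)"
  shows "gap_free r G"
proof (rule ccontr)
  assume "\<not> gap_free r G"
  then obtain A B where AB: "A \<in> Con r G" "B \<in> Con r G" "A \<inter> B = {}"
    "\<And>C. C \<in> Con r G \<Longrightarrow> C \<subseteq> A \<union> B \<Longrightarrow> C = A \<or> C = B"
    using gap_obtain assms by metis
  have fin: "finite (verts G)" using graph_arcs_ends(3)[OF assms(1)] .
  interpret stanley_reisner "TYPE('k)" "verts G" "Sigma_complex r G"
    by (rule stanley_reisner_Sigma[OF fin])
  let ?F = "verts G - (A \<union> B)"
  have sub: "A \<subseteq> verts G" "B \<subseteq> verts G" "card A = r" "card B = r" "finite A" "finite B"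
    using AB fin by (auto simp: Con_def intro: finite_subset)
  have mem: "X \<in> Sigma_complex r G \<longleftrightarrow> (\<exists>W\<in>Con r G. X \<subseteq> verts G - W)" for X
    by (auto simp: Sigma_complex_def generated_complex_def)
  have "card (A \<union> B) = 2 * r" using sub AB(3) by (simp add: card_Un_disjoint)
  moreover have "card (A \<union> B) \<le> card (verts G)" using sub fin by (intro card_mono) auto
  ultimately have card: "card ?F = card (verts G) - 2 * r" "2 * r \<le> card (verts G)"
    using sub by (simp_all add: card_Diff_subset)
  have "\<not> cohen_macaulay TYPE('k) (verts G) (Sigma_complex r G)"
  proof (rule not_cohen_macaulay_gap)
    show "verts G = ?F \<union> A \<union> B" "?F \<inter> (A \<union> B) = {}" using sub by auto
    show "A \<noteq> {}" "B \<noteq> {}" using sub assms(2) by auto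
    show "insert u ?F \<in> Sigma_complex r G" if u: "u \<in> A \<union> B" for u
    proof (cases "u \<in> A")
      case True
      then have "insert u ?F \<subseteq> verts G - B" using sub AB(3) by auto
      then show ?thesis using mem AB(2) by blast
    next
      case False
      then have "insert u ?F \<subseteq> verts G - A" using sub u by auto
      then show ?thesis using mem AB(1) by blast
    qed
    \<comment> \<open>Such a face would avoid a connected r-set contained in
      \<open>A \<union> B\<close> but missing \<open>a\<close> and \<open>b\<close>, hence different
      from \<open>A\<close> and \<open>B\<close>.\<close>
    show "insert a (insert b ?F) \<notin> Sigma_complex r G" if ab: "a \<in> A" "b \<in> B" for a b
    proof
      assume "insert a (insert b ?F) \<in> Sigma_complex r G"
      then obtain W where W: "W \<in> Con r G" "insert a (insert b ?F) \<subseteq> verts G - W" using mem by blast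
      then have "W \<subseteq> A \<union> B" "a \<notin> W" "b \<notin> W" by (auto simp: Con_def)
      then show False using AB(4)[OF W(1)] ab by blast
    qed
    show "verts G - A \<in> Sigma_complex r G" using mem AB(1) by blast
    have "card (verts G - A) = card (verts G) - r" using sub by (simp add: card_Diff_subset)
    then show "Suc (card ?F) < card (verts G - A)" using card assms(2) by linarith
  qed (rule AB(3))
  then show False using assms(3) by blast
qed

theorem theorem4p1:
  fixes G :: "('v, 'e) pre_digraph" and r :: nat
  assumes "graph G" and "chordal_graph G" and "r \<ge> 2"
  shows "(vertex_decomposable (Sigma_complex r G) \<longleftrightarrow> shellable (Sigma_complex r G)) \<and>
         (shellable (Sigma_complex r G) \<longleftrightarrow>
            cohen_macaulay TYPE('k::field) (verts G) (Sigma_complex r G)) \<and>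
         (cohen_macaulay TYPE('k) (verts G) (Sigma_complex r G) \<longleftrightarrow> gap_free r G) \<and>
         (gap_free r G \<longleftrightarrow> cochordal_clutter r (verts G) (Con r G))"
proof -
  have fin: "finite (verts G)" using graph_arcs_ends(3)[OF assms(1)] .
  have "shellable (Sigma_complex r G)" if "vertex_decomposable (Sigma_complex r G)"
    by (rule shellable_of_vertex_decomposable[OF that Sigma_complex_finite(1)[OF fin]
          finite_face_Sigma_complex[OF fin] Sigma_complex_finite(3)[OF fin]])
  moreover have "cohen_macaulay TYPE('k) (verts G) (Sigma_complex r G)" if "shellable (Sigma_complex r G)"
    using cohen_macaulay_of_shellable_Sigma[OF fin that] .
  moreover have "gap_free r G" if "cohen_macaulay TYPE('k) (verts G) (Sigma_complex r G)"
    using gap_free_of_cohen_macaulay_Sigma[OF assms(1,3) that] .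
  moreover have "vertex_decomposable (Sigma_complex r G)" if "gap_free r G"
    using vertex_decomposable_of_decomposable_clutter[OF decomposable_Con[OF assms that]]
    by (simp add: Sigma_complex_def)
  moreover have "cochordal_clutter r (verts G) (Con r G)" if "gap_free r G"
    using cochordal_of_decomposable_clutter[OF decomposable_Con[OF assms that]] assms(3) by simp
  moreover have "gap_free r G" if "cochordal_clutter r (verts G) (Con r G)"
    using gap_free_of_cochordal_Con[OF assms(1,3) that] .
  \<comment> \<open>The first four conditions form a cycle, from vertex decomposable through
    shellable and Cohen-Macaulay to gap-free and back; co-chordality is tied to gap-freeness in both
    directions.\<close>
  ultimately show ?thesis by blast
qed

end
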